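(* Let $G=(V,E)$ be a connected, locally finite graph, let $(\xi_t)_{t\ge0}$ be coalescing random walk on $G$ started with one particle at every vertex, let $v\in V$, and let $p_s(v)=\mathbf{P}(\xi_s(v)=1)$. For $t\geq 0$ let $\sigma_t=\inf\{s\ge t:\ \xi_s(v)=1\}\in[t,\infty]$ be the first time after $t$ that $v$ is occupied by a particle. Then for all $0\le t<u$, $$\mathbf{P}(\sigma_t>u)\ \le\ \frac{t}{t+\int_t^u p_s(v)\,ds}.$$ Moreover, if $G$ has maximum degree $D$ with $1\le D<\infty$, then for all $0\le t<u$, $$\mathbf{P}(\sigma_t>u)\ \le\ \frac{t}{t+\frac1D\bigl(\log(1+Du)-\log(1+Dt)\bigr)},$$ and for fixed $t$ the right-hand side is $O(1/\log u)$ as $u\to\infty$.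
   Context: Coalescing random walk on $G=(V,E)$: each undirected edge is replaced by two directed edges, and independent unit-intensity Poisson processes (in time) are attached to the directed edges. Initially there is one particle at each vertex. When the Poisson process of the directed edge $(u,w)$ rings, any particle at $u$ moves to $w$; if there is already a particle at $w$ the two merge into one and proceed together. (So a particle at $u$ jumps at total rate $\deg u$. A particle that makes infinitely many jumps in finite time is regarded as removed.) $\xi_t\in\{0,1\}^V$ denotes the configuration of occupied vertices at time $t$: $\xi_t(v)=1$ iff $v$ is occupied at time $t$. *)

theory Defs
  imports
    "HOL-Probability.Probability"
    "HOL-Library.Landau_Symbols"
    "Graph_Theory.Pair_Digraph"
    "Graph_Theory.Digraph_Component"
begin

text \<open>
  A simple undirected graph, finite or infinite, is a symmetric loop-free digraph whose arcs are
  ordered pairs (\<^locale>\<open>pair_bidirected_digraph\<close>): every undirected edge contributes two opposite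
  arcs. The degree of a vertex is thus its out-degree.
\<close>

definition locally_finite_graph :: "'v pair_pre_digraph \<Rightarrow> bool" where
  "locally_finite_graph G \<longleftrightarrow> (\<forall>x\<in>pverts G. finite (out_arcs G x))"

definition has_max_degree :: "'v pair_pre_digraph \<Rightarrow> nat \<Rightarrow> bool" where
  "has_max_degree G D \<longleftrightarrow>
     (\<forall>x\<in>pverts G. out_degree G x \<le> D) \<and> (\<exists>x\<in>pverts G. out_degree G x = D)"

text \<open>
  A homogeneous Poisson process on the positive half-line, as a random locally finite set of ring
  times: the numbers of rings in disjoint intervals are independent, and the number of rings in an
  interval is Poisson with mean the rate times its length. Ring times are locally finite surely,
  not just almost surely, as usual for counting processes.
\<close>

definition poisson_process :: "'w measure \<Rightarrow> real \<Rightarrow> ('w \<Rightarrow> real set) \<Rightarrow> bool" where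
  "poisson_process M rate T \<longleftrightarrow>
     (\<forall>\<omega>\<in>space M. T \<omega> \<subseteq> {0<..} \<and> (\<forall>b. finite (T \<omega> \<inter> {..b}))) \<and>
     (\<forall>a b. 0 \<le> a \<and> a < b \<longrightarrow>
        (\<lambda>\<omega>. card (T \<omega> \<inter> {a<..b})) \<in> M \<rightarrow>\<^sub>M count_space UNIV \<and>
        distr M (count_space UNIV) (\<lambda>\<omega>. card (T \<omega> \<inter> {a<..b}))
          = measure_pmf (poisson_pmf (rate * (b - a)))) \<and>
     (\<forall>s n. 0 \<le> s 0 \<and> mono s \<longrightarrow>
        prob_space.indep_vars M (\<lambda>_. count_space UNIV)
          (\<lambda>i \<omega>. card (T \<omega> \<inter> {s i<..s (Suc i)})) {..<n::nat})"

text \<open>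
  Unit-intensity Poisson clocks on the directed edges. They are independent as processes: each
  clock is regarded as a random element, via its counting function, of the space of functions
  from the nonnegative reals to \<^typ>\<open>nat\<close> with the product sigma-algebra.
\<close>

definition indep_unit_clocks ::
    "'w measure \<Rightarrow> 'v pair_pre_digraph \<Rightarrow> ('v \<times> 'v \<Rightarrow> 'w \<Rightarrow> real set) \<Rightarrow> bool" where
  "indep_unit_clocks M G T \<longleftrightarrow>
     (\<forall>e\<in>parcs G. poisson_process M 1 (T e)) \<and>
     prob_space.indep_vars M (\<lambda>_. \<Pi>\<^sub>M t\<in>{0::real..}. count_space (UNIV :: nat set))
       (\<lambda>e \<omega>. \<lambda>t\<in>{0..}. card (T e \<omega> \<inter> {0<..t})) (parcs G)"

text \<open>
  The dynamics for a given realisation \<open>R\<close> of the ring times. A particle at \<open>u\<close> follows the first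
  outgoing edge of \<open>u\<close> that rings. Two particles that meet see the same rings from then on and
  move together, so coalescence amounts to recording only whether a vertex is occupied.
  Since \<open>particle_arrives\<close> is inductive, it only sees finitely many jumps; a particle that has made
  infinitely many jumps by time \<open>t\<close> is nowhere at time \<open>t\<close>, i.e. it has been removed.
  Simultaneous rings of different clocks have probability zero and are not treated specially.
\<close>

definition out_rings :: "'v pair_pre_digraph \<Rightarrow> ('v \<times> 'v \<Rightarrow> real set) \<Rightarrow> 'v \<Rightarrow> real set" where
  "out_rings G R u = (\<Union>e\<in>out_arcs G u. R e)"

inductive particle_arrives ::
    "'v pair_pre_digraph \<Rightarrow> ('v \<times> 'v \<Rightarrow> real set) \<Rightarrow> 'v \<Rightarrow> real \<Rightarrow> 'v \<Rightarrow> bool"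
  for G R x where
  start: "particle_arrives G R x 0 x"
| jump: "particle_arrives G R x s u \<Longrightarrow> (u, w) \<in> parcs G \<Longrightarrow> s' \<in> R (u, w) \<Longrightarrow> s < s' \<Longrightarrow>
    out_rings G R u \<inter> {s<..<s'} = {} \<Longrightarrow> particle_arrives G R x s' w"

definition particle_at ::
    "'v pair_pre_digraph \<Rightarrow> ('v \<times> 'v \<Rightarrow> real set) \<Rightarrow> 'v \<Rightarrow> real \<Rightarrow> 'v \<Rightarrow> bool" where
  "particle_at G R x t v \<longleftrightarrow>
     (\<exists>s\<le>t. particle_arrives G R x s v \<and> out_rings G R v \<inter> {s<..t} = {})"

text \<open>The configuration of coalescing random walk from one particle at every vertex.\<close>

definition crw ::
    "'v pair_pre_digraph \<Rightarrow> ('v \<times> 'v \<Rightarrow> 'w \<Rightarrow> real set) \<Rightarrow> real \<Rightarrow> 'w \<Rightarrow> 'v \<Rightarrow> nat" where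
  "crw G T t \<omega> v = of_bool (\<exists>x\<in>pverts G. particle_at G (\<lambda>e. T e \<omega>) x t v)"

definition occ_prob ::
    "'w measure \<Rightarrow> 'v pair_pre_digraph \<Rightarrow> ('v \<times> 'v \<Rightarrow> 'w \<Rightarrow> real set) \<Rightarrow> 'v \<Rightarrow> real \<Rightarrow> real" where
  "occ_prob M G T v s = \<P>(\<omega> in M. crw G T s \<omega> v = 1)"

text \<open>In \<^typ>\<open>ereal\<close>, the infimum of the empty set is \<open>\<infinity>\<close>.\<close>

definition next_occ ::
    "'v pair_pre_digraph \<Rightarrow> ('v \<times> 'v \<Rightarrow> 'w \<Rightarrow> real set) \<Rightarrow> 'v \<Rightarrow> real \<Rightarrow> 'w \<Rightarrow> ereal" where
  "next_occ G T v t \<omega> = Inf (ereal ` {s. t \<le> s \<and> crw G T s \<omega> v = 1})"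

end

(*
  Suppose that v is occupied at time s by a particle of the process and that the process restarted
  at time s from the full configuration leaves v empty during [s + t, s + u]. By independence and
  stationarity of the clocks this has probability p_s(v) P(sigma_t > u), and since the restarted
  process dominates the original one, v is then empty during [s + t, s + u] in the latter as well.
  The times s in [t, u] at which v is occupied before such a gap have diameter at most t, and there
  are none of them if sigma_t > u. Integrating over s gives
  P(sigma_t > u) * (integral of p_s(v) over [t, u]) <= t * P(sigma_t <= u).

  For maximum degree D, let psi(t, A) be the probability that the finite set A is empty at time t.
  Revealing the rings of the last h time units replaces A by its dual: for each edge {u, w} of the
  boundary, the outer endpoint joins A at rate 1 and the inner endpoint leaves A at rate 1. As
  there are at most D |A| such edges, psi(t, A) <= q(t)^|A| with q' = D (1 - q)^2, q(0) = 0, that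
  is 1 - q(t) = 1 / (1 + D t), and p_t(v) = 1 - psi(t, {v}). The differential inequality is
  discretised with step h, with an error of order h |A|^2 that vanishes in the limit.
*)

theory Submission
  imports Defs "HOL-Real_Asymp.Real_Asymp"
begin

text \<open>The clocks are independent as counting paths, while the process is an inductive
  predicate over ring times at uncountably many times. Most of the work is to make "restart at time
  s" a statement about independent random elements. Two devices serve this. Occupation is written
  through countably many vertex paths, each with one arrival and one departure time, which gives
  measurability jointly in time and outcome. Ring times are read off the counting paths, so every
  event about rings is a measurable set of paths and can be evaluated for truncated and shifted
  clocks alike. All pathwise statements hold for every locally finite realisation, simultaneous
  rings included; no null set is removed. Of the duality only one implication is used, over one
  short window with at most one relevant ring: if A is empty at the end, then its dual set is empty
  at the start. No dual process over long times is built. The power \<open>q ^ n\<close> fits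
  because its second difference \<open>q ^ (n - 1) * (1 - q)\<^sup>2\<close> is nonnegative: the
  true boundary of A, which depends on its shape, may be replaced by the maximal value
  \<open>D * n\<close>, as for branching particles that do not interact.\<close>

section \<open>The dynamics for a fixed realisation of the rings\<close>

lemma out_rings_iff: "r \<in> out_rings G R u \<longleftrightarrow> (\<exists>w. (u, w) \<in> parcs G \<and> r \<in> R (u, w))"
  by (auto simp: out_rings_def out_arcs_def)

lemma out_rings_cong:
  assumes "\<And>e. e \<in> parcs G \<Longrightarrow> R e \<inter> B = R' e \<inter> B" and "X \<subseteq> B"
  shows "out_rings G R u \<inter> X = out_rings G R' u \<inter> X"
proof -
  have "(\<Union>e\<in>out_arcs G u. R e \<inter> B) = (\<Union>e\<in>out_arcs G u. R' e \<inter> B)"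
    using assms by (intro SUP_cong refl) (auto simp: out_arcs_def)
  then have "out_rings G R u \<inter> B = out_rings G R' u \<inter> B"
    by (simp add: out_rings_def)
  moreover have "A \<inter> X = A \<inter> B \<inter> X" for A
    using assms(2) by auto
  ultimately show ?thesis
    by metis
qed

text \<open>Stated for a bare family of ring sets, so that it can be evaluated at truncated, shifted
  and canonical clocks and not only at \<open>T\<close>.\<close>

definition occupied ::
    "'v pair_pre_digraph \<Rightarrow> ('v \<times> 'v \<Rightarrow> real set) \<Rightarrow> real \<Rightarrow> 'v \<Rightarrow> bool" where
  "occupied G R t v \<longleftrightarrow> (\<exists>x\<in>pverts G. particle_at G R x t v)"

lemma crw_eq_1_iff: "crw G T t \<omega> v = 1 \<longleftrightarrow> occupied G (\<lambda>e. T e \<omega>) t v"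
  by (simp add: crw_def occupied_def)

lemma particle_arrives_pverts:
  assumes "pair_wf_digraph G" "x \<in> pverts G"
  shows "particle_arrives G R x s v \<Longrightarrow> v \<in> pverts G"
  by (induction rule: particle_arrives.induct)
     (simp_all add: assms(2) pair_wf_digraph.in_arcsD2[OF assms(1)])

text \<open>Causality: a jump at time \<open>s'\<close> inspects rings up to \<open>s'\<close> only,
  and the earlier jumps of the same particle happen before \<open>s'\<close>, so the bound
  \<open>b\<close> passes down the induction.\<close>

lemma particle_arrives_cong:
  assumes "\<And>e. e \<in> parcs G \<Longrightarrow> R e \<inter> {..b} = R' e \<inter> {..b}"
  shows "particle_arrives G R x s v \<Longrightarrow> s \<le> b \<Longrightarrow> particle_arrives G R' x s v"
proof (induction rule: particle_arrives.induct)
  case start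
  show ?case by (rule particle_arrives.start)
next
  case (jump s u w s')
  have eq: "r \<in> R e \<longleftrightarrow> r \<in> R' e" if "e \<in> parcs G" "r \<le> b" for e r
    using assms[OF that(1)] that(2) by blast
  have "out_rings G R' u \<inter> {s<..<s'} = {}"
  proof -
    have "{s<..<s'} \<subseteq> {..b}"
      using jump.prems by auto
    then show ?thesis
      using jump.hyps(5) out_rings_cong[where G = G and R = R and R' = R' and u = u, OF assms] by simp
  qed
  moreover have "s' \<in> R' (u, w)"
    using jump eq by auto
  ultimately show ?case
    using jump by (intro particle_arrives.jump[of G R' x s u w s']) auto
qed

text \<open>Serves two purposes: with truncated rings it says that occupation at time
  \<open>t\<close> is an event of the past, and with equal rings that only the clocks of actual arcs
  are seen.\<close>

lemma occupied_cong:
  assumes "\<And>e. e \<in> parcs G \<Longrightarrow> R e \<inter> {..b} = R' e \<inter> {..b}" and "t \<le> b"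
  shows "occupied G R t v \<longleftrightarrow> occupied G R' t v"
proof -
  have *: "particle_at G R' x t v"
    if at: "particle_at G R x t v" and R: "\<And>e. e \<in> parcs G \<Longrightarrow> R e \<inter> {..b} = R' e \<inter> {..b}" for x R R'
  proof -
    from at obtain s where s: "s \<le> t" "particle_arrives G R x s v" "out_rings G R v \<inter> {s<..t} = {}"
      unfolding particle_at_def by auto
    have "particle_arrives G R' x s v"
      using particle_arrives_cong[OF R s(2)] s(1) assms(2) by simp
    moreover have "out_rings G R' v \<inter> {s<..t} = {}"
    proof -
      have "{s<..t} \<subseteq> {..b}"
        using assms(2) by auto
      then show ?thesis
        using s(3) out_rings_cong[where G = G and R = R and R' = R' and u = v, OF R] by simp
    qed
    ultimately show ?thesis
      using s(1) unfolding particle_at_def by blast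
  qed
  show ?thesis
    using *[of R _ R'] *[of R' _ R] assms(1) unfolding occupied_def by metis
qed

text \<open>The clock as seen by a process restarted at \<open>s\<close>. A ring at \<open>s\<close>
  itself is discarded and counts as past, in agreement with the truncation to
  \<open>{..s}\<close>.\<close>

definition shift_rings :: "real \<Rightarrow> real set \<Rightarrow> real set" where
  "shift_rings s A = {r. 0 < r \<and> s + r \<in> A}"

lemma out_rings_shift:
  "out_rings G (\<lambda>e. shift_rings s (R e)) u = shift_rings s (out_rings G R u)"
  by (auto simp: out_rings_def shift_rings_def)

text \<open>Wherever the particle stands at time \<open>s\<close>, the restarted process has a fresh
  particle on the same vertex; from then on both follow the same rings.\<close>

lemma particle_arrives_restart:
  assumes G: "pair_wf_digraph G" and x: "x \<in> pverts G"
  shows "particle_arrives G R x a w \<Longrightarrow> 0 \<le> s \<Longrightarrow> s < a \<Longrightarrow>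
    \<exists>y\<in>pverts G. particle_arrives G (\<lambda>e. shift_rings s (R e)) y (a - s) w"
proof (induction rule: particle_arrives.induct)
  case start
  then show ?case by simp
next
  case (jump a u w a')
  let ?R = "\<lambda>e. shift_rings s (R e)"
  have ring: "a' - s \<in> ?R (u, w)"
    using jump by (simp add: shift_rings_def)
  have quiet: "out_rings G ?R u \<inter> {b<..<a' - s} = {}" if "a - s \<le> b" for b
    proof (rule equals0I)
    fix r assume "r \<in> out_rings G ?R u \<inter> {b<..<a' - s}"
    then have "s + r \<in> out_rings G R u \<inter> {a<..<a'}"
      using that unfolding out_rings_shift by (auto simp: shift_rings_def)
    then show False
      using jump.hyps(5) by simp
  qed
  show ?case
  proof (cases "a \<le> s")
    case True
    \<comment> \<open>This jump straddles \<open>s\<close>: the particle waits at \<open>u\<close>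
      at time \<open>s\<close>, so the fresh particle starting from \<open>u\<close> makes the same
      jump.\<close>
    then have "particle_arrives G ?R u (a' - s) w"
      using jump ring quiet[of 0] by (intro particle_arrives.jump[OF particle_arrives.start]) auto
    then show ?thesis
      using particle_arrives_pverts[OF G x jump.hyps(1)] by blast
  next
    case False
    then obtain y where y: "y \<in> pverts G" "particle_arrives G ?R y (a - s) u"
      using jump.IH jump.prems by auto
    have "particle_arrives G ?R y (a' - s) w"
      by (rule particle_arrives.jump[OF y(2) jump.hyps(2) ring])
         (use jump.hyps(4) quiet[of "a - s"] in simp_all)
    then show ?thesis
      using y(1) by blast
  qed
qed

text \<open>Domination by the restarted process. A particle that has not jumped since
  \<open>s\<close> is replaced by the fresh particle at \<open>v\<close>, any other one by the
  particle that shares its jumps after \<open>s\<close>.\<close>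

lemma occupied_restart:
  assumes G: "pair_wf_digraph G" and "0 \<le> s" "0 \<le> r" and occ: "occupied G R (s + r) v"
  shows "occupied G (\<lambda>e. shift_rings s (R e)) r v"
proof -
  from occ obtain x a where x: "x \<in> pverts G" and a: "a \<le> s + r" "particle_arrives G R x a v"
    and quiet: "out_rings G R v \<inter> {a<..s + r} = {}"
    unfolding occupied_def particle_at_def by auto
  let ?R = "\<lambda>e. shift_rings s (R e)"
  have quiet': "out_rings G ?R v \<inter> {b<..r} = {}" if "a - s \<le> b" for b
  proof (rule equals0I)
    fix q assume "q \<in> out_rings G ?R v \<inter> {b<..r}"
    then have "s + q \<in> out_rings G R v \<inter> {a<..s + r}"
      using that unfolding out_rings_shift by (auto simp: shift_rings_def)
    then show False
      using quiet by simp
  qed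
  show ?thesis
  proof (cases "a \<le> s")
    case True
    have "particle_at G ?R v r v"
      unfolding particle_at_def using \<open>0 \<le> r\<close> quiet'[of 0] True
      by (intro exI[of _ 0]) (auto intro: particle_arrives.start)
    then show ?thesis
      using particle_arrives_pverts[OF G x a(2)] unfolding occupied_def by blast
  next
    case False
    then obtain y where "y \<in> pverts G" "particle_arrives G ?R y (a - s) v"
      using particle_arrives_restart[OF G x a(2) \<open>0 \<le> s\<close>] by auto
    then have "particle_at G ?R y r v"
      unfolding particle_at_def using a(1) quiet'[of "a - s"] by (intro exI[of _ "a - s"]) auto
    then show ?thesis
      using \<open>y \<in> pverts G\<close> unfolding occupied_def by blast
  qed
qed

lemma occupied_0: "v \<in> pverts G \<Longrightarrow> occupied G R 0 v"
  unfolding occupied_def particle_at_def by (auto intro!: bexI[of _ v] particle_arrives.start)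

lemma occupied_stay:
  assumes "occupied G R r v" "r \<le> r'" "out_rings G R v \<inter> {r<..r'} = {}"
  shows "occupied G R r' v"
proof -
  from assms(1) obtain x s where x: "x \<in> pverts G" and s: "s \<le> r" "particle_arrives G R x s v"
    and quiet: "out_rings G R v \<inter> {s<..r} = {}"
    unfolding occupied_def particle_at_def by auto
  have "{s<..r'} = {s<..r} \<union> {r<..r'}"
    using s(1) assms(2) by auto
  then have "out_rings G R v \<inter> {s<..r'} = {}"
    using quiet assms(3) by auto
  then show ?thesis
    using s assms(2) unfolding occupied_def particle_at_def
    by (intro bexI[OF _ x] exI[of _ s]) auto
qed

text \<open>The silent interval of \<open>w\<close> is open at \<open>a\<close> because a particle
  reacts only to rings strictly after its arrival.\<close>

lemma occupied_move:
  assumes "occupied G R r u" and arc: "(u, w) \<in> parcs G" and ring: "a \<in> R (u, w)" "r < a" "a \<le> r'"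
    and u: "out_rings G R u \<inter> {r<..<a} = {}" and w: "out_rings G R w \<inter> {a<..r'} = {}"
  shows "occupied G R r' w"
proof -
  from assms(1) obtain x s where x: "x \<in> pverts G" and s: "s \<le> r" "particle_arrives G R x s u"
    and quiet: "out_rings G R u \<inter> {s<..r} = {}"
    unfolding occupied_def particle_at_def by auto
  have "{s<..<a} = {s<..r} \<union> {r<..<a}"
    using s(1) ring by auto
  then have "out_rings G R u \<inter> {s<..<a} = {}"
    using quiet u by auto
  then have "particle_arrives G R x a w"
    using s ring arc by (intro particle_arrives.jump[OF s(2)]) auto
  then show ?thesis
    using x w ring unfolding occupied_def particle_at_def by blast
qed

section \<open>Occupation through countably many vertex paths\<close>

definition loc_fin_rings :: "'e set \<Rightarrow> ('e \<Rightarrow> real set) \<Rightarrow> bool" where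
  "loc_fin_rings E R \<longleftrightarrow> (\<forall>e\<in>E. R e \<subseteq> {0<..} \<and> (\<forall>b. finite (R e \<inter> {..b})))"

text \<open>Extended reals serve twice: a clock without further rings gives
  \<open>\<infinity>\<close>, and an infinite starting time is passed on as
  \<open>\<infinity>\<close>.\<close>

definition next_ring :: "real set \<Rightarrow> ereal \<Rightarrow> ereal" where
  "next_ring A a = Inf {ereal r |r. r \<in> A \<and> a < ereal r}"

lemma next_ring_less_iff: "next_ring A a < b \<longleftrightarrow> (\<exists>r\<in>A. a < ereal r \<and> ereal r < b)"
  unfolding next_ring_def Inf_less_iff by auto

lemma next_ring_lower: "r \<in> A \<Longrightarrow> a < ereal r \<Longrightarrow> next_ring A a \<le> ereal r"
  unfolding next_ring_def by (rule Inf_lower) auto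

lemma next_ring_greatest:
  "(\<And>r. r \<in> A \<Longrightarrow> a < ereal r \<Longrightarrow> b \<le> ereal r) \<Longrightarrow> b \<le> next_ring A a"
  unfolding next_ring_def by (rule Inf_greatest) auto

lemma le_next_ring: "a \<le> next_ring A a"
  by (rule next_ring_greatest) simp

lemma next_ring_attained:
  assumes fin: "\<And>b. finite (A \<inter> {..b})" and less: "next_ring A a < \<infinity>"
  obtains r where "r \<in> A" "a < ereal r" "next_ring A a = ereal r"
proof -
  obtain r0 where r0: "r0 \<in> A" "a < ereal r0"
    using less unfolding next_ring_less_iff by auto
  let ?S = "{r \<in> A. a < ereal r \<and> r \<le> r0}"
  have S: "finite ?S" "?S \<noteq> {}"
    using r0 by (auto intro: finite_subset[OF _ fin[of r0]])
  define m where "m = Min ?S"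
  have m: "m \<in> ?S"
    using Min_in[OF S] unfolding m_def .
  have min: "m \<le> r" if "r \<in> A" "a < ereal r" for r
  proof (cases "r \<le> r0")
    case True
    then show ?thesis
      unfolding m_def using that S by (intro Min_le) auto
  next
    case False
    then show ?thesis
      using m by auto
  qed
  have "next_ring A a = ereal m"
    using m min by (intro antisym next_ring_lower next_ring_greatest) auto
  then show ?thesis
    using that m by blast
qed

text \<open>Strict inequality survives the infimum because local finiteness makes the infimum a
  minimum whenever it is finite.\<close>

lemma less_next_ring_iff:
  assumes "\<And>b. finite (A \<inter> {..b})"
  shows "ereal t < next_ring A a \<longleftrightarrow> (\<forall>r\<in>A. a < ereal r \<longrightarrow> t < r)"
proof
  assume "ereal t < next_ring A a"
  then show "\<forall>r\<in>A. a < ereal r \<longrightarrow> t < r"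
    using next_ring_lower[of _ A a] by (metis less_ereal.simps(1) less_le_trans)
next
  assume *: "\<forall>r\<in>A. a < ereal r \<longrightarrow> t < r"
  show "ereal t < next_ring A a"
  proof (cases "next_ring A a < \<infinity>")
    case True
    then obtain r where "r \<in> A" "a < ereal r" "next_ring A a = ereal r"
      using next_ring_attained[OF assms] by blast
    then show ?thesis
      using * by simp
  qed simp
qed

text \<open>Paths are reversed: the particle starts at \<open>last p\<close> and arrives at \<open>hd p\<close>. The time is \<open>\<infinity>\<close>
  if the particle does not follow this path.\<close>

fun arrival :: "'v pair_pre_digraph \<Rightarrow> ('v \<times> 'v \<Rightarrow> real set) \<Rightarrow> 'v list \<Rightarrow> ereal" where
  "arrival G R [] = \<infinity>"
| "arrival G R [x] = 0"
| "arrival G R (w # u # p) =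
    (if (u, w) \<in> parcs G \<and>
        (\<forall>e\<in>out_arcs G u. next_ring (R (u, w)) (arrival G R (u # p)) \<le> next_ring (R e) (arrival G R (u # p)))
     then next_ring (R (u, w)) (arrival G R (u # p)) else \<infinity>)"

text \<open>A particle that follows \<open>p\<close> sits at \<open>hd p\<close> exactly during the
  half-open interval from arrival to departure. At a vertex without arcs the infimum is empty, hence
  \<open>\<infinity>\<close>: the particle stays for ever.\<close>

definition departure :: "'v pair_pre_digraph \<Rightarrow> ('v \<times> 'v \<Rightarrow> real set) \<Rightarrow> 'v list \<Rightarrow> ereal" where
  "departure G R p = (INF e\<in>out_arcs G (hd p). next_ring (R e) (arrival G R p))"

lemma arrival_nonneg: "0 \<le> arrival G R p"
proof (induction G R p rule: arrival.induct)
  case (3 G R w u p)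
  then show ?case
    using le_next_ring[of "arrival G R (u # p)" "R (u, w)"] by auto
qed auto

lemma particle_arrives_imp_arrival:
  assumes G: "pair_wf_digraph G" and x: "x \<in> pverts G"
  shows "particle_arrives G R x s v \<Longrightarrow>
    \<exists>p\<in>lists (pverts G). p \<noteq> [] \<and> hd p = v \<and> arrival G R p = ereal s"
proof (induction rule: particle_arrives.induct)
  case start
  show ?case
    using x by (intro bexI[of _ "[x]"]) (auto simp: zero_ereal_def)
next
  case (jump s u w s')
  then obtain p where p: "p \<in> lists (pverts G)" "p \<noteq> []" "hd p = u" "arrival G R p = ereal s"
    by auto
  then obtain p' where p': "p = u # p'"
    by (cases p) auto
  have quiet: "s' \<le> r" if "e \<in> out_arcs G u" "r \<in> R e" "s < r" for e r
  proof (rule ccontr)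
    assume "\<not> s' \<le> r"
    then have "r \<in> out_rings G R u \<inter> {s<..<s'}"
      using that by (auto simp: out_rings_def)
    then show False
      using jump.hyps(5) by simp
  qed
  have ge: "ereal s' \<le> next_ring (R e) (ereal s)" if "e \<in> out_arcs G u" for e
    using quiet[OF that] by (intro next_ring_greatest) simp
  have uw: "(u, w) \<in> out_arcs G u"
    using jump.hyps(2) by (simp add: out_arcs_def)
  have eq: "next_ring (R (u, w)) (ereal s) = ereal s'"
    using jump.hyps ge[OF uw] by (intro antisym next_ring_lower) auto
  have "arrival G R (w # p) = ereal s'"
    using ge p(4) jump.hyps(2) unfolding p' by (simp add: eq)
  moreover have "w \<in> pverts G"
    using pair_wf_digraph.in_arcsD2[OF G jump.hyps(2)] .
  ultimately show ?case
    using p(1) by (intro bexI[of _ "w # p"]) auto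
qed

text \<open>Local finiteness turns a finite value of \<open>next_ring\<close> into an actual ring,
  which is the ring that the rule \<open>jump\<close> asks for.\<close>

lemma arrival_imp_particle_arrives:
  assumes fin: "loc_fin_rings (parcs G) R"
  shows "p \<noteq> [] \<Longrightarrow> arrival G R p = ereal s \<Longrightarrow> particle_arrives G R (last p) s (hd p)"
proof (induction p arbitrary: s rule: induct_list012)
  case (2 x)
  then have "s = 0"
    by (simp add: zero_ereal_def)
  then show ?case
    by (simp add: particle_arrives.start)
next
  case (3 w u p)
  let ?a = "arrival G R (u # p)"
  have arc: "(u, w) \<in> parcs G" and s: "next_ring (R (u, w)) ?a = ereal s"
    and min: "\<And>e. e \<in> out_arcs G u \<Longrightarrow> ereal s \<le> next_ring (R e) ?a"
    using 3(4) by (auto split: if_splits)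
  have "finite (R (u, w) \<inter> {..b})" for b
    using fin arc unfolding loc_fin_rings_def by blast
  then obtain r where r: "r \<in> R (u, w)" "?a < ereal r" "next_ring (R (u, w)) ?a = ereal r"
    by (rule next_ring_attained[of "R (u, w)" ?a]) (simp add: s)
  then have [simp]: "r = s"
    using s by simp
  obtain a where a: "?a = ereal a"
    using r(2) arrival_nonneg[of G R "u # p"] by (cases ?a) auto
  have "out_rings G R u \<inter> {a<..<s} = {}"
  proof (rule equals0I)
    fix q assume q: "q \<in> out_rings G R u \<inter> {a<..<s}"
    then obtain e where e: "e \<in> out_arcs G u" "q \<in> R e"
      by (auto simp: out_rings_def)
    have "ereal s \<le> ereal q"
      by (rule order_trans[OF min[OF e(1)] next_ring_lower[OF e(2)]]) (use q a in simp)
    then show False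
      using q by simp
  qed
  moreover have "particle_arrives G R (last (u # p)) a u"
    using 3(2)[of a] a by simp
  ultimately have "particle_arrives G R (last (u # p)) s w"
    using r arc unfolding a by (intro particle_arrives.jump[of G R _ a u w s]) auto
  then show ?case
    by simp
qed simp

lemma less_INF_finite_iff:
  fixes f :: "'a \<Rightarrow> ereal"
  assumes "finite A"
  shows "ereal t < (INF x\<in>A. f x) \<longleftrightarrow> (\<forall>x\<in>A. ereal t < f x)"
  using assms by (induction rule: finite_induct) (auto simp: inf_min top_ereal_def)

text \<open>The arrival and departure times on the right do not involve \<open>t\<close>, and the
  paths form a countable set if the vertices do. Measurability in time and outcome together then
  reduces to that of countably many random variables.\<close>

lemma occupied_iff_paths:
  assumes G: "pair_wf_digraph G" and lf: "locally_finite_graph G" and v: "v \<in> pverts G"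
    and fin: "loc_fin_rings (parcs G) R"
  shows "occupied G R t v \<longleftrightarrow>
    (\<exists>p\<in>{p\<in>lists (pverts G). p \<noteq> [] \<and> hd p = v}. arrival G R p \<le> ereal t \<and> ereal t < departure G R p)"
proof -
  have quiet_iff: "ereal t < (INF e\<in>out_arcs G v. next_ring (R e) (ereal s)) \<longleftrightarrow>
      out_rings G R v \<inter> {s<..t} = {}" for s
  proof -
    have "finite (out_arcs G v)"
      using lf v unfolding locally_finite_graph_def by simp
    then have "ereal t < (INF e\<in>out_arcs G v. next_ring (R e) (ereal s)) \<longleftrightarrow>
        (\<forall>e\<in>out_arcs G v. ereal t < next_ring (R e) (ereal s))"
      by (rule less_INF_finite_iff)
    also have "\<dots> \<longleftrightarrow> (\<forall>e\<in>out_arcs G v. \<forall>r\<in>R e. s < r \<longrightarrow> t < r)"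
    proof (intro ball_cong refl)
      fix e assume "e \<in> out_arcs G v"
      then have "finite (R e \<inter> {..b})" for b
        using fin unfolding loc_fin_rings_def out_arcs_def by auto
      then show "ereal t < next_ring (R e) (ereal s) \<longleftrightarrow> (\<forall>r\<in>R e. s < r \<longrightarrow> t < r)"
        by (simp add: less_next_ring_iff)
    qed
    also have "\<dots> \<longleftrightarrow> out_rings G R v \<inter> {s<..t} = {}"
      unfolding out_rings_def by (auto simp: disjoint_iff not_le)
    finally show ?thesis .
  qed
  show ?thesis
  proof
    assume "occupied G R t v"
    then obtain x s where x: "x \<in> pverts G" and s: "s \<le> t" "particle_arrives G R x s v"
      and quiet: "out_rings G R v \<inter> {s<..t} = {}"
      unfolding occupied_def particle_at_def by auto
    obtain p where p: "p\<in>lists (pverts G)" "p \<noteq> []" "hd p = v" "arrival G R p = ereal s"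
      using particle_arrives_imp_arrival[OF G x s(2)] by auto
    then show "\<exists>p\<in>{p\<in>lists (pverts G). p \<noteq> [] \<and> hd p = v}. arrival G R p \<le> ereal t \<and> ereal t < departure G R p"
      using s(1) quiet quiet_iff[of s] by (intro bexI[of _ p]) (auto simp: departure_def)
  next
    assume "\<exists>p\<in>{p\<in>lists (pverts G). p \<noteq> [] \<and> hd p = v}. arrival G R p \<le> ereal t \<and> ereal t < departure G R p"
    then obtain p where p: "p\<in>lists (pverts G)" "p \<noteq> []" "hd p = v"
      and le: "arrival G R p \<le> ereal t" "ereal t < departure G R p"
      by blast
    obtain s where s: "arrival G R p = ereal s"
      using le(1) arrival_nonneg[of G R p] by (cases "arrival G R p") auto
    have "particle_arrives G R (last p) s v"
      using arrival_imp_particle_arrives[OF fin p(2) s] p(3) by simp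
    moreover have "last p \<in> pverts G"
      using p last_in_set by blast
    ultimately show "occupied G R t v"
      using le quiet_iff[of s] p(3) s unfolding occupied_def particle_at_def departure_def
      by (intro bexI[of _ "last p"] exI[of _ s]) auto
  qed
qed

section \<open>Measurability\<close>

text \<open>No probability is mentioned: the same measurability results are applied to
  \<open>M\<close> and to the canonical space of counting paths.\<close>

definition clock_space :: "'w measure \<Rightarrow> 'e set \<Rightarrow> ('e \<Rightarrow> 'w \<Rightarrow> real set) \<Rightarrow> bool" where
  "clock_space M E T \<longleftrightarrow> (\<forall>\<omega>\<in>space M. loc_fin_rings E (\<lambda>e. T e \<omega>)) \<and>
    (\<forall>e\<in>E. \<forall>t\<ge>0. (\<lambda>\<omega>. card (T e \<omega> \<inter> {0<..t})) \<in> M \<rightarrow>\<^sub>M count_space UNIV)"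

text \<open>A ring between \<open>a\<close> and \<open>b\<close> is enclosed by rationals
  \<open>q < r \<le> q'\<close> and betrays itself by an increase of the counting function. This
  expresses the event by countably many counts.\<close>

lemma next_ring_less_iff_count:
  assumes A: "A \<subseteq> {0<..}" "\<And>b. finite (A \<inter> {..b})"
  shows "next_ring A a < b \<longleftrightarrow> (\<exists>q\<in>\<rat> \<inter> {0..}. \<exists>q'\<in>\<rat> \<inter> {0..}. q < q' \<and> ereal q' < b \<and> a \<le> ereal q \<and>
    card (A \<inter> {0<..q}) < card (A \<inter> {0<..q'}))"
proof -
  have fin: "finite (A \<inter> {0<..q})" for q
    by (rule finite_subset[OF _ A(2)[of q]]) auto
  show ?thesis
  proof
    assume "next_ring A a < b"
    then obtain r where r: "r \<in> A" "a < ereal r" "ereal r < b"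
      unfolding next_ring_less_iff by blast
    have "0 < r"
      using r A by auto
    \<comment> \<open>A real substitute for \<open>a\<close>, which may be
      \<open>-\<infinity>\<close>; then any number below \<open>r\<close> will do. The maximum with
      0 below keeps \<open>q\<close> where counts are available.\<close>
    obtain c where c: "a \<le> ereal c" "c < r"
      using r(2) by (cases a) (auto intro: that[of "r - 1"])
    obtain q where q: "q \<in> \<rat>" "max 0 c < q" "q < r"
      using Rats_dense_in_real[of "max 0 c" r] c \<open>0 < r\<close> by auto
    obtain d where d: "r < d" "ereal d \<le> b"
      using r(3) by (cases b) (auto intro: that[of "r + 1"])
    obtain q' where q': "q' \<in> \<rat>" "r < q'" "q' < d"
      using Rats_dense_in_real[of r d] d by auto
    have "r \<in> A \<inter> {0<..q'}" "r \<notin> A \<inter> {0<..q}"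
      using r(1) q q' \<open>0 < r\<close> by auto
    moreover have "A \<inter> {0<..q} \<subseteq> A \<inter> {0<..q'}"
      using q q' by auto
    ultimately have "A \<inter> {0<..q} \<subset> A \<inter> {0<..q'}"
      by blast
    then have "card (A \<inter> {0<..q}) < card (A \<inter> {0<..q'})"
      by (rule psubset_card_mono[OF fin])
    moreover have "ereal q' < b"
      by (rule less_le_trans[OF _ d(2)]) (use q'(3) in simp)
    moreover have "a \<le> ereal q"
      by (rule order_trans[OF c(1)]) (use q(2) in simp)
    ultimately show "\<exists>q\<in>\<rat> \<inter> {0..}. \<exists>q'\<in>\<rat> \<inter> {0..}. q < q' \<and> ereal q' < b \<and> a \<le> ereal q \<and>
        card (A \<inter> {0<..q}) < card (A \<inter> {0<..q'})"
      using q q' by (intro bexI[of _ q] bexI[of _ q']) auto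
  next
    assume "\<exists>q\<in>\<rat> \<inter> {0..}. \<exists>q'\<in>\<rat> \<inter> {0..}. q < q' \<and> ereal q' < b \<and> a \<le> ereal q \<and>
        card (A \<inter> {0<..q}) < card (A \<inter> {0<..q'})"
    then obtain q q' where q: "0 \<le> q" "q < q'" "ereal q' < b" "a \<le> ereal q"
      and card: "card (A \<inter> {0<..q}) < card (A \<inter> {0<..q'})"
      by auto
    have "\<not> A \<inter> {0<..q'} \<subseteq> A \<inter> {0<..q}"
    proof
      assume "A \<inter> {0<..q'} \<subseteq> A \<inter> {0<..q}"
      then have "card (A \<inter> {0<..q'}) \<le> card (A \<inter> {0<..q})"
        by (rule card_mono[OF fin])
      then show False
        using card by simp
    qed
    then obtain r where "r \<in> A \<inter> {0<..q'}" "r \<notin> A \<inter> {0<..q}"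
      by blast
    then have "r \<in> A" "q < r" "r \<le> q'"
      by auto
    moreover have "a < ereal r"
      by (rule le_less_trans[OF q(4)]) (use \<open>q < r\<close> in simp)
    moreover have "ereal r < b"
      by (rule le_less_trans[OF _ q(3)]) (use \<open>r \<le> q'\<close> in simp)
    ultimately show "next_ring A a < b"
      unfolding next_ring_less_iff by blast
  qed
qed

text \<open>The starting time is random too. In the rational description it meets the counts only
  through \<open>a \<omega> \<le> ereal q\<close>, so each rational pair contributes an intersection
  of two measurable events.\<close>

lemma next_ring_measurable:
  assumes A: "\<And>\<omega>. \<omega> \<in> space M \<Longrightarrow> A \<omega> \<subseteq> {0<..} \<and> (\<forall>b. finite (A \<omega> \<inter> {..b}))"
    and N: "\<And>t. 0 \<le> t \<Longrightarrow> (\<lambda>\<omega>. card (A \<omega> \<inter> {0<..t})) \<in> M \<rightarrow>\<^sub>M count_space UNIV"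
    and a [measurable]: "a \<in> borel_measurable M"
  shows "(\<lambda>\<omega>. next_ring (A \<omega>) (a \<omega>)) \<in> borel_measurable M"
proof (rule borel_measurableI_less)
  fix b :: ereal
  let ?Q = "\<rat> \<inter> {0..} :: real set"
  have Q: "countable ?Q"
    by (simp add: countable_Int1 countable_rat)
  have "{\<omega> \<in> space M. next_ring (A \<omega>) (a \<omega>) < b} =
    {\<omega> \<in> space M. \<exists>q\<in>?Q. \<exists>q'\<in>?Q. q < q' \<and> ereal q' < b \<and> a \<omega> \<le> ereal q \<and>
      card (A \<omega> \<inter> {0<..q}) < card (A \<omega> \<inter> {0<..q'})}"
    using A by (intro Collect_cong conj_cong refl next_ring_less_iff_count) auto
  also have "\<dots> \<in> sets M"
  proof -
    have *: "Measurable.pred M (\<lambda>\<omega>. q < q' \<and> ereal q' < b \<and> a \<omega> \<le> ereal q \<and>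
      card (A \<omega> \<inter> {0<..q}) < card (A \<omega> \<inter> {0<..q'}))" if "q \<in> ?Q" "q' \<in> ?Q" for q q'
    proof -
      have "(\<lambda>\<omega>. real (card (A \<omega> \<inter> {0<..r}))) \<in> borel_measurable M" if "r \<in> ?Q" for r
        using that by (intro measurable_compose[OF N]) auto
      then have [measurable]: "(\<lambda>\<omega>. real (card (A \<omega> \<inter> {0<..q}))) \<in> borel_measurable M"
          "(\<lambda>\<omega>. real (card (A \<omega> \<inter> {0<..q'}))) \<in> borel_measurable M"
        using \<open>q \<in> ?Q\<close> \<open>q' \<in> ?Q\<close> by blast+
      have "Measurable.pred M (\<lambda>\<omega>. real (card (A \<omega> \<inter> {0<..q})) < real (card (A \<omega> \<inter> {0<..q'})))"
        by measurable
      moreover have "Measurable.pred M (\<lambda>\<omega>. a \<omega> \<le> ereal q)"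
        by measurable
      ultimately show ?thesis
        unfolding of_nat_less_iff by (intro pred_intros_logic) simp_all
    qed
    have "Measurable.pred M (\<lambda>\<omega>. \<exists>q\<in>?Q. \<exists>q'\<in>?Q. q < q' \<and> ereal q' < b \<and> a \<omega> \<le> ereal q \<and>
      card (A \<omega> \<inter> {0<..q}) < card (A \<omega> \<inter> {0<..q'}))"
      by (intro measurable_pred_countable(2)[OF Q] *)
    then show ?thesis
      by (simp add: pred_def)
  qed
  finally show "{\<omega> \<in> space M. next_ring (A \<omega>) (a \<omega>) < b} \<in> sets M" .
qed

lemma next_ring_clock_measurable:
  assumes "clock_space M E T" "e \<in> E" "a \<in> borel_measurable M"
  shows "(\<lambda>\<omega>. next_ring (T e \<omega>) (a \<omega>)) \<in> borel_measurable M"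
  using assms by (intro next_ring_measurable) (auto simp: clock_space_def loc_fin_rings_def)

lemma arrival_measurable:
  assumes T: "clock_space M (parcs G) T" and lf: "locally_finite_graph G"
  shows "p \<in> lists (pverts G) \<Longrightarrow> (\<lambda>\<omega>. arrival G (\<lambda>e. T e \<omega>) p) \<in> borel_measurable M"
proof (induction p rule: induct_list012)
  case (3 w u p)
  let ?a = "\<lambda>\<omega>. arrival G (\<lambda>e. T e \<omega>) (u # p)"
  have a: "?a \<in> borel_measurable M"
    using 3 by simp
  have out: "e \<in> parcs G" if "e \<in> out_arcs G u" for e
    using that by (simp add: out_arcs_def)
  have fin: "countable (out_arcs G u)"
    using 3 lf unfolding locally_finite_graph_def by (auto intro: countable_finite)
  show ?case
  proof (cases "(u, w) \<in> parcs G")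
    case True
    have [measurable]: "(\<lambda>\<omega>. next_ring (T e \<omega>) (?a \<omega>)) \<in> borel_measurable M" if "e \<in> parcs G" for e
      by (rule next_ring_clock_measurable[OF T that a])
    have [measurable]: "(\<lambda>\<omega>. next_ring (T (u, w) \<omega>) (?a \<omega>)) \<in> borel_measurable M"
      using True by measurable
    have [measurable]: "Measurable.pred M (\<lambda>\<omega>. \<forall>e\<in>out_arcs G u. next_ring (T (u, w) \<omega>) (?a \<omega>) \<le> next_ring (T e \<omega>) (?a \<omega>))"
    proof (intro measurable_pred_countable fin)
      fix e assume "e \<in> out_arcs G u"
      then have [measurable]: "(\<lambda>\<omega>. next_ring (T e \<omega>) (?a \<omega>)) \<in> borel_measurable M"
        using next_ring_clock_measurable[OF T _ a] out by blast
      show "Measurable.pred M (\<lambda>\<omega>. next_ring (T (u, w) \<omega>) (?a \<omega>) \<le> next_ring (T e \<omega>) (?a \<omega>))"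
        by measurable
    qed
    show ?thesis
      unfolding arrival.simps by measurable
  qed simp
qed simp_all

lemma departure_measurable:
  assumes T: "clock_space M (parcs G) T" and lf: "locally_finite_graph G"
    and p: "p \<in> lists (pverts G)" "p \<noteq> []"
  shows "(\<lambda>\<omega>. departure G (\<lambda>e. T e \<omega>) p) \<in> borel_measurable M"
  unfolding departure_def
proof (rule borel_measurable_INF)
  have "hd p \<in> pverts G"
    using p by (cases p) auto
  then show "countable (out_arcs G (hd p))"
    using lf unfolding locally_finite_graph_def by (auto intro: countable_finite)
  show "(\<lambda>\<omega>. next_ring (T e \<omega>) (arrival G (\<lambda>e. T e \<omega>) p)) \<in> borel_measurable M" if "e \<in> out_arcs G (hd p)" for e
    using that by (intro next_ring_clock_measurable[OF T] arrival_measurable[OF T lf p(1)]) (simp add: out_arcs_def)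
qed

definition paths_to :: "'v pair_pre_digraph \<Rightarrow> 'v \<Rightarrow> 'v list set" where
  "paths_to G v = {p\<in>lists (pverts G). p \<noteq> [] \<and> hd p = v}"

lemma countable_paths_to: "countable (pverts G) \<Longrightarrow> countable (paths_to G v)"
  unfolding paths_to_def by (rule countable_subset[of _ "lists (pverts G)"]) (auto intro: countable_lists)

text \<open>Connectedness enters through the countability of the vertex set, which makes
  \<open>paths_to\<close> countable.\<close>

locale crw_graph = pair_bidirected_digraph G for G :: "'v pair_pre_digraph" +
  assumes locfin: "locally_finite_graph G" and countable_verts: "countable (pverts G)"

lemma (in crw_graph) occupied_iff:
  assumes "v \<in> pverts G" "loc_fin_rings (parcs G) R"
  shows "occupied G R t v \<longleftrightarrow> (\<exists>p\<in>paths_to G v. arrival G R p \<le> ereal t \<and> ereal t < departure G R p)"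
  unfolding paths_to_def by (rule occupied_iff_paths[OF _ locfin assms]) unfold_locales

definition next_occupied :: "'v pair_pre_digraph \<Rightarrow> ('v \<times> 'v \<Rightarrow> real set) \<Rightarrow> 'v \<Rightarrow> real \<Rightarrow> ereal" where
  "next_occupied G R v t = Inf (ereal ` {s. t \<le> s \<and> occupied G R s v})"

lemma next_occ_eq: "next_occ G T v t \<omega> = next_occupied G (\<lambda>e. T e \<omega>) v t"
  unfolding next_occ_def next_occupied_def crw_eq_1_iff by (rule refl)

text \<open>A path occupies \<open>v\<close> during a half-open interval, whose first point not
  before \<open>t\<close> is \<open>max t arrival\<close> if that still precedes the departure. The
  infimum over uncountably many times becomes one over countably many paths.\<close>

lemma (in crw_graph) next_occupied_eq_INF:
  assumes "v \<in> pverts G" "loc_fin_rings (parcs G) R"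
  shows "next_occupied G R v t = (INF p\<in>paths_to G v.
    if max (ereal t) (arrival G R p) < departure G R p then max (ereal t) (arrival G R p) else \<infinity>)"
    (is "_ = (INF p\<in>_. ?f p)")
proof (rule antisym)
  show "next_occupied G R v t \<le> (INF p\<in>paths_to G v. ?f p)"
  proof (rule INF_greatest)
    fix p assume p: "p \<in> paths_to G v"
    show "next_occupied G R v t \<le> ?f p"
    proof (cases "max (ereal t) (arrival G R p) < departure G R p")
      case True
      then obtain s where s: "max (ereal t) (arrival G R p) = ereal s"
        using arrival_nonneg[of G R p] by (cases "max (ereal t) (arrival G R p)") (auto simp: max_def split: if_splits)
      have "arrival G R p \<le> ereal s" "ereal t \<le> ereal s"
        unfolding s[symmetric] by simp_all
      moreover have "ereal s < departure G R p"
        using True s by simp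
      ultimately have "occupied G R s v" "t \<le> s"
        using occupied_iff[OF assms] p by auto
      then have "next_occupied G R v t \<le> ereal s"
        unfolding next_occupied_def by (intro Inf_lower) auto
      then show ?thesis
        using True s by simp
    next
      case False
      then show ?thesis
        unfolding if_not_P[OF False] by simp
    qed
  qed
  show "(INF p\<in>paths_to G v. ?f p) \<le> next_occupied G R v t"
    unfolding next_occupied_def
  proof (rule Inf_greatest)
    fix x assume "x \<in> ereal ` {s. t \<le> s \<and> occupied G R s v}"
    then obtain s where s: "x = ereal s" "t \<le> s" "occupied G R s v"
      by auto
    then obtain p where p: "p \<in> paths_to G v" "arrival G R p \<le> ereal s" "ereal s < departure G R p"
      using occupied_iff[OF assms] by blast
    have le: "max (ereal t) (arrival G R p) \<le> ereal s"
      using s p by simp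
    then have "?f p \<le> x"
      using le_less_trans[OF le p(3)] s(1) by simp
    then show "(INF p\<in>paths_to G v. ?f p) \<le> x"
      using p(1) by (rule INF_lower2[rotated])
  qed
qed

context crw_graph
begin

context
  fixes M :: "'w measure" and T :: "'v \<times> 'v \<Rightarrow> 'w \<Rightarrow> real set" and v :: 'v
  assumes T: "clock_space M (parcs G) T" and v: "v \<in> pverts G"
begin

lemma measurable_arrival_departure:
  assumes "p \<in> paths_to G v"
  shows "(\<lambda>\<omega>. arrival G (\<lambda>e. T e \<omega>) p) \<in> borel_measurable M"
    and "(\<lambda>\<omega>. departure G (\<lambda>e. T e \<omega>) p) \<in> borel_measurable M"
  using assms unfolding paths_to_def
  by (auto intro!: arrival_measurable departure_measurable T locfin)

text \<open>Measurability in the pair of time and outcome, not only for fixed time: the exchange of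
  the integral over \<open>s\<close> with the expectation rests on it, as does the measurability of
  the occupation probability in \<open>s\<close>.\<close>

lemma pred_occupied:
  "Measurable.pred (borel \<Otimes>\<^sub>M M) (\<lambda>x. occupied G (\<lambda>e. T e (snd x)) (fst x) v)"
proof -
  have *: "Measurable.pred (borel \<Otimes>\<^sub>M M) (\<lambda>x. arrival G (\<lambda>e. T e (snd x)) p \<le> ereal (fst x) \<and>
      ereal (fst x) < departure G (\<lambda>e. T e (snd x)) p)" if "p \<in> paths_to G v" for p
  proof -
    note [measurable] = measurable_arrival_departure[OF that]
    have [measurable]: "(\<lambda>x. arrival G (\<lambda>e. T e (snd x)) p) \<in> borel_measurable (borel \<Otimes>\<^sub>M M)"
      "(\<lambda>x. departure G (\<lambda>e. T e (snd x)) p) \<in> borel_measurable (borel \<Otimes>\<^sub>M M)"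
      by (rule measurable_compose[OF measurable_snd]; measurable)+
    show ?thesis
      by measurable
  qed
  have "Measurable.pred (borel \<Otimes>\<^sub>M M) (\<lambda>x. \<exists>p\<in>paths_to G v.
      arrival G (\<lambda>e. T e (snd x)) p \<le> ereal (fst x) \<and> ereal (fst x) < departure G (\<lambda>e. T e (snd x)) p)"
    by (intro measurable_pred_countable(2) countable_paths_to countable_verts *)
  moreover have "occupied G (\<lambda>e. T e (snd x)) (fst x) v \<longleftrightarrow> (\<exists>p\<in>paths_to G v.
      arrival G (\<lambda>e. T e (snd x)) p \<le> ereal (fst x) \<and> ereal (fst x) < departure G (\<lambda>e. T e (snd x)) p)"
    if "x \<in> space (borel \<Otimes>\<^sub>M M)" for x
  proof (rule occupied_iff[OF v])
    show "loc_fin_rings (parcs G) (\<lambda>e. T e (snd x))"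
      using T that by (auto simp: clock_space_def space_pair_measure)
  qed
  ultimately show ?thesis
    by (subst measurable_cong)
qed

lemma sets_occupied: "{\<omega>\<in>space M. occupied G (\<lambda>e. T e \<omega>) s v} \<in> sets M"
proof -
  have "Measurable.pred M (\<lambda>\<omega>. occupied G (\<lambda>e. T e (snd (s, \<omega>))) (fst (s, \<omega>)) v)"
    by (rule measurable_compose[OF _ pred_occupied]) simp
  then show ?thesis
    by (simp add: pred_def)
qed

lemma measurable_next_occupied_pair:
  "(\<lambda>x. next_occupied G (\<lambda>e. T e (snd x)) v (fst x)) \<in> borel_measurable (borel \<Otimes>\<^sub>M M)"
proof -
  have *: "(\<lambda>x. if max (ereal (fst x)) (arrival G (\<lambda>e. T e (snd x)) p) < departure G (\<lambda>e. T e (snd x)) p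
      then max (ereal (fst x)) (arrival G (\<lambda>e. T e (snd x)) p) else \<infinity>) \<in> borel_measurable (borel \<Otimes>\<^sub>M M)"
    if "p \<in> paths_to G v" for p
  proof -
    note [measurable] = measurable_arrival_departure[OF that]
    have [measurable]: "(\<lambda>x. arrival G (\<lambda>e. T e (snd x)) p) \<in> borel_measurable (borel \<Otimes>\<^sub>M M)"
      "(\<lambda>x. departure G (\<lambda>e. T e (snd x)) p) \<in> borel_measurable (borel \<Otimes>\<^sub>M M)"
      by (rule measurable_compose[OF measurable_snd]; measurable)+
    show ?thesis
      by measurable
  qed
  have "(\<lambda>x. INF p\<in>paths_to G v. if max (ereal (fst x)) (arrival G (\<lambda>e. T e (snd x)) p) < departure G (\<lambda>e. T e (snd x)) p
      then max (ereal (fst x)) (arrival G (\<lambda>e. T e (snd x)) p) else \<infinity>) \<in> borel_measurable (borel \<Otimes>\<^sub>M M)"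
    by (intro borel_measurable_INF countable_paths_to countable_verts *)
  moreover have "next_occupied G (\<lambda>e. T e (snd x)) v (fst x) = (INF p\<in>paths_to G v.
      if max (ereal (fst x)) (arrival G (\<lambda>e. T e (snd x)) p) < departure G (\<lambda>e. T e (snd x)) p
      then max (ereal (fst x)) (arrival G (\<lambda>e. T e (snd x)) p) else \<infinity>)"
    if "x \<in> space (borel \<Otimes>\<^sub>M M)" for x
  proof (rule next_occupied_eq_INF[OF v])
    show "loc_fin_rings (parcs G) (\<lambda>e. T e (snd x))"
      using T that by (auto simp: clock_space_def space_pair_measure)
  qed
  ultimately show ?thesis
    by (subst measurable_cong)
qed

lemma measurable_next_occupied:
  "(\<lambda>\<omega>. next_occupied G (\<lambda>e. T e \<omega>) v t) \<in> borel_measurable M"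
proof -
  have "(\<lambda>\<omega>. next_occupied G (\<lambda>e. T e (snd (t, \<omega>))) v (fst (t, \<omega>))) \<in> borel_measurable M"
    by (rule measurable_compose[OF _ measurable_next_occupied_pair]) simp
  then show ?thesis
    by simp
qed

end

end

section \<open>Independence of two processes from finite cylinders\<close>

lemma vimage_prod_emb:
  assumes "X \<in> M \<rightarrow>\<^sub>M PiM I N" "J \<subseteq> I"
  shows "X -` prod_emb I N J (Pi\<^sub>E J A) \<inter> space M = {\<omega>\<in>space M. \<forall>i\<in>J. X \<omega> i \<in> A i}"
proof -
  have "X \<omega> \<in> prod_emb I N J (Pi\<^sub>E J A) \<longleftrightarrow> (\<forall>i\<in>J. X \<omega> i \<in> A i)" if "\<omega> \<in> space M" for \<omega>
    using measurable_space[OF assms(1) that] assms(2)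
    by (auto simp: prod_emb_iff space_PiM PiE_iff)
  then show ?thesis
    by auto
qed

text \<open>The sets of \<open>prod_algebra\<close> are stable under intersection and generate the
  product sigma-algebra, and each constrains finitely many coordinates only.\<close>

lemma (in prob_space) indep_var_PiM_I:
  assumes X: "X \<in> M \<rightarrow>\<^sub>M PiM I N" and Y: "Y \<in> M \<rightarrow>\<^sub>M PiM I N"
    and cyl: "\<And>J L A B. finite J \<Longrightarrow> J \<subseteq> I \<Longrightarrow> finite L \<Longrightarrow> L \<subseteq> I \<Longrightarrow>
      (\<And>i. i \<in> J \<Longrightarrow> A i \<in> sets (N i)) \<Longrightarrow> (\<And>i. i \<in> L \<Longrightarrow> B i \<in> sets (N i)) \<Longrightarrow>
      prob {\<omega>\<in>space M. (\<forall>i\<in>J. X \<omega> i \<in> A i) \<and> (\<forall>i\<in>L. Y \<omega> i \<in> B i)} =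
      prob {\<omega>\<in>space M. \<forall>i\<in>J. X \<omega> i \<in> A i} * prob {\<omega>\<in>space M. \<forall>i\<in>L. Y \<omega> i \<in> B i}"
  shows "indep_var (PiM I N) X (PiM I N) Y"
proof -
  have case_bool_const: "case_bool c c = (\<lambda>_. c)" for c :: 'z
    by (auto split: bool.split)
  have "indep_vars (\<lambda>_. PiM I N) (case_bool X Y) UNIV \<longleftrightarrow>
    (\<forall>A\<in>(\<Pi> i\<in>UNIV. prod_algebra I N). prob (\<Inter>j\<in>UNIV. case_bool X Y j -` A j \<inter> space M) =
      (\<Prod>j\<in>UNIV. prob (case_bool X Y j -` A j \<inter> space M)))"
  proof (rule indep_vars_finite)
    show "sets (PiM I N) = sigma_sets (space (PiM I N)) (prod_algebra I N)"
      by (simp add: sets_PiM space_PiM)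
    show "case_bool X Y i \<in> M \<rightarrow>\<^sub>M PiM I N" for i
      using X Y by (cases i) auto
    show "Int_stable (prod_algebra I N)"
      by (rule Int_stable_prod_algebra)
    show "space (PiM I N) \<in> prod_algebra I N"
      by (simp add: space_PiM space_in_prod_algebra)
    show "prod_algebra I N \<subseteq> Pow (space (PiM I N))"
      using prod_algebra_sets_into_space[of I N] by (simp add: space_PiM)
  qed auto
  also have "\<dots>"
  proof
    fix A :: "bool \<Rightarrow> _" assume "A \<in> (\<Pi> i\<in>UNIV. prod_algebra I N)"
    then have A: "A True \<in> prod_algebra I N" "A False \<in> prod_algebra I N"
      by auto
    obtain J E where J: "A True = prod_emb I N J (Pi\<^sub>E J E)" "finite J" "J \<subseteq> I" "\<And>i. i \<in> J \<Longrightarrow> E i \<in> sets (N i)"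
      by (rule prod_algebraE[OF A(1)]) blast
    obtain L F where L: "A False = prod_emb I N L (Pi\<^sub>E L F)" "finite L" "L \<subseteq> I" "\<And>i. i \<in> L \<Longrightarrow> F i \<in> sets (N i)"
      by (rule prod_algebraE[OF A(2)]) blast
    have 1: "X -` A True \<inter> space M = {\<omega>\<in>space M. \<forall>i\<in>J. X \<omega> i \<in> E i}"
      unfolding J(1) by (rule vimage_prod_emb[OF X J(3)])
    have 2: "Y -` A False \<inter> space M = {\<omega>\<in>space M. \<forall>i\<in>L. Y \<omega> i \<in> F i}"
      unfolding L(1) by (rule vimage_prod_emb[OF Y L(3)])
    have "(\<Inter>j\<in>UNIV. case_bool X Y j -` A j \<inter> space M) = (X -` A True \<inter> space M) \<inter> (Y -` A False \<inter> space M)"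
      unfolding UNIV_bool by auto
    also have "\<dots> = {\<omega>\<in>space M. (\<forall>i\<in>J. X \<omega> i \<in> E i) \<and> (\<forall>i\<in>L. Y \<omega> i \<in> F i)}"
      unfolding 1 2 by auto
    also have "prob \<dots> = prob (X -` A True \<inter> space M) * prob (Y -` A False \<inter> space M)"
      unfolding 1 2 by (rule cyl[OF J(2,3) L(2,3) J(4) L(4)])
    also have "\<dots> = (\<Prod>j\<in>UNIV. prob (case_bool X Y j -` A j \<inter> space M))"
      unfolding UNIV_bool by simp
    finally show "prob (\<Inter>j\<in>UNIV. case_bool X Y j -` A j \<inter> space M) =
      (\<Prod>j\<in>UNIV. prob (case_bool X Y j -` A j \<inter> space M))" .
  qed
  finally show ?thesis
    unfolding indep_var_def case_bool_const by simp
qed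

section \<open>A single Poisson clock: law, stationarity, independence of past and future\<close>

abbreviation path_space :: "(real \<Rightarrow> nat) measure" where
  "path_space \<equiv> \<Pi>\<^sub>M t\<in>{0::real..}. count_space (UNIV :: nat set)"

definition counting :: "real set \<Rightarrow> real \<Rightarrow> nat" where
  "counting A = (\<lambda>t\<in>{0..}. card (A \<inter> {0<..t}))"

lemma counting_apply: "0 \<le> t \<Longrightarrow> counting A t = card (A \<inter> {0<..t})"
  by (simp add: counting_def)

lemma finite_rings_interval: "(\<And>b. finite (A \<inter> {..b})) \<Longrightarrow> finite (A \<inter> {a<..b::real})"
  by (rule finite_subset[of _ "A \<inter> {..b}"]) auto

lemma card_interval_add:
  fixes a b c :: real
  assumes "\<And>b. finite (A \<inter> {..b})" "a \<le> b" "b \<le> c"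
  shows "card (A \<inter> {a<..c}) = card (A \<inter> {a<..b}) + card (A \<inter> {b<..c})"
proof -
  have "A \<inter> {a<..c} = (A \<inter> {a<..b}) \<union> (A \<inter> {b<..c})"
    using assms by auto
  then show ?thesis
    using finite_rings_interval[OF assms(1)] by (simp add: card_Un_disjoint disjoint_iff)
qed

lemma card_grid_sum:
  fixes g :: "nat \<Rightarrow> real"
  assumes fin: "\<And>b. finite (A \<inter> {..b})" and g: "mono g" and "m \<le> l"
  shows "card (A \<inter> {g m<..g l}) = (\<Sum>i\<in>{m..<l}. card (A \<inter> {g i<..g (Suc i)}))"
  using \<open>m \<le> l\<close>
proof (induction l rule: dec_induct)
  case (step n)
  have "card (A \<inter> {g m<..g (Suc n)}) = card (A \<inter> {g m<..g n}) + card (A \<inter> {g n<..g (Suc n)})"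
    using step by (intro card_interval_add fin monoD[OF g]) auto
  then show ?case
    using step by simp
qed simp

lemma card_shift_rings: "0 \<le> a \<Longrightarrow> card (shift_rings s A \<inter> {a<..b}) = card (A \<inter> {s + a<..s + b})"
proof -
  assume "0 \<le> a"
  have "A \<inter> {s + a<..s + b} = (+) s ` (shift_rings s A \<inter> {a<..b})"
  proof (intro set_eqI iffI)
    fix r assume "r \<in> A \<inter> {s + a<..s + b}"
    then show "r \<in> (+) s ` (shift_rings s A \<inter> {a<..b})"
      using \<open>0 \<le> a\<close> by (intro image_eqI[of _ _ "r - s"]) (auto simp: shift_rings_def)
  qed (auto simp: shift_rings_def)
  then show ?thesis
    by (simp add: card_image)
qed

lemma finite_shift_rings: "(\<And>b. finite (A \<inter> {..b})) \<Longrightarrow> finite (shift_rings s A \<inter> {..b})"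
proof (rule inj_on_finite[of "(+) s" _ "A \<inter> {..s + b}"])
qed (auto simp: shift_rings_def)

text \<open>Counts of the shifted clock are counts of the original one over translated intervals,
  and the Poisson mean depends on the length alone.\<close>

lemma poisson_process_shift:
  assumes T: "poisson_process M rate T" and s: "0 \<le> s"
  shows "poisson_process M rate (\<lambda>\<omega>. shift_rings s (T \<omega>))"
  unfolding poisson_process_def
proof (intro conjI ballI allI impI)
  fix \<omega> b assume "\<omega> \<in> space M"
  then show "shift_rings s (T \<omega>) \<subseteq> {0<..}" "finite (shift_rings s (T \<omega>) \<inter> {..b})"
    using T finite_shift_rings unfolding poisson_process_def by (auto simp: shift_rings_def)
next
  fix a b :: real assume ab: "0 \<le> a \<and> a < b"
  have *: "(\<lambda>\<omega>. card (shift_rings s (T \<omega>) \<inter> {a<..b})) = (\<lambda>\<omega>. card (T \<omega> \<inter> {s + a<..s + b}))"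
    using ab by (simp add: card_shift_rings)
  have "0 \<le> s + a \<and> s + a < s + b"
    using ab s by simp
  note T' = T[unfolded poisson_process_def, THEN conjunct2, THEN conjunct1, rule_format, OF this]
  show "(\<lambda>\<omega>. card (shift_rings s (T \<omega>) \<inter> {a<..b})) \<in> M \<rightarrow>\<^sub>M count_space UNIV"
    unfolding * using T' by simp
  show "distr M (count_space UNIV) (\<lambda>\<omega>. card (shift_rings s (T \<omega>) \<inter> {a<..b})) =
      measure_pmf (poisson_pmf (rate * (b - a)))"
    unfolding * using T' by simp
next
  fix g :: "nat \<Rightarrow> real" and n assume g: "0 \<le> g 0 \<and> mono g"
  then have g': "0 \<le> g i" for i
    using monoD[of g 0 i] by auto
  have "0 \<le> s + g 0 \<and> mono (\<lambda>i. s + g i)"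
    using g s by (auto simp: mono_def)
  note T' = T[unfolded poisson_process_def, THEN conjunct2, THEN conjunct2, rule_format, OF this]
  show "prob_space.indep_vars M (\<lambda>_. count_space UNIV)
      (\<lambda>i \<omega>. card (shift_rings s (T \<omega>) \<inter> {g i<..g (Suc i)})) {..<n}"
    using T'[of n] by (simp add: card_shift_rings g')
qed

definition increments :: "(nat \<Rightarrow> real) \<Rightarrow> ('a \<Rightarrow> real set) \<Rightarrow> nat set \<Rightarrow> 'a \<Rightarrow> nat \<Rightarrow> nat" where
  "increments g T I \<omega> = (\<lambda>i\<in>I. card (T \<omega> \<inter> {g i<..g (Suc i)}))"

text \<open>\<open>poisson_process\<close> states independence of increments along a monotone
  sequence, so finitely many times have to be listed by one. It starts at 0 because counts
  do.\<close>

lemma exists_grid: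
  assumes "finite J" "J \<subseteq> {0::real..}"
  obtains g :: "nat \<Rightarrow> real" and n where "mono g" "g 0 = 0" "J \<subseteq> g ` {..n}"
proof -
  define xs where "xs = sorted_list_of_set (insert 0 J)"
  \<comment> \<open>The minimum makes the sequence constant after the last listed time; the
    corresponding intervals are empty.\<close>
  define g where "g i = xs ! min i (length xs - 1)" for i
  have xs: "set xs = insert 0 J" "sorted xs"
    using assms(1) unfolding xs_def by (simp_all del: sorted_list_of_set_insert_remove)
  then have ne: "0 < length xs"
    by (metis insert_not_empty length_greater_0_conv list.set(1))
  have "mono g"
    unfolding g_def by (intro monoI sorted_nth_mono[OF xs(2)]) (use ne in \<open>auto simp: min_less_iff_disj\<close>)
  moreover have "g 0 = 0"
  proof -
    obtain k where k: "k < length xs" "xs ! k = 0"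
      using xs(1) by (metis in_set_conv_nth insertI1)
    have "xs ! 0 \<le> xs ! k"
      by (rule sorted_nth_mono[OF xs(2)]) (use k in auto)
    moreover have "xs ! 0 \<in> insert 0 J"
      using nth_mem[OF ne] xs(1) by simp
    ultimately show ?thesis
      using assms(2) k(2) by (auto simp: g_def)
  qed
  moreover have "J \<subseteq> g ` {..length xs}"
  proof
    fix j assume "j \<in> J"
    then obtain k where "k < length xs" "xs ! k = j"
      using xs(1) by (metis in_set_conv_nth insertI2)
    then show "j \<in> g ` {..length xs}"
      by (intro image_eqI[of _ _ k]) (auto simp: g_def min_def)
  qed
  ultimately show ?thesis
    by (rule that)
qed

lemma sets_sum_components:
  assumes "finite J" "\<And>j. j \<in> J \<Longrightarrow> K j \<subseteq> (I :: nat set)"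
  shows "{d \<in> space (PiM I (\<lambda>_. count_space (UNIV :: nat set))). \<forall>j\<in>J. (\<Sum>i\<in>K j. d i) \<in> A j}
    \<in> sets (PiM I (\<lambda>_. count_space UNIV))"
proof (intro sets.sets_Collect_finite_All assms(1))
  fix j assume "j \<in> J"
  then have "(\<lambda>d. \<Sum>i\<in>K j. d i) \<in> PiM I (\<lambda>_. count_space (UNIV :: nat set)) \<rightarrow>\<^sub>M count_space UNIV"
    using assms(2) by (intro measurable_sum_nat measurable_component_singleton) auto
  then have "(\<lambda>d. \<Sum>i\<in>K j. d i) -` A j \<inter> space (PiM I (\<lambda>_. count_space UNIV)) \<in> sets (PiM I (\<lambda>_. count_space UNIV))"
    by (rule measurable_sets) simp
  then show "{d \<in> space (PiM I (\<lambda>_. count_space UNIV)). (\<Sum>i\<in>K j. d i) \<in> A j} \<in> sets (PiM I (\<lambda>_. count_space UNIV))"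
    by (simp add: vimage_def Int_def conj_commute)
qed

context prob_space
begin

lemma poisson_finite:
  assumes "poisson_process M rate T" "\<omega> \<in> space M"
  shows "finite (T \<omega> \<inter> {..b})"
  using assms unfolding poisson_process_def by blast

lemma poisson_measurable:
  assumes T: "poisson_process M rate T" and a: "0 \<le> a"
  shows "(\<lambda>\<omega>. card (T \<omega> \<inter> {a<..b})) \<in> M \<rightarrow>\<^sub>M count_space UNIV"
proof (cases "a < b")
  case True
  then show ?thesis
    using T a unfolding poisson_process_def by blast
qed simp

lemma counting_measurable:
  assumes T: "poisson_process M rate T"
  shows "(\<lambda>\<omega>. counting (T \<omega>)) \<in> M \<rightarrow>\<^sub>M path_space"
  unfolding counting_def by (intro measurable_restrict poisson_measurable[OF T]) simp

lemma increments_indep: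
  assumes T: "poisson_process M rate T" and g: "mono g" "0 \<le> g 0"
  shows "indep_vars (\<lambda>_. count_space UNIV) (\<lambda>i \<omega>. card (T \<omega> \<inter> {g i<..g (Suc i)})) {..<n::nat}"
  using T g unfolding poisson_process_def by blast

text \<open>Independence makes the joint law a product, and the factors are Poisson laws fixed by
  the rate and the grid. \<open>Suc n\<close> keeps the index set nonempty, as the product
  characterisation of independence requires.\<close>

lemma increments_law:
  assumes T: "poisson_process M rate T" and T': "poisson_process M rate T'"
    and g: "mono g" "0 \<le> g 0"
  shows "distr M (PiM {..<Suc n} (\<lambda>_. count_space UNIV)) (increments g T {..<Suc n}) =
    distr M (PiM {..<Suc n} (\<lambda>_. count_space UNIV)) (increments g T' {..<Suc n})"
proof -
  have g0: "0 \<le> g i" for i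
    using g monoD[of g 0 i] by auto
  have "distr M (PiM {..<Suc n} (\<lambda>_. count_space UNIV)) (increments g T {..<Suc n}) =
      PiM {..<Suc n} (\<lambda>i. distr M (count_space UNIV) (\<lambda>\<omega>. card (T \<omega> \<inter> {g i<..g (Suc i)})))"
    if T: "poisson_process M rate T" for T
    unfolding increments_def
    by (subst indep_vars_iff_distr_eq_PiM'[symmetric])
       (auto intro!: increments_indep[OF T g] poisson_measurable[OF T] g0)
  note * = this[OF T] this[OF T']
  have "distr M (count_space UNIV) (\<lambda>\<omega>. card (T \<omega> \<inter> {g i<..g (Suc i)})) =
      distr M (count_space UNIV) (\<lambda>\<omega>. card (T' \<omega> \<inter> {g i<..g (Suc i)}))" for i
  proof (cases "g i < g (Suc i)")
    case True
    then show ?thesis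
      using T T' g0[of i] unfolding poisson_process_def by simp
  qed simp
  then show ?thesis
    unfolding * by (intro PiM_cong refl)
qed

lemma increments_measurable:
  assumes T: "poisson_process M rate T" and g: "mono g" "0 \<le> g 0"
  shows "increments g T I \<in> M \<rightarrow>\<^sub>M PiM I (\<lambda>_. count_space UNIV)"
proof -
  have "0 \<le> g i" for i
    using g monoD[of g 0 i] by auto
  then show ?thesis
    unfolding increments_def by (intro measurable_restrict poisson_measurable[OF T])
qed

text \<open>A law on the product space is determined by its finite-dimensional marginals, and counts
  at finitely many times are partial sums of the increments along a common grid.\<close>

lemma poisson_law_unique:
  assumes T: "poisson_process M rate T" and T': "poisson_process M rate T'"
  shows "distr M path_space (\<lambda>\<omega>. counting (T \<omega>)) = distr M path_space (\<lambda>\<omega>. counting (T' \<omega>))"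
proof (rule measure_eqI_PiM_infinite)
  fix A :: "real \<Rightarrow> nat set" and J :: "real set"
  assume J: "finite J" "J \<subseteq> {0..}"
  obtain g :: "nat \<Rightarrow> real" and n where g: "mono g" "g 0 = 0" "J \<subseteq> g ` {..n}"
    by (rule exists_grid[OF J])
  then have "\<forall>j\<in>J. \<exists>k\<le>n. g k = j"
    by auto
  then obtain k where k: "\<And>j. j \<in> J \<Longrightarrow> k j \<le> n \<and> g (k j) = j"
    by metis
  define B where "B = {d \<in> space (PiM {..<Suc n} (\<lambda>_. count_space (UNIV :: nat set))). \<forall>j\<in>J. (\<Sum>i\<in>{0..<k j}. d i) \<in> A j}"
  have B: "B \<in> sets (PiM {..<Suc n} (\<lambda>_. count_space UNIV))"
    unfolding B_def by (rule sets_sum_components[OF J(1)]) (use k in force)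
  have g0: "mono g" "0 \<le> g 0"
    using g by auto
  have eq: "emeasure (distr M path_space (\<lambda>\<omega>. counting (T \<omega>))) (prod_emb {0..} (\<lambda>_. count_space UNIV) J (Pi\<^sub>E J A)) =
      emeasure (distr M (PiM {..<Suc n} (\<lambda>_. count_space UNIV)) (increments g T {..<Suc n})) B"
    if T: "poisson_process M rate T" for T
  proof -
    have sum: "counting (T \<omega>) j = (\<Sum>i\<in>{0..<k j}. increments g T {..<Suc n} \<omega> i)" if "j \<in> J" "\<omega> \<in> space M" for j \<omega>
    proof -
      have "counting (T \<omega>) j = card (T \<omega> \<inter> {g 0<..g (k j)})"
        using that J k[of j] g(2) by (auto simp: counting_apply)
      also have "\<dots> = (\<Sum>i\<in>{0..<k j}. card (T \<omega> \<inter> {g i<..g (Suc i)}))"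
        by (rule card_grid_sum[OF poisson_finite[OF T that(2)] g(1)]) simp
      also have "\<dots> = (\<Sum>i\<in>{0..<k j}. increments g T {..<Suc n} \<omega> i)"
        using k[OF that(1)] by (intro sum.cong refl) (auto simp: increments_def)
      finally show ?thesis .
    qed
    have "(\<lambda>\<omega>. counting (T \<omega>)) -` prod_emb {0..} (\<lambda>_. count_space UNIV) J (Pi\<^sub>E J A) \<inter> space M =
        increments g T {..<Suc n} -` B \<inter> space M"
      unfolding vimage_prod_emb[OF counting_measurable[OF T] J(2)]
      using measurable_space[OF increments_measurable[OF T g0]] by (auto simp: B_def sum)
    moreover have "prod_emb {0..} (\<lambda>_. count_space UNIV) J (Pi\<^sub>E J A) \<in> sets path_space"
      by (intro sets_PiM_I J) auto
    ultimately show ?thesis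
      by (simp add: emeasure_distr counting_measurable[OF T] increments_measurable[OF T g0] B)
  qed
  show "emeasure (distr M path_space (\<lambda>\<omega>. counting (T \<omega>))) (prod_emb {0..} (\<lambda>_. count_space UNIV) J (Pi\<^sub>E J A)) =
      emeasure (distr M path_space (\<lambda>\<omega>. counting (T' \<omega>))) (prod_emb {0..} (\<lambda>_. count_space UNIV) J (Pi\<^sub>E J A))"
    unfolding eq[OF T] eq[OF T'] increments_law[OF T T' g0] by (rule refl)
next
  show "finite_measure (distr M path_space (\<lambda>\<omega>. counting (T \<omega>)))"
    by (rule finite_measure_distr) (rule counting_measurable[OF T])
qed simp_all

lemma counting_past_measurable:
  assumes T: "poisson_process M rate T" and s: "0 \<le> s"
  shows "(\<lambda>\<omega>. counting (T \<omega> \<inter> {..s})) \<in> M \<rightarrow>\<^sub>M path_space"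
proof -
  have "card (A \<inter> {..s} \<inter> {0<..t}) = card (A \<inter> {0<..min t s})" for A :: "real set" and t
    by (rule arg_cong[where f = card]) auto
  then show ?thesis
    unfolding counting_def by (intro measurable_restrict) (simp add: poisson_measurable[OF T])
qed

text \<open>On a grid that contains \<open>s\<close>, past counts are sums of increments before the
  index \<open>m\<close> of \<open>s\<close> and future counts are sums of increments from
  \<open>m\<close> on. Disjoint blocks of independent increments are independent.\<close>

lemma poisson_past_future_indep:
  assumes T: "poisson_process M rate T" and s: "0 \<le> s"
  shows "indep_var path_space (\<lambda>\<omega>. counting (T \<omega> \<inter> {..s})) path_space (\<lambda>\<omega>. counting (shift_rings s (T \<omega>)))"
proof (rule indep_var_PiM_I)
  show "(\<lambda>\<omega>. counting (T \<omega> \<inter> {..s})) \<in> M \<rightarrow>\<^sub>M path_space"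
    by (rule counting_past_measurable[OF assms])
  show "(\<lambda>\<omega>. counting (shift_rings s (T \<omega>))) \<in> M \<rightarrow>\<^sub>M path_space"
    by (rule counting_measurable[OF poisson_process_shift[OF assms]])
  fix J L :: "real set" and A B :: "real \<Rightarrow> nat set"
  assume J: "finite J" "J \<subseteq> {0..}" and L: "finite L" "L \<subseteq> {0..}"
  \<comment> \<open>Past times are cut at \<open>s\<close>, where the truncated clock stops
    counting; future times are moved back to the original time axis.\<close>
  let ?G = "(\<lambda>j. min j s) ` J \<union> {s} \<union> (\<lambda>l. s + l) ` L"
  obtain g :: "nat \<Rightarrow> real" and n where g: "mono g" "g 0 = 0" "?G \<subseteq> g ` {..n}"
    by (rule exists_grid[of ?G]) (use J L s in auto)
  from g(3) obtain m where m: "m \<le> n" "g m = s"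
    by auto
  have "\<forall>j\<in>J. \<exists>k\<le>m. g k = min j s"
  proof
    fix j assume "j \<in> J"
    then obtain k where "g k = min j s"
      using g(3) by fastforce
    \<comment> \<open>Grid values may repeat, so the index found may lie beyond \<open>m\<close>;
      the value there is still \<open>s = g m\<close>, and \<open>m\<close> can be used
      instead.\<close>
    then have "g (min k m) = min j s"
      using m g(1) by (simp add: min_of_mono[symmetric])
    then show "\<exists>k\<le>m. g k = min j s"
      by (intro exI[of _ "min k m"]) auto
  qed
  then obtain k where k: "\<And>j. j \<in> J \<Longrightarrow> k j \<le> m \<and> g (k j) = min j s"
    by metis
  have "\<forall>l\<in>L. \<exists>k. m \<le> k \<and> k \<le> n \<and> g k = s + l"
  proof
    fix l assume l: "l \<in> L"
    then obtain k where "k \<le> n" "g k = s + l"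
      using g(3) by fastforce
    moreover from this have "g (max k m) = s + l"
      using m g(1) l L by (auto simp: max_of_mono[symmetric])
    ultimately show "\<exists>k. m \<le> k \<and> k \<le> n \<and> g k = s + l"
      using m by (intro exI[of _ "max k m"]) auto
  qed
  then obtain k' where k': "\<And>l. l \<in> L \<Longrightarrow> m \<le> k' l \<and> k' l \<le> n \<and> g (k' l) = s + l"
    by metis
  define C where "C = {d \<in> space (PiM {..<m} (\<lambda>_. count_space (UNIV :: nat set))). \<forall>j\<in>J. (\<Sum>i\<in>{0..<k j}. d i) \<in> A j}"
  define D where "D = {d \<in> space (PiM {m..<n} (\<lambda>_. count_space (UNIV :: nat set))). \<forall>l\<in>L. (\<Sum>i\<in>{m..<k' l}. d i) \<in> B l}"
  have C: "C \<in> sets (PiM {..<m} (\<lambda>_. count_space UNIV))"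
    unfolding C_def by (rule sets_sum_components[OF J(1)]) (use k in force)
  have D: "D \<in> sets (PiM {m..<n} (\<lambda>_. count_space UNIV))"
    unfolding D_def by (rule sets_sum_components[OF L(1)]) (use k' in force)
  have g0: "mono g" "0 \<le> g 0"
    using g by auto
  let ?U = "increments g T {..<m}" and ?V = "increments g T {m..<n}"
  have past: "{\<omega>\<in>space M. \<forall>j\<in>J. counting (T \<omega> \<inter> {..s}) j \<in> A j} = ?U -` C \<inter> space M"
  proof -
    have "counting (T \<omega> \<inter> {..s}) j = (\<Sum>i\<in>{0..<k j}. ?U \<omega> i)" if "j \<in> J" "\<omega> \<in> space M" for j \<omega>
    proof -
      have "counting (T \<omega> \<inter> {..s}) j = card (T \<omega> \<inter> {..s} \<inter> {0<..j})"
        using that J by (auto simp: counting_apply)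
      also have "T \<omega> \<inter> {..s} \<inter> {0<..j} = T \<omega> \<inter> {g 0<..g (k j)}"
        using k[OF that(1)] g(2) by auto
      also have "card \<dots> = (\<Sum>i\<in>{0..<k j}. card (T \<omega> \<inter> {g i<..g (Suc i)}))"
        by (rule card_grid_sum[OF poisson_finite[OF T that(2)] g(1)]) simp
      also have "\<dots> = (\<Sum>i\<in>{0..<k j}. ?U \<omega> i)"
        using k[OF that(1)] by (intro sum.cong refl) (auto simp: increments_def)
      finally show ?thesis .
    qed
    then show ?thesis
      using measurable_space[OF increments_measurable[OF T g0]] by (auto simp: C_def)
  qed
  have future: "{\<omega>\<in>space M. \<forall>l\<in>L. counting (shift_rings s (T \<omega>)) l \<in> B l} = ?V -` D \<inter> space M"
  proof -
    have "counting (shift_rings s (T \<omega>)) l = (\<Sum>i\<in>{m..<k' l}. ?V \<omega> i)" if "l \<in> L" "\<omega> \<in> space M" for l \<omega>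
    proof -
      have "counting (shift_rings s (T \<omega>)) l = card (T \<omega> \<inter> {g m<..g (k' l)})"
        using that L k'[OF that(1)] m by (auto simp: counting_apply card_shift_rings)
      also have "\<dots> = (\<Sum>i\<in>{m..<k' l}. card (T \<omega> \<inter> {g i<..g (Suc i)}))"
        by (rule card_grid_sum[OF poisson_finite[OF T that(2)] g(1)]) (use k'[OF that(1)] in simp)
      also have "\<dots> = (\<Sum>i\<in>{m..<k' l}. ?V \<omega> i)"
        using k'[OF that(1)] by (intro sum.cong refl) (auto simp: increments_def)
      finally show ?thesis .
    qed
    then show ?thesis
      using measurable_space[OF increments_measurable[OF T g0]] by (auto simp: D_def)
  qed
  have indep: "indep_var (PiM {..<m} (\<lambda>_. count_space UNIV)) ?U (PiM {m..<n} (\<lambda>_. count_space UNIV)) ?V"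
    unfolding increments_def
    by (rule indep_var_restrict[OF increments_indep[OF T g0, of n]]) (use m in auto)
  have "{\<omega>\<in>space M. (\<forall>i\<in>J. counting (T \<omega> \<inter> {..s}) i \<in> A i) \<and> (\<forall>i\<in>L. counting (shift_rings s (T \<omega>)) i \<in> B i)} =
      {\<omega>\<in>space M. \<forall>j\<in>J. counting (T \<omega> \<inter> {..s}) j \<in> A j} \<inter> {\<omega>\<in>space M. \<forall>l\<in>L. counting (shift_rings s (T \<omega>)) l \<in> B l}"
    by auto
  also have "\<dots> = (\<lambda>x. (?U x, ?V x)) -` (C \<times> D) \<inter> space M"
    unfolding past future by auto
  also have "prob \<dots> = prob (?U -` C \<inter> space M) * prob (?V -` D \<inter> space M)"
    by (rule indep_varD[OF indep C D])
  finally show "prob {\<omega>\<in>space M. (\<forall>i\<in>J. counting (T \<omega> \<inter> {..s}) i \<in> A i) \<and> (\<forall>i\<in>L. counting (shift_rings s (T \<omega>)) i \<in> B i)} =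
      prob {\<omega>\<in>space M. \<forall>i\<in>J. counting (T \<omega> \<inter> {..s}) i \<in> A i} *
      prob {\<omega>\<in>space M. \<forall>i\<in>L. counting (shift_rings s (T \<omega>)) i \<in> B i}"
    unfolding past future .
qed

end

section \<open>Past and future of a family of independent clocks\<close>

lemma (in prob_space) prob_indep_vars_all:
  assumes "indep_vars (\<lambda>_. N) Y E" "finite K" "K \<subseteq> E" "\<And>e. e \<in> K \<Longrightarrow> D e \<in> sets N"
  shows "prob {\<omega>\<in>space M. \<forall>e\<in>K. Y e \<omega> \<in> D e} = (\<Prod>e\<in>K. prob {\<omega>\<in>space M. Y e \<omega> \<in> D e})"
proof (cases "K = {}")
  case True
  then show ?thesis
    by (simp add: prob_space)
next
  case False
  have "prob (\<Inter>e\<in>K. Y e -` D e \<inter> space M) = (\<Prod>e\<in>K. prob (Y e -` D e \<inter> space M))"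
    using assms False by (intro indep_varsD[of "\<lambda>_. N" Y E])
  moreover have "(\<Inter>e\<in>K. Y e -` D e \<inter> space M) = {\<omega>\<in>space M. \<forall>e\<in>K. Y e \<omega> \<in> D e}"
    using False by auto
  moreover have "Y e -` D e \<inter> space M = {\<omega>\<in>space M. Y e \<omega> \<in> D e}" for e
    by auto
  ultimately show ?thesis
    by simp
qed

text \<open>Both members of a pair are functions of the same \<open>Y e\<close>. The probability of
  a joint cylinder therefore first splits over the indices \<open>e\<close>, then within each index
  into the two members, and the factors are regrouped.\<close>

lemma (in prob_space) indep_var_PiM_family:
  assumes Y: "indep_vars (\<lambda>_. N) Y E"
    and \<phi>: "\<phi> \<in> N \<rightarrow>\<^sub>M N'" and \<psi>: "\<psi> \<in> N \<rightarrow>\<^sub>M N'"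
    and pair: "\<And>e. e \<in> E \<Longrightarrow> indep_var N' (U e) N' (V e)"
    and U: "\<And>e \<omega>. e \<in> E \<Longrightarrow> \<omega> \<in> space M \<Longrightarrow> U e \<omega> = \<phi> (Y e \<omega>)"
    and V: "\<And>e \<omega>. e \<in> E \<Longrightarrow> \<omega> \<in> space M \<Longrightarrow> V e \<omega> = \<psi> (Y e \<omega>)"
  shows "indep_var (PiM E (\<lambda>_. N')) (\<lambda>\<omega>. \<lambda>e\<in>E. U e \<omega>) (PiM E (\<lambda>_. N')) (\<lambda>\<omega>. \<lambda>e\<in>E. V e \<omega>)"
proof (rule indep_var_PiM_I)
  show "(\<lambda>\<omega>. \<lambda>e\<in>E. U e \<omega>) \<in> M \<rightarrow>\<^sub>M PiM E (\<lambda>_. N')" "(\<lambda>\<omega>. \<lambda>e\<in>E. V e \<omega>) \<in> M \<rightarrow>\<^sub>M PiM E (\<lambda>_. N')"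
    by (intro measurable_restrict indep_var_rv1[OF pair] indep_var_rv2[OF pair]; assumption)+
  fix J L A B
  assume J: "finite J" "J \<subseteq> E" and L: "finite L" "L \<subseteq> E"
    and A: "\<And>i. i \<in> J \<Longrightarrow> A i \<in> sets N'" and B: "\<And>i. i \<in> L \<Longrightarrow> B i \<in> sets N'"
  \<comment> \<open>Unconstrained coordinates receive the whole space, so that both cylinders extend
    over the same finite index set \<open>J \<union> L\<close>.\<close>
  define A' where "A' e = (if e \<in> J then A e else space N')" for e
  define B' where "B' e = (if e \<in> L then B e else space N')" for e
  have A': "A' e \<in> sets N'" and B': "B' e \<in> sets N'" for e
    using A B by (auto simp: A'_def B'_def)
  have Ysp: "Y e \<omega> \<in> space N" if "e \<in> E" "\<omega> \<in> space M" for e \<omega>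
    using Y that unfolding indep_vars_def by (auto intro: measurable_space)
  have sets: "\<phi> -` A' e \<inter> space N \<in> sets N" "\<psi> -` B' e \<inter> space N \<in> sets N" for e
    by (rule measurable_sets[OF \<phi> A'], rule measurable_sets[OF \<psi> B'])
  let ?K = "J \<union> L"
  have K: "finite ?K" "?K \<subseteq> E"
    using J L by auto
  note all = prob_indep_vars_all[OF Y K]
  have iffU: "U e \<omega> \<in> A' e \<longleftrightarrow> Y e \<omega> \<in> \<phi> -` A' e \<inter> space N" if "\<omega> \<in> space M" "e \<in> ?K" for e \<omega>
    using that K(2) U[of e \<omega>] Ysp[of e \<omega>] by auto
  have iffV: "V e \<omega> \<in> B' e \<longleftrightarrow> Y e \<omega> \<in> \<psi> -` B' e \<inter> space N" if "\<omega> \<in> space M" "e \<in> ?K" for e \<omega>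
    using that K(2) V[of e \<omega>] Ysp[of e \<omega>] by auto
  have iffUV: "U e \<omega> \<in> A' e \<and> V e \<omega> \<in> B' e \<longleftrightarrow> Y e \<omega> \<in> (\<phi> -` A' e \<inter> space N) \<inter> (\<psi> -` B' e \<inter> space N)"
    if "\<omega> \<in> space M" "e \<in> ?K" for e \<omega>
    using iffU[OF that] iffV[OF that] by blast
  have pU: "prob {\<omega>\<in>space M. \<forall>e\<in>?K. U e \<omega> \<in> A' e} = (\<Prod>e\<in>?K. prob {\<omega>\<in>space M. U e \<omega> \<in> A' e})"
  proof -
    have "{\<omega>\<in>space M. \<forall>e\<in>?K. U e \<omega> \<in> A' e} = {\<omega>\<in>space M. \<forall>e\<in>?K. Y e \<omega> \<in> \<phi> -` A' e \<inter> space N}"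
      by (intro Collect_cong conj_cong refl ball_cong iffU) assumption+
    also have "prob \<dots> = (\<Prod>e\<in>?K. prob {\<omega>\<in>space M. Y e \<omega> \<in> \<phi> -` A' e \<inter> space N})"
      by (rule all) (rule sets)
    also have "\<dots> = (\<Prod>e\<in>?K. prob {\<omega>\<in>space M. U e \<omega> \<in> A' e})"
      by (intro prod.cong refl arg_cong[where f = prob] Collect_cong conj_cong iffU[symmetric])
    finally show ?thesis .
  qed
  have pV: "prob {\<omega>\<in>space M. \<forall>e\<in>?K. V e \<omega> \<in> B' e} = (\<Prod>e\<in>?K. prob {\<omega>\<in>space M. V e \<omega> \<in> B' e})"
  proof -
    have "{\<omega>\<in>space M. \<forall>e\<in>?K. V e \<omega> \<in> B' e} = {\<omega>\<in>space M. \<forall>e\<in>?K. Y e \<omega> \<in> \<psi> -` B' e \<inter> space N}"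
      by (intro Collect_cong conj_cong refl ball_cong iffV) assumption+
    also have "prob \<dots> = (\<Prod>e\<in>?K. prob {\<omega>\<in>space M. Y e \<omega> \<in> \<psi> -` B' e \<inter> space N})"
      by (rule all) (rule sets)
    also have "\<dots> = (\<Prod>e\<in>?K. prob {\<omega>\<in>space M. V e \<omega> \<in> B' e})"
      by (intro prod.cong refl arg_cong[where f = prob] Collect_cong conj_cong iffV[symmetric])
    finally show ?thesis .
  qed
  have pUV: "prob {\<omega>\<in>space M. \<forall>e\<in>?K. U e \<omega> \<in> A' e \<and> V e \<omega> \<in> B' e} = (\<Prod>e\<in>?K. prob {\<omega>\<in>space M. U e \<omega> \<in> A' e \<and> V e \<omega> \<in> B' e})"
  proof -
    have "{\<omega>\<in>space M. \<forall>e\<in>?K. U e \<omega> \<in> A' e \<and> V e \<omega> \<in> B' e} = {\<omega>\<in>space M. \<forall>e\<in>?K. Y e \<omega> \<in> (\<phi> -` A' e \<inter> space N) \<inter> (\<psi> -` B' e \<inter> space N)}"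
      by (intro Collect_cong conj_cong refl ball_cong iffUV) assumption+
    also have "prob \<dots> = (\<Prod>e\<in>?K. prob {\<omega>\<in>space M. Y e \<omega> \<in> (\<phi> -` A' e \<inter> space N) \<inter> (\<psi> -` B' e \<inter> space N)})"
      by (rule all) (intro sets.Int sets)
    also have "\<dots> = (\<Prod>e\<in>?K. prob {\<omega>\<in>space M. U e \<omega> \<in> A' e \<and> V e \<omega> \<in> B' e})"
      by (intro prod.cong refl arg_cong[where f = prob] Collect_cong conj_cong iffUV[symmetric])
    finally show ?thesis .
  qed
  have pe: "prob {\<omega>\<in>space M. U e \<omega> \<in> A' e \<and> V e \<omega> \<in> B' e} =
      prob {\<omega>\<in>space M. U e \<omega> \<in> A' e} * prob {\<omega>\<in>space M. V e \<omega> \<in> B' e}" if "e \<in> ?K" for e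
  proof -
    have "indep_var N' (U e) N' (V e)"
      using that K by (intro pair) auto
    from indep_varD[OF this A' B', of e e] show ?thesis
      by (simp add: vimage_def Int_def conj_commute)
  qed
  have spJ: "(\<forall>i\<in>J. (\<lambda>e\<in>E. U e \<omega>) i \<in> A i) \<longleftrightarrow> (\<forall>e\<in>?K. U e \<omega> \<in> A' e)" if "\<omega> \<in> space M" for \<omega>
    using that J L measurable_space[OF indep_var_rv1[OF pair]] by (auto simp: A'_def subset_iff)
  have spL: "(\<forall>i\<in>L. (\<lambda>e\<in>E. V e \<omega>) i \<in> B i) \<longleftrightarrow> (\<forall>e\<in>?K. V e \<omega> \<in> B' e)" if "\<omega> \<in> space M" for \<omega>
    using that J L measurable_space[OF indep_var_rv2[OF pair]] by (auto simp: B'_def subset_iff)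
  have "{\<omega>\<in>space M. (\<forall>i\<in>J. (\<lambda>e\<in>E. U e \<omega>) i \<in> A i) \<and> (\<forall>i\<in>L. (\<lambda>e\<in>E. V e \<omega>) i \<in> B i)} =
      {\<omega>\<in>space M. \<forall>e\<in>?K. U e \<omega> \<in> A' e \<and> V e \<omega> \<in> B' e}"
    using spJ spL by blast
  moreover have "{\<omega>\<in>space M. \<forall>i\<in>J. (\<lambda>e\<in>E. U e \<omega>) i \<in> A i} = {\<omega>\<in>space M. \<forall>e\<in>?K. U e \<omega> \<in> A' e}"
    using spJ by blast
  moreover have "{\<omega>\<in>space M. \<forall>i\<in>L. (\<lambda>e\<in>E. V e \<omega>) i \<in> B i} = {\<omega>\<in>space M. \<forall>e\<in>?K. V e \<omega> \<in> B' e}"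
    using spL by blast
  ultimately show "prob {\<omega>\<in>space M. (\<forall>i\<in>J. (\<lambda>e\<in>E. U e \<omega>) i \<in> A i) \<and> (\<forall>i\<in>L. (\<lambda>e\<in>E. V e \<omega>) i \<in> B i)} =
      prob {\<omega>\<in>space M. \<forall>i\<in>J. (\<lambda>e\<in>E. U e \<omega>) i \<in> A i} * prob {\<omega>\<in>space M. \<forall>i\<in>L. (\<lambda>e\<in>E. V e \<omega>) i \<in> B i}"
    by (simp only: pU pV pUV pe prod.distrib cong: prod.cong)
qed

definition past_path :: "real \<Rightarrow> (real \<Rightarrow> nat) \<Rightarrow> real \<Rightarrow> nat" where
  "past_path s c = (\<lambda>t\<in>{0..}. c (min t s))"

text \<open>The effect of \<open>shift_rings\<close> on counting paths. Subtraction on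
  \<open>nat\<close> is exact there, because these paths are nondecreasing.\<close>

definition future_path :: "real \<Rightarrow> (real \<Rightarrow> nat) \<Rightarrow> real \<Rightarrow> nat" where
  "future_path s c = (\<lambda>t\<in>{0..}. c (s + t) - c s)"

lemma past_path_measurable: "0 \<le> s \<Longrightarrow> past_path s \<in> path_space \<rightarrow>\<^sub>M path_space"
  unfolding past_path_def by (intro measurable_restrict measurable_component_singleton) auto

lemma future_path_measurable:
  assumes "0 \<le> s"
  shows "future_path s \<in> path_space \<rightarrow>\<^sub>M path_space"
  unfolding future_path_def
proof (rule measurable_restrict)
  fix t :: real assume "t \<in> {0..}"
  then have 1: "(\<lambda>c. c (s + t)) \<in> path_space \<rightarrow>\<^sub>M count_space UNIV"
    using assms by (intro measurable_component_singleton) auto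
  have 2: "(\<lambda>c. c s) \<in> path_space \<rightarrow>\<^sub>M count_space UNIV"
    using assms by (intro measurable_component_singleton) auto
  show "(\<lambda>c. c (s + t) - c s) \<in> path_space \<rightarrow>\<^sub>M count_space UNIV"
  proof (rule measurable_compose_countable[where f = "\<lambda>k c. k - c s", OF _ 1])
    show "(\<lambda>c. i - c s) \<in> path_space \<rightarrow>\<^sub>M count_space UNIV" for i
      by (rule measurable_compose[OF 2]) simp
  qed
qed

lemma counting_past: "0 \<le> s \<Longrightarrow> counting (A \<inter> {..s}) = past_path s (counting A)"
proof
  fix t assume "0 \<le> s"
  have "A \<inter> {..s} \<inter> {0<..t} = A \<inter> {0<..min t s}"
    by auto
  with \<open>0 \<le> s\<close> show "counting (A \<inter> {..s}) t = past_path s (counting A) t"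
    by (simp add: counting_def past_path_def)
qed

lemma counting_future:
  assumes "0 \<le> s" "\<And>b. finite (A \<inter> {..b})"
  shows "counting (shift_rings s A) = future_path s (counting A)"
proof
  fix t
  show "counting (shift_rings s A) t = future_path s (counting A) t"
  proof (cases "0 \<le> t")
    case True
    have "card (A \<inter> {0<..s + t}) = card (A \<inter> {0<..s}) + card (A \<inter> {s<..s + t})"
      using assms True by (intro card_interval_add) auto
    then show ?thesis
      using True assms(1) by (simp add: counting_def future_path_def card_shift_rings)
  qed (simp add: counting_def future_path_def)
qed

definition clock_map :: "'e set \<Rightarrow> ('e \<Rightarrow> real set) \<Rightarrow> 'e \<Rightarrow> real \<Rightarrow> nat" where
  "clock_map E R = (\<lambda>e\<in>E. counting (R e))"

abbreviation clock_paths :: "'e set \<Rightarrow> ('e \<Rightarrow> real \<Rightarrow> nat) measure" where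
  "clock_paths E \<equiv> \<Pi>\<^sub>M e\<in>E. path_space"

locale unit_clocks = prob_space M for M :: "'w measure" +
  fixes E :: "'e set" and T :: "'e \<Rightarrow> 'w \<Rightarrow> real set"
  assumes poisson: "\<And>e. e \<in> E \<Longrightarrow> poisson_process M 1 (T e)"
    and indep: "indep_vars (\<lambda>_. path_space) (\<lambda>e \<omega>. counting (T e \<omega>)) E"
begin

lemma clock_space: "clock_space M E T"
proof -
  have "T e \<omega> \<subseteq> {0<..} \<and> (\<forall>b. finite (T e \<omega> \<inter> {..b}))" if "e \<in> E" "\<omega> \<in> space M" for e \<omega>
    using poisson[OF that(1)] that(2) unfolding poisson_process_def by blast
  then show ?thesis
    unfolding clock_space_def loc_fin_rings_def
    by (intro conjI ballI allI impI poisson_measurable[OF poisson]) auto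
qed

lemma loc_fin: "\<omega> \<in> space M \<Longrightarrow> loc_fin_rings E (\<lambda>e. T e \<omega>)"
  using clock_space by (auto simp: clock_space_def)

lemma finite_clock: "e \<in> E \<Longrightarrow> \<omega> \<in> space M \<Longrightarrow> finite (T e \<omega> \<inter> {..b})"
  using loc_fin by (auto simp: loc_fin_rings_def)

lemma clock_map_measurable: "(\<lambda>\<omega>. clock_map E (\<lambda>e. T e \<omega>)) \<in> M \<rightarrow>\<^sub>M clock_paths E"
  unfolding clock_map_def by (intro measurable_restrict counting_measurable[OF poisson])

lemma past_future_indep:
  assumes s: "0 \<le> s"
  shows "indep_var (clock_paths E) (\<lambda>\<omega>. clock_map E (\<lambda>e. T e \<omega> \<inter> {..s}))
    (clock_paths E) (\<lambda>\<omega>. clock_map E (\<lambda>e. shift_rings s (T e \<omega>)))"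
  unfolding clock_map_def
proof (rule indep_var_PiM_family[OF indep past_path_measurable[OF s] future_path_measurable[OF s]])
  show "indep_var path_space (\<lambda>\<omega>. counting (T e \<omega> \<inter> {..s})) path_space (\<lambda>\<omega>. counting (shift_rings s (T e \<omega>)))"
    if "e \<in> E" for e
    by (rule poisson_past_future_indep[OF poisson[OF that] s])
qed (simp_all add: counting_past[OF s] counting_future[OF s] finite_clock)

text \<open>Stationarity of the whole family: both laws are products over the arcs, and the factors
  agree since a shifted Poisson clock is again a Poisson clock of the same rate. The empty index set
  is separate, as the product characterisation of independence excludes it.\<close>

lemma future_law:
  assumes s: "0 \<le> s"
  shows "distr M (clock_paths E) (\<lambda>\<omega>. clock_map E (\<lambda>e. shift_rings s (T e \<omega>))) =
    distr M (clock_paths E) (\<lambda>\<omega>. clock_map E (\<lambda>e. T e \<omega>))"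
proof (cases "E = {}")
  case True
  then show ?thesis
    unfolding clock_map_def restrict_def by simp
next
  case False
  have m: "(\<lambda>\<omega>. future_path s (counting (T e \<omega>))) \<in> M \<rightarrow>\<^sub>M path_space" if "e \<in> E" for e
    by (rule measurable_compose[OF counting_measurable[OF poisson[OF that]] future_path_measurable[OF s]])
  have "distr M (clock_paths E) (\<lambda>\<omega>. clock_map E (\<lambda>e. shift_rings s (T e \<omega>))) =
      distr M (clock_paths E) (\<lambda>\<omega>. \<lambda>e\<in>E. future_path s (counting (T e \<omega>)))"
    by (rule distr_cong) (auto simp: clock_map_def counting_future[OF s] finite_clock cong: restrict_cong)
  also have "\<dots> = (\<Pi>\<^sub>M e\<in>E. distr M path_space (\<lambda>\<omega>. future_path s (counting (T e \<omega>))))"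
    using indep_vars_iff_distr_eq_PiM'[of E "\<lambda>e \<omega>. future_path s (counting (T e \<omega>))" "\<lambda>_. path_space", OF False m]
      indep_vars_compose2[OF indep, of "\<lambda>_. future_path s" "\<lambda>_. path_space"] future_path_measurable[OF s] by simp
  also have "\<dots> = (\<Pi>\<^sub>M e\<in>E. distr M path_space (\<lambda>\<omega>. counting (T e \<omega>)))"
  proof (rule PiM_cong[OF refl])
    fix e assume e: "e \<in> E"
    have "distr M path_space (\<lambda>\<omega>. future_path s (counting (T e \<omega>))) = distr M path_space (\<lambda>\<omega>. counting (shift_rings s (T e \<omega>)))"
      by (rule distr_cong) (auto simp: counting_future[OF s] finite_clock e)
    also have "\<dots> = distr M path_space (\<lambda>\<omega>. counting (T e \<omega>))"
      by (rule poisson_law_unique[OF poisson_process_shift[OF poisson[OF e] s] poisson[OF e]])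
    finally show "distr M path_space (\<lambda>\<omega>. future_path s (counting (T e \<omega>))) = distr M path_space (\<lambda>\<omega>. counting (T e \<omega>))" .
  qed
  also have "\<dots> = distr M (clock_paths E) (\<lambda>\<omega>. clock_map E (\<lambda>e. T e \<omega>))"
    using indep_vars_iff_distr_eq_PiM'[of E "\<lambda>e \<omega>. counting (T e \<omega>)" "\<lambda>_. path_space", OF False]
      indep counting_measurable[OF poisson] by (simp add: clock_map_def)
  finally show ?thesis .
qed

end

section \<open>Events about rings as events about counting paths, and the Markov property\<close>

text \<open>One set \<open>A\<close> has to work for all ring families. This permits reading the
  same property off the truncated, the shifted and the original clocks.\<close>

definition clock_event :: "'e set \<Rightarrow> (('e \<Rightarrow> real set) \<Rightarrow> bool) \<Rightarrow> bool" where
  "clock_event E Q \<longleftrightarrow> (\<exists>A\<in>sets (clock_paths E). \<forall>R. loc_fin_rings E R \<longrightarrow> (Q R \<longleftrightarrow> clock_map E R \<in> A))"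

lemma loc_fin_rings_past: "loc_fin_rings E R \<Longrightarrow> loc_fin_rings E (\<lambda>e. R e \<inter> {..s})"
  unfolding loc_fin_rings_def by (auto intro: finite_subset[of _ "R _ \<inter> {..s}"])

lemma loc_fin_rings_shift: "loc_fin_rings E R \<Longrightarrow> loc_fin_rings E (\<lambda>e. shift_rings s (R e))"
  unfolding loc_fin_rings_def using finite_shift_rings by (auto simp: shift_rings_def)

lemma (in unit_clocks) clock_event_sets:
  assumes "clock_event E Q"
  shows "{\<omega>\<in>space M. Q (\<lambda>e. T e \<omega>)} \<in> sets M"
proof -
  obtain A where A: "A \<in> sets (clock_paths E)" "\<And>R. loc_fin_rings E R \<Longrightarrow> Q R \<longleftrightarrow> clock_map E R \<in> A"
    using assms unfolding clock_event_def by blast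
  have "{\<omega>\<in>space M. Q (\<lambda>e. T e \<omega>)} = (\<lambda>\<omega>. clock_map E (\<lambda>e. T e \<omega>)) -` A \<inter> space M"
    using A(2) loc_fin by auto
  then show ?thesis
    using measurable_sets[OF clock_map_measurable A(1)] by simp
qed

text \<open>The Markov property at a deterministic time: past and future counting paths are
  independent, and the future has the law of the unshifted clocks, so the shift disappears from the
  second factor.\<close>

lemma (in unit_clocks) prob_past_future:
  assumes s: "0 \<le> s" and P: "clock_event E P" and Q: "clock_event E Q"
  shows "prob {\<omega>\<in>space M. P (\<lambda>e. T e \<omega> \<inter> {..s}) \<and> Q (\<lambda>e. shift_rings s (T e \<omega>))} =
    prob {\<omega>\<in>space M. P (\<lambda>e. T e \<omega> \<inter> {..s})} * prob {\<omega>\<in>space M. Q (\<lambda>e. T e \<omega>)}"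
    and "{\<omega>\<in>space M. P (\<lambda>e. T e \<omega> \<inter> {..s}) \<and> Q (\<lambda>e. shift_rings s (T e \<omega>))} \<in> sets M"
proof -
  obtain A where A: "A \<in> sets (clock_paths E)" "\<And>R. loc_fin_rings E R \<Longrightarrow> P R \<longleftrightarrow> clock_map E R \<in> A"
    using P unfolding clock_event_def by blast
  obtain B where B: "B \<in> sets (clock_paths E)" "\<And>R. loc_fin_rings E R \<Longrightarrow> Q R \<longleftrightarrow> clock_map E R \<in> B"
    using Q unfolding clock_event_def by blast
  let ?past = "\<lambda>\<omega>. clock_map E (\<lambda>e. T e \<omega> \<inter> {..s})"
  let ?future = "\<lambda>\<omega>. clock_map E (\<lambda>e. shift_rings s (T e \<omega>))"
  note indep = past_future_indep[OF s]
  note [measurable] = indep_var_rv1[OF indep] indep_var_rv2[OF indep]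
  have pf: "{\<omega>\<in>space M. P (\<lambda>e. T e \<omega> \<inter> {..s}) \<and> Q (\<lambda>e. shift_rings s (T e \<omega>))} =
      (\<lambda>\<omega>. (?past \<omega>, ?future \<omega>)) -` (A \<times> B) \<inter> space M"
    using A(2)[OF loc_fin_rings_past] B(2)[OF loc_fin_rings_shift] loc_fin by auto
  have p: "{\<omega>\<in>space M. P (\<lambda>e. T e \<omega> \<inter> {..s})} = ?past -` A \<inter> space M"
    using A(2)[OF loc_fin_rings_past] loc_fin by auto
  have q: "{\<omega>\<in>space M. Q (\<lambda>e. T e \<omega>)} = (\<lambda>\<omega>. clock_map E (\<lambda>e. T e \<omega>)) -` B \<inter> space M"
    using B(2) loc_fin by auto
  have "prob (?future -` B \<inter> space M) = measure (distr M (clock_paths E) ?future) B"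
    by (rule measure_distr[symmetric]) (use B(1) indep_var_rv2[OF indep] in auto)
  also have "\<dots> = prob {\<omega>\<in>space M. Q (\<lambda>e. T e \<omega>)}"
    unfolding future_law[OF s] q by (rule measure_distr[OF clock_map_measurable B(1)])
  finally show "prob {\<omega>\<in>space M. P (\<lambda>e. T e \<omega> \<inter> {..s}) \<and> Q (\<lambda>e. shift_rings s (T e \<omega>))} =
    prob {\<omega>\<in>space M. P (\<lambda>e. T e \<omega> \<inter> {..s})} * prob {\<omega>\<in>space M. Q (\<lambda>e. T e \<omega>)}"
    unfolding pf p indep_varD[OF indep A(1) B(1)] by simp
  show "{\<omega>\<in>space M. P (\<lambda>e. T e \<omega> \<inter> {..s}) \<and> Q (\<lambda>e. shift_rings s (T e \<omega>))} \<in> sets M"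
  proof -
    have "(\<lambda>\<omega>. (?past \<omega>, ?future \<omega>)) -` (A \<times> B) \<inter> space M = (?past -` A \<inter> space M) \<inter> (?future -` B \<inter> space M)"
      by auto
    then show ?thesis
      unfolding pf
      using measurable_sets[OF indep_var_rv1[OF indep] A(1)] measurable_sets[OF indep_var_rv2[OF indep] B(1)]
      by simp
  qed
qed

text \<open>The ring times are recovered as the jump points of the counting paths. The path space,
  restricted to such paths, thus carries clocks itself, and events about arbitrary clocks are
  preimages of events about these.\<close>

definition jump_points :: "(real \<Rightarrow> nat) \<Rightarrow> real set" where
  "jump_points c = {r. 0 < r \<and> (\<forall>q. 0 \<le> q \<longrightarrow> q < r \<longrightarrow> c q \<noteq> c r)}"

text \<open>The count at a ring exceeds all earlier counts. At any other time it equals the count at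
  the preceding ring, or at 0 if there is none.\<close>

lemma jump_points_counting:
  assumes A: "A \<subseteq> {0<..}" and fin: "\<And>b. finite (A \<inter> {..b})"
  shows "jump_points (counting A) = A"
proof (intro set_eqI iffI)
  fix r assume r: "r \<in> A"
  then have "0 < r"
    using A by auto
  moreover have "counting A q \<noteq> counting A r" if "0 \<le> q" "q < r" for q
  proof -
    have "r \<in> A \<inter> {0<..r}" "r \<notin> A \<inter> {0<..q}" "A \<inter> {0<..q} \<subseteq> A \<inter> {0<..r}"
      using r that \<open>0 < r\<close> by auto
    then have "card (A \<inter> {0<..q}) < card (A \<inter> {0<..r})"
      by (intro psubset_card_mono finite_rings_interval fin) blast
    then show ?thesis
      using that by (simp add: counting_def)
  qed
  ultimately show "r \<in> jump_points (counting A)"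
    by (simp add: jump_points_def)
next
  fix r assume r: "r \<in> jump_points (counting A)"
  show "r \<in> A"
  proof (rule ccontr)
    assume "r \<notin> A"
    \<comment> \<open>The last ring up to \<open>r\<close>, with 0 as the default; since
      \<open>r\<close> is not a ring, no ring lies between \<open>q\<close> and
      \<open>r\<close>.\<close>
    define q where "q = Max (insert 0 (A \<inter> {..r}))"
    have "q \<in> insert 0 (A \<inter> {..r})"
      unfolding q_def by (rule Max_in) (use fin in auto)
    then have q: "0 \<le> q" "q < r"
      using r A \<open>r \<notin> A\<close> by (auto simp: jump_points_def less_le)
    have "x \<le> q" if "x \<in> A" "x \<le> r" for x
      unfolding q_def using that fin by (intro Max_ge) auto
    then have "A \<inter> {0<..q} = A \<inter> {0<..r}"
      using q by force
    then have "counting A q = counting A r"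
      using q by (simp add: counting_def)
    then show False
      using r q by (auto simp: jump_points_def)
  qed
qed

definition canonical_clocks :: "'e set \<Rightarrow> ('e \<Rightarrow> real \<Rightarrow> nat) measure" where
  "canonical_clocks E = restrict_space (clock_paths E) {clock_map E R |R. loc_fin_rings E R}"

lemma clock_map_in_space: "clock_map E R \<in> space (clock_paths E)"
  by (auto simp: clock_map_def space_PiM counting_def)

lemma space_canonical_clocks: "space (canonical_clocks E) = {clock_map E R |R. loc_fin_rings E R}"
  unfolding canonical_clocks_def space_restrict_space using clock_map_in_space by auto

lemma jump_points_clock_map: "loc_fin_rings E R \<Longrightarrow> e \<in> E \<Longrightarrow> jump_points (clock_map E R e) = R e"
  unfolding clock_map_def loc_fin_rings_def by (simp add: jump_points_counting)

lemma clock_space_canonical: "clock_space (canonical_clocks E) E (\<lambda>e c. jump_points (c e))"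
  unfolding clock_space_def
proof (intro conjI ballI allI impI)
  fix c assume "c \<in> space (canonical_clocks E)"
  then obtain R where "c = clock_map E R" "loc_fin_rings E R"
    unfolding space_canonical_clocks by auto
  then show "loc_fin_rings E (\<lambda>e. jump_points (c e))"
    using jump_points_clock_map[of E R] unfolding loc_fin_rings_def by simp
next
  fix e and t :: real assume e: "e \<in> E" and t: "0 \<le> t"
  have "(\<lambda>c. c e t) \<in> clock_paths E \<rightarrow>\<^sub>M count_space UNIV"
    by (rule measurable_compose[OF measurable_component_singleton[OF e] measurable_component_singleton])
       (use t in simp)
  then have "(\<lambda>c. c e t) \<in> canonical_clocks E \<rightarrow>\<^sub>M count_space UNIV"
    unfolding canonical_clocks_def by (rule measurable_restrict_space1)
  moreover have "card (jump_points (c e) \<inter> {0<..t}) = c e t" if c: "c \<in> space (canonical_clocks E)" for c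
  proof -
    obtain R where R: "c = clock_map E R" "loc_fin_rings E R"
      using c unfolding space_canonical_clocks by auto
    then have "jump_points (c e) = R e"
      using jump_points_clock_map[OF R(2) e] by simp
    then show ?thesis
      using R e t by (simp add: clock_map_def counting_def)
  qed
  ultimately show "(\<lambda>c. card (jump_points (c e) \<inter> {0<..t})) \<in> canonical_clocks E \<rightarrow>\<^sub>M count_space UNIV"
    by (subst measurable_cong)
qed

text \<open>Measurability is checked on the canonical clocks only. The second premise says that
  \<open>Q\<close> looks at no clocks outside \<open>E\<close>, about which the counting paths carry
  no information.\<close>

lemma clock_eventI:
  assumes sets: "{c\<in>space (canonical_clocks E). Q (\<lambda>e. jump_points (c e))} \<in> sets (canonical_clocks E)"
    and cong: "\<And>R R'. (\<And>e. e \<in> E \<Longrightarrow> R e = R' e) \<Longrightarrow> Q R \<Longrightarrow> Q R'"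
  shows "clock_event E Q"
proof -
  obtain A where A: "A \<in> sets (clock_paths E)"
    "{c\<in>space (canonical_clocks E). Q (\<lambda>e. jump_points (c e))} = A \<inter> {clock_map E R |R. loc_fin_rings E R}"
    using sets unfolding canonical_clocks_def sets_restrict_space by auto
  have "Q R \<longleftrightarrow> clock_map E R \<in> A" if R: "loc_fin_rings E R" for R
  proof -
    have c: "clock_map E R \<in> space (canonical_clocks E)"
      using R unfolding space_canonical_clocks by auto
    have "Q R \<longleftrightarrow> Q (\<lambda>e. jump_points (clock_map E R e))"
      using cong[of R "\<lambda>e. jump_points (clock_map E R e)"] cong[of "\<lambda>e. jump_points (clock_map E R e)" R]
        jump_points_clock_map[OF R] by auto
    also have "\<dots> \<longleftrightarrow> clock_map E R \<in> A \<inter> {clock_map E R |R. loc_fin_rings E R}"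
      unfolding A(2)[symmetric] using c by simp
    finally show ?thesis
      using R by auto
  qed
  then show ?thesis
    using A(1) unfolding clock_event_def by blast
qed

section \<open>The inequality for the gap probability\<close>

lemma next_occupied_le: "t \<le> s \<Longrightarrow> occupied G R s v \<Longrightarrow> next_occupied G R v t \<le> ereal s"
  unfolding next_occupied_def by (intro Inf_lower) auto

text \<open>By domination, every occupation time \<open>r\<close> from \<open>s + t\<close> on gives
  the occupation time \<open>r - s\<close> of the restarted process. A gap of the latter is thus a
  gap of the original process.\<close>

lemma next_occupied_restart:
  assumes G: "pair_wf_digraph G" and "0 \<le> s" "0 \<le> t"
    and less: "ereal u < next_occupied G (\<lambda>e. shift_rings s (R e)) v t"
  shows "ereal (s + u) < next_occupied G R v (s + t)"
proof -
  let ?x = "next_occupied G (\<lambda>e. shift_rings s (R e)) v t"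
  have "ereal (s + u) < ereal s + ?x"
    using less by (cases ?x) auto
  also have "\<dots> \<le> next_occupied G R v (s + t)"
    unfolding next_occupied_def[of G R]
  proof (rule Inf_greatest)
    fix y assume "y \<in> ereal ` {r. s + t \<le> r \<and> occupied G R r v}"
    then obtain r where r: "y = ereal r" "s + t \<le> r" "occupied G R r v"
      by auto
    have "occupied G (\<lambda>e. shift_rings s (R e)) (r - s) v"
      by (rule occupied_restart[OF G]) (use r assms in auto)
    then have "?x \<le> ereal (r - s)"
      using r by (intro next_occupied_le) auto
    then have "ereal s + ?x \<le> ereal s + ereal (r - s)"
      by (rule add_left_mono)
    then show "ereal s + ?x \<le> y"
      using r by simp
  qed
  finally show ?thesis .
qed

text \<open>If \<open>s < s'\<close> both belong to this set, then \<open>v\<close> is occupied at \<open>s'\<close> but empty on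
  \<open>{s + t..s + u}\<close>, which forces \<open>s' < s + t\<close>.\<close>

lemma emeasure_occupied_before_gap:
  fixes G R v t u
  defines "S \<equiv> {s. t \<le> s \<and> s \<le> u \<and> occupied G R s v \<and> ereal (s + u) < next_occupied G R v (s + t)}"
  assumes t: "0 \<le> t"
  shows "emeasure lborel S \<le> ennreal t * indicator {True} (next_occupied G R v t \<le> ereal u)"
proof (cases "S = {}")
  case False
  then obtain s0 where s0: "s0 \<in> S"
    by auto
  then have "next_occupied G R v t \<le> ereal s0"
    unfolding S_def by (intro next_occupied_le) auto
  also have "ereal s0 \<le> ereal u"
    using s0 by (simp add: S_def)
  finally have le: "next_occupied G R v t \<le> ereal u" .
  have gap: "s' < s + t" if "s \<in> S" "s' \<in> S" for s s'
  proof (rule ccontr)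
    assume "\<not> s' < s + t"
    then have "next_occupied G R v (s + t) \<le> ereal s'"
      using that by (intro next_occupied_le) (auto simp: S_def)
    moreover have "ereal (s + u) < next_occupied G R v (s + t)"
      using that by (simp add: S_def)
    ultimately have "s + u < s'"
      by (metis less_ereal.simps(1) less_le_trans)
    then show False
      using that t by (auto simp: S_def)
  qed
  have bdd: "bdd_below S"
    by (auto simp: S_def bdd_below_def)
  have "S \<subseteq> {Inf S..Inf S + t}"
  proof
    fix s' assume s': "s' \<in> S"
    have "s' - t \<le> s" if "s \<in> S" for s
      using gap[OF that s'] by simp
    then have "s' - t \<le> Inf S"
      by (rule cInf_greatest[OF False])
    then show "s' \<in> {Inf S..Inf S + t}"
      using cInf_lower[OF s' bdd] by auto
  qed
  then have "emeasure lborel S \<le> emeasure lborel {Inf S..Inf S + t}"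
    by (rule emeasure_mono) simp
  then show ?thesis
    using le t by simp
qed simp

locale crw_clocks = crw_graph G + unit_clocks M "parcs G" T
  for G :: "'v pair_pre_digraph" and M :: "'w measure" and T :: "'v \<times> 'v \<Rightarrow> 'w \<Rightarrow> real set"
begin

lemma clock_event_occupied:
  assumes v: "v \<in> pverts G"
  shows "clock_event (parcs G) (\<lambda>R. occupied G R s v)"
proof (rule clock_eventI)
  show "{c\<in>space (canonical_clocks (parcs G)). occupied G (\<lambda>e. jump_points (c e)) s v} \<in> sets (canonical_clocks (parcs G))"
    by (rule sets_occupied[OF clock_space_canonical v])
  show "occupied G R' s v" if "\<And>e. e \<in> parcs G \<Longrightarrow> R e = R' e" "occupied G R s v" for R R'
    using occupied_cong[of G R s R' s v] that by simp
qed

lemma clock_event_next_occupied: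
  assumes v: "v \<in> pverts G"
  shows "clock_event (parcs G) (\<lambda>R. u < next_occupied G R v t)"
proof (rule clock_eventI)
  note [measurable] = measurable_next_occupied[OF clock_space_canonical v, of t]
  show "{c\<in>space (canonical_clocks (parcs G)). u < next_occupied G (\<lambda>e. jump_points (c e)) v t} \<in> sets (canonical_clocks (parcs G))"
    by measurable
  show "u < next_occupied G R' v t" if R: "\<And>e. e \<in> parcs G \<Longrightarrow> R e = R' e" and less: "u < next_occupied G R v t" for R R'
  proof -
    have "occupied G R s v \<longleftrightarrow> occupied G R' s v" for s
      using occupied_cong[of G R s R' s v] R by simp
    then show ?thesis
      using less by (simp add: next_occupied_def)
  qed
qed

context
  fixes v assumes v: "v \<in> pverts G"
begin

definition p_occ :: "real \<Rightarrow> real" where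
  "p_occ s = prob {\<omega>\<in>space M. occupied G (\<lambda>e. T e \<omega>) s v}"

definition p_gap :: "real \<Rightarrow> real \<Rightarrow> real" where
  "p_gap t u = prob {\<omega>\<in>space M. ereal u < next_occupied G (\<lambda>e. T e \<omega>) v t}"

lemma occupied_past_iff: "occupied G (\<lambda>e. T e \<omega> \<inter> {..s}) s v \<longleftrightarrow> occupied G (\<lambda>e. T e \<omega>) s v"
  by (rule occupied_cong[where b = s]) auto

lemmas sets_occ = sets_occupied[OF clock_space v]

lemma sets_gap: "{\<omega>\<in>space M. u < next_occupied G (\<lambda>e. T e \<omega>) v t} \<in> sets M"
  using measurable_next_occupied[OF clock_space v, of t] by measurable

lemma sets_occ_gap:
  "{x\<in>space (lborel \<Otimes>\<^sub>M M). t \<le> fst x \<and> fst x \<le> u \<and> occupied G (\<lambda>e. T e (snd x)) (fst x) v \<and>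
      ereal (fst x + u) < next_occupied G (\<lambda>e. T e (snd x)) v (fst x + t)} \<in> sets (lborel \<Otimes>\<^sub>M M)"
proof -
  have [measurable]: "Measurable.pred (borel \<Otimes>\<^sub>M M) (\<lambda>x. occupied G (\<lambda>e. T e (snd x)) (fst x) v)"
    by (rule pred_occupied[OF clock_space v])
  have "(\<lambda>x. (\<lambda>y. next_occupied G (\<lambda>e. T e (snd y)) v (fst y)) (fst x + t, snd x)) \<in> borel_measurable (borel \<Otimes>\<^sub>M M)"
    by (rule measurable_compose[OF _ measurable_next_occupied_pair[OF clock_space v]]) measurable
  then have [measurable]: "(\<lambda>x. next_occupied G (\<lambda>e. T e (snd x)) v (fst x + t)) \<in> borel_measurable (borel \<Otimes>\<^sub>M M)"
    by simp
  have *: "{x\<in>space (borel \<Otimes>\<^sub>M M). t \<le> fst x \<and> fst x \<le> u \<and> occupied G (\<lambda>e. T e (snd x)) (fst x) v \<and>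
      ereal (fst x + u) < next_occupied G (\<lambda>e. T e (snd x)) v (fst x + t)} \<in> sets (borel \<Otimes>\<^sub>M M)"
    by measurable
  have sets: "sets (lborel \<Otimes>\<^sub>M M) = sets (borel \<Otimes>\<^sub>M M)"
    by (rule sets_pair_measure_cong) simp_all
  show ?thesis
    unfolding sets sets_eq_imp_space_eq[OF sets] by (rule *)
qed

text \<open>The product is the probability of occupation at \<open>s\<close> followed by a gap of
  the restarted process. Domination provides an inclusion of events, hence only an
  inequality.\<close>

lemma p_occ_times_p_gap_le:
  assumes "0 \<le> s" "0 \<le> t"
  shows "p_occ s * p_gap t u \<le>
    prob {\<omega>\<in>space M. occupied G (\<lambda>e. T e \<omega>) s v \<and> ereal (s + u) < next_occupied G (\<lambda>e. T e \<omega>) v (s + t)}"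
proof -
  have G: "pair_wf_digraph G"
    by unfold_locales
  have "p_occ s * p_gap t u = prob {\<omega>\<in>space M. occupied G (\<lambda>e. T e \<omega> \<inter> {..s}) s v \<and>
      ereal u < next_occupied G (\<lambda>e. shift_rings s (T e \<omega>)) v t}"
    using prob_past_future(1)[OF \<open>0 \<le> s\<close> clock_event_occupied[OF v] clock_event_next_occupied[OF v], of s "ereal u" t]
    by (simp add: p_occ_def p_gap_def occupied_past_iff)
  also have "\<dots> \<le> prob {\<omega>\<in>space M. occupied G (\<lambda>e. T e \<omega>) s v \<and> ereal (s + u) < next_occupied G (\<lambda>e. T e \<omega>) v (s + t)}"
  proof (rule finite_measure_mono)
    show "{\<omega>\<in>space M. occupied G (\<lambda>e. T e \<omega> \<inter> {..s}) s v \<and> ereal u < next_occupied G (\<lambda>e. shift_rings s (T e \<omega>)) v t}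
      \<subseteq> {\<omega>\<in>space M. occupied G (\<lambda>e. T e \<omega>) s v \<and> ereal (s + u) < next_occupied G (\<lambda>e. T e \<omega>) v (s + t)}"
      using next_occupied_restart[OF G assms] by (auto simp: occupied_past_iff)
    show "{\<omega>\<in>space M. occupied G (\<lambda>e. T e \<omega>) s v \<and> ereal (s + u) < next_occupied G (\<lambda>e. T e \<omega>) v (s + t)} \<in> events"
      using sets.Int[OF sets_occ[of s] sets_gap[of "ereal (s + u)" "s + t"]]
      by (simp add: Int_def conj_ac)
  qed
  finally show ?thesis .
qed

lemma measurable_p_occ: "p_occ \<in> borel_measurable borel"
proof -
  have "{x\<in>space (borel \<Otimes>\<^sub>M M). occupied G (\<lambda>e. T e (snd x)) (fst x) v} \<in> sets (borel \<Otimes>\<^sub>M M)"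
    using pred_occupied[OF clock_space v] by (simp add: pred_def)
  then have "(\<lambda>s. emeasure M (Pair s -` {x\<in>space (borel \<Otimes>\<^sub>M M). occupied G (\<lambda>e. T e (snd x)) (fst x) v})) \<in> borel_measurable borel"
    by (rule measurable_emeasure_Pair)
  moreover have "Pair s -` {x\<in>space (borel \<Otimes>\<^sub>M M). occupied G (\<lambda>e. T e (snd x)) (fst x) v} =
      {\<omega>\<in>space M. occupied G (\<lambda>e. T e \<omega>) s v}" for s
    by (auto simp: space_pair_measure)
  ultimately have "(\<lambda>s. enn2real (emeasure M {\<omega>\<in>space M. occupied G (\<lambda>e. T e \<omega>) s v})) \<in> borel_measurable borel"
    by simp
  then show ?thesis
    by (simp add: p_occ_def[abs_def] measure_def)
qed

lemma set_integrable_p_occ: "set_integrable lborel {t..u} p_occ"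
  unfolding set_integrable_def
proof (rule integrableI_bounded_set_indicator[where B = 1])
  show "p_occ \<in> borel_measurable lborel"
    using measurable_p_occ by simp
  show "emeasure lborel {t..u} < \<infinity>"
    by (cases "t \<le> u") auto
  show "AE x in lborel. x \<in> {t..u} \<longrightarrow> norm (p_occ x) \<le> 1"
    by (simp add: p_occ_def)
qed simp

text \<open>Tonelli for the set \<open>X\<close> of pairs of a time and an outcome. For
  \<open>s\<close> in \<open>{t..u}\<close> the section at \<open>s\<close> has probability at least
  \<open>p_occ s * p_gap t u\<close>; the section at an outcome has length at most \<open>t\<close>,
  and length 0 outside \<open>?N\<close>.\<close>

lemma p_gap_bound_aux:
  assumes t: "0 \<le> t" "t < u"
  shows "p_gap t u * (LBINT s:{t..u}. p_occ s) \<le> t * (1 - p_gap t u)"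
proof -
  interpret pair_sigma_finite lborel M ..
  define X where "X = {x\<in>space (lborel \<Otimes>\<^sub>M M). t \<le> fst x \<and> fst x \<le> u \<and> occupied G (\<lambda>e. T e (snd x)) (fst x) v \<and>
      ereal (fst x + u) < next_occupied G (\<lambda>e. T e (snd x)) v (fst x + t)}"
  have X: "X \<in> sets (lborel \<Otimes>\<^sub>M M)"
    unfolding X_def by (rule sets_occ_gap)
  let ?N = "{\<omega>\<in>space M. next_occupied G (\<lambda>e. T e \<omega>) v t \<le> ereal u}"
  have N: "?N \<in> sets M"
    using measurable_next_occupied[OF clock_space v, of t] by measurable
  have probN: "prob ?N = 1 - p_gap t u"
  proof -
    have "?N = space M - {\<omega>\<in>space M. ereal u < next_occupied G (\<lambda>e. T e \<omega>) v t}"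
      by auto
    then show ?thesis
      using prob_compl[OF sets_gap[of "ereal u" t]] by (simp add: p_gap_def)
  qed
  have "ennreal (p_gap t u * (LBINT s:{t..u}. p_occ s)) =
      (\<integral>\<^sup>+s. ennreal (p_gap t u * (indicator {t..u} s * p_occ s)) \<partial>lborel)"
    using set_integrable_p_occ[of t u] unfolding set_lebesgue_integral_def set_integrable_def
    by (subst nn_integral_eq_integral) (auto simp: p_gap_def p_occ_def)
  also have "\<dots> \<le> (\<integral>\<^sup>+s. emeasure M (Pair s -` X) \<partial>lborel)"
  proof (rule nn_integral_mono)
    fix s
    show "ennreal (p_gap t u * (indicator {t..u} s * p_occ s)) \<le> emeasure M (Pair s -` X)"
    proof (cases "s \<in> {t..u}")
      case True
      then have "Pair s -` X = {\<omega>\<in>space M. occupied G (\<lambda>e. T e \<omega>) s v \<and> ereal (s + u) < next_occupied G (\<lambda>e. T e \<omega>) v (s + t)}"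
        by (auto simp: X_def space_pair_measure)
      then show ?thesis
        using p_occ_times_p_gap_le[of s t u] True t
        by (simp add: emeasure_eq_measure mult.commute ennreal_leI)
    qed simp
  qed
  also have "\<dots> = emeasure (lborel \<Otimes>\<^sub>M M) X"
    by (rule sigma_finite_measure.emeasure_pair_measure_alt[OF prob_space_imp_sigma_finite[OF prob_space_axioms] X, symmetric])
  also have "\<dots> = (\<integral>\<^sup>+\<omega>. emeasure lborel ((\<lambda>s. (s, \<omega>)) -` X) \<partial>M)"
    by (rule emeasure_pair_measure_alt2[OF X])
  also have "\<dots> \<le> (\<integral>\<^sup>+\<omega>. ennreal t * indicator ?N \<omega> \<partial>M)"
  proof (rule nn_integral_mono)
    fix \<omega> assume \<omega>: "\<omega> \<in> space M"
    then have "(\<lambda>s. (s, \<omega>)) -` X = {s. t \<le> s \<and> s \<le> u \<and> occupied G (\<lambda>e. T e \<omega>) s v \<and>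
        ereal (s + u) < next_occupied G (\<lambda>e. T e \<omega>) v (s + t)}"
      by (auto simp: X_def space_pair_measure)
    then show "emeasure lborel ((\<lambda>s. (s, \<omega>)) -` X) \<le> ennreal t * indicator ?N \<omega>"
      using emeasure_occupied_before_gap[OF t(1), of u G "\<lambda>e. T e \<omega>" v] \<omega> by (simp add: indicator_def)
  qed
  also have "\<dots> = ennreal (t * prob ?N)"
    using t N by (simp add: nn_integral_cmult emeasure_eq_measure ennreal_mult)
  finally show ?thesis
    using t unfolding probN by (subst (asm) ennreal_le_iff) (auto simp: p_gap_def)
qed

theorem p_gap_bound:
  assumes t: "0 \<le> t" "t < u"
  shows "p_gap t u \<le> t / (t + (LBINT s:{t..u}. p_occ s))"
\<comment> \<open>At \<open>t = 0\<close> the right-hand side is 0, and so is the gap probability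
  because \<open>v\<close> is occupied at time 0. Otherwise the denominator is positive and one may
  divide.\<close>
proof (cases "t = 0")
  case True
  have "next_occupied G R v 0 \<le> ereal 0" for R
    by (rule next_occupied_le) (simp_all add: occupied_0 v)
  moreover have "ereal 0 < ereal u"
    using t by simp
  ultimately have "\<not> ereal u < next_occupied G R v 0" for R
    by (meson le_less_trans less_asym)
  then show ?thesis
    using True by (simp add: p_gap_def)
next
  case False
  have "0 \<le> (LBINT s:{t..u}. p_occ s)"
    unfolding set_lebesgue_integral_def by (intro integral_nonneg_AE) (auto simp: p_occ_def)
  then show ?thesis
    using p_gap_bound_aux[OF t] t False by (simp add: pos_le_divide_eq algebra_simps)
qed

end

end

section \<open>The Euler scheme and its error\<close>

text \<open>The first two terms of the binomial expansion. It absorbs the first-order gain of one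
  time step into the power of the next value of \<open>ext_prob\<close>.\<close>

lemma power_add_ge_linear:
  fixes q \<delta> :: real
  assumes "0 \<le> q" "0 \<le> \<delta>"
  shows "q ^ Suc n + real (Suc n) * q ^ n * \<delta> \<le> (q + \<delta>) ^ Suc n"
proof (induction n)
  case (Suc n)
  have "q ^ Suc (Suc n) + real (Suc (Suc n)) * q ^ Suc n * \<delta> \<le>
      (q ^ Suc n + real (Suc n) * q ^ n * \<delta>) * (q + \<delta>)"
    using assms by (simp add: algebra_simps)
  also have "\<dots> \<le> (q + \<delta>) ^ Suc n * (q + \<delta>)"
    using Suc assms by (intro mult_right_mono) auto
  finally show ?case
    by (simp add: mult.commute)
qed simp

text \<open>Euler scheme, with step size \<open>h\<close>, for the equation \<open>q' = D (1 - q)\<^sup>2\<close>, \<open>q 0 = 0\<close> with solution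
  \<open>1 - 1 / (1 + D t)\<close>: the extinction probability of critical binary branching at rate \<open>D\<close>.\<close>

primrec ext_prob :: "real \<Rightarrow> real \<Rightarrow> nat \<Rightarrow> real" where
  "ext_prob D h 0 = 0"
| "ext_prob D h (Suc k) = ext_prob D h k + D * h * (1 - ext_prob D h k)\<^sup>2"

text \<open>Coefficient of the squared cardinality in the error. The second difference of
  \<open>n\<^sup>2\<close> is 2 and there are at most \<open>D * n\<close> boundary edges, whence
  the factor \<open>1 + 2 * D * h\<close>; the added term bounds \<open>(w * h)\<^sup>2\<close> for
  \<open>w \<le> D * (D + 1) * n\<close> watched arcs.\<close>

primrec step_err :: "real \<Rightarrow> real \<Rightarrow> nat \<Rightarrow> real" where
  "step_err D h 0 = 0"
| "step_err D h (Suc k) = step_err D h k * (1 + 2 * D * h) + (D * (D + 1) * h)\<^sup>2"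

text \<open>With \<open>c = D * h\<close> the complement \<open>m\<close> moves to
  \<open>m * (1 - c * m)\<close>, so its reciprocal grows by \<open>c / (1 - c * m)\<close>, which
  is at most \<open>c / (1 - c)\<close>. This is the discrete form of the linear growth of
  \<open>1 / (1 - q)\<close> along the differential equation.\<close>

lemma ext_prob_bounds:
  assumes "0 \<le> D * h" "D * h < 1"
  shows "0 \<le> ext_prob D h k \<and> 1 / (1 + real k * (D * h / (1 - D * h))) \<le> 1 - ext_prob D h k"
proof (induction k)
  case (Suc k)
  let ?c = "D * h" and ?q = "ext_prob D h k"
  define m where "m = 1 - ?q"
  define a where "a = 1 + real k * (?c / (1 - ?c))"
  have a: "1 \<le> a"
    using assms by (simp add: a_def)
  have m: "1 / a \<le> m" "m \<le> 1"
    using Suc by (auto simp: m_def a_def)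
  have "0 < m"
    using m a by (meson less_le_trans zero_less_divide_1_iff zero_less_one)
  have cm: "?c * m \<le> ?c"
    using assms m by (simp add: mult_left_le)
  have "1 / (m * (1 - ?c * m)) = 1 / m + ?c / (1 - ?c * m)"
    using \<open>0 < m\<close> cm assms by (simp add: field_simps)
  also have "\<dots> \<le> a + ?c / (1 - ?c)"
  proof (rule add_mono)
    show "1 / m \<le> a"
      using m(1) \<open>0 < m\<close> a by (simp add: field_simps)
    show "?c / (1 - ?c * m) \<le> ?c / (1 - ?c)"
      using assms cm by (intro divide_left_mono) auto
  qed
  also have "\<dots> = 1 + real (Suc k) * (?c / (1 - ?c))"
    by (simp add: a_def distrib_right add_divide_distrib)
  finally have *: "1 / (m * (1 - ?c * m)) \<le> 1 + real (Suc k) * (?c / (1 - ?c))" .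
  have pos: "0 < m * (1 - ?c * m)"
    using \<open>0 < m\<close> cm assms by simp
  have "0 < 1 / (m * (1 - ?c * m))"
    using pos by simp
  then have pos2: "0 < 1 + real (Suc k) * (?c / (1 - ?c))"
    using * by linarith
  have "1 / (1 + real (Suc k) * (?c / (1 - ?c))) \<le> m * (1 - ?c * m)"
    using * pos pos2 by (simp add: pos_divide_le_eq mult.commute)
  moreover have "1 - ext_prob D h (Suc k) = m * (1 - ?c * m)"
    by (simp add: m_def power2_eq_square algebra_simps)
  moreover have "0 \<le> ext_prob D h (Suc k)"
    using Suc assms by simp
  ultimately show ?case
    by simp
qed simp

lemma step_err_nonneg: "0 \<le> D \<Longrightarrow> 0 \<le> h \<Longrightarrow> 0 \<le> step_err D h k"
  by (induction k) auto

text \<open>For fixed \<open>k * h\<close> the bound is of order \<open>h\<close>: one factor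
  \<open>h\<close> joins \<open>k\<close>, and the power stays below an exponential.\<close>

lemma step_err_le:
  assumes "0 \<le> D" "0 \<le> h"
  shows "step_err D h k \<le> (D * (D + 1))\<^sup>2 * h\<^sup>2 * real k * (1 + 2 * D * h) ^ k"
proof (induction k)
  case (Suc k)
  let ?c = "(D * (D + 1))\<^sup>2 * h\<^sup>2" and ?b = "1 + 2 * D * h"
  have b: "1 \<le> ?b"
    using assms by simp
  have "step_err D h k * ?b \<le> ?c * real k * ?b ^ k * ?b"
    using Suc b by (intro mult_right_mono) auto
  moreover have "?c * 1 \<le> ?c * ?b ^ Suc k"
    using b by (intro mult_left_mono one_le_power) auto
  ultimately have "step_err D h k * ?b + ?c \<le> ?c * real k * ?b ^ k * ?b + ?c * ?b ^ Suc k"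
    by linarith
  also have "\<dots> = ?c * real (Suc k) * ?b ^ Suc k"
    by (simp add: algebra_simps)
  finally show ?case
    by (simp add: power_mult_distrib)
qed simp

section \<open>Duality over a short time window\<close>

text \<open>One step of the backward dual: if \<open>(u, w)\<close> rings, then particles at \<open>u\<close> move to \<open>w\<close>.\<close>

definition dual_step :: "'v set \<Rightarrow> 'v \<times> 'v \<Rightarrow> 'v set" where
  "dual_step A e = (if snd e \<in> A then insert (fst e) A else A - {fst e})"

text \<open>The arcs leaving \<open>A\<close> or an in-neighbour of \<open>A\<close>. The arcs of an
  in-neighbour that lead elsewhere are included, since an earlier ring on one of them would carry
  its particle away before the arc into \<open>A\<close> rings.\<close>

definition watched_arcs :: "'v pair_pre_digraph \<Rightarrow> 'v set \<Rightarrow> ('v \<times> 'v) set" where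
  "watched_arcs G A = (\<Union>x\<in>A \<union> {x. \<exists>w\<in>A. (x, w) \<in> parcs G}. out_arcs G x)"

lemma watched_arcs_subset: "watched_arcs G A \<subseteq> parcs G"
  by (auto simp: watched_arcs_def out_arcs_def)

lemma arc_to_watched: "(x, w) \<in> parcs G \<Longrightarrow> w \<in> A \<Longrightarrow> (x, y) \<in> parcs G \<Longrightarrow> (x, y) \<in> watched_arcs G A"
  by (auto simp: watched_arcs_def out_arcs_def)

lemma arc_from_watched: "x \<in> A \<Longrightarrow> (x, y) \<in> parcs G \<Longrightarrow> (x, y) \<in> watched_arcs G A"
  by (auto simp: watched_arcs_def out_arcs_def)

lemma card_eq_0_shift_iff:
  assumes "\<And>b. finite (B \<inter> {..b})"
  shows "card (shift_rings r B \<inter> {0<..h}) = 0 \<longleftrightarrow> B \<inter> {r<..r + h} = {}"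
  using finite_rings_interval[OF assms] by (simp add: card_shift_rings)

lemma empty_before_no_rings:
  assumes fin: "loc_fin_rings (parcs G) R" and "0 \<le> h"
    and rings: "\<forall>e\<in>watched_arcs G A. card (shift_rings r (R e) \<inter> {0<..h}) = 0"
    and empty: "\<forall>y\<in>A. \<not> occupied G R (r + h) y"
  shows "\<forall>y\<in>A. \<not> occupied G R r y"
proof (intro ballI notI)
  fix y assume y: "y \<in> A" and occ: "occupied G R r y"
  have "R (y, w) \<inter> {r<..r + h} = {}" if "(y, w) \<in> parcs G" for w
    using rings arc_from_watched[OF y that] card_eq_0_shift_iff[of "R (y, w)" r h] fin that
    by (auto simp: loc_fin_rings_def)
  then have "out_rings G R y \<inter> {r<..r + h} = {}"
    by (fastforce simp: disjoint_iff out_rings_iff)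
  then show False
    using occupied_stay[OF occ, of "r + h"] \<open>0 \<le> h\<close> empty y by auto
qed

text \<open>A particle on the dual set at time \<open>r\<close> would be in \<open>A\<close> at time
  \<open>r + h\<close>. If it is at \<open>u\<close>, then \<open>w\<close> belongs to
  \<open>A\<close> and the ring carries it there; elsewhere it is already in \<open>A\<close>. In
  both cases the remaining watched arcs are silent and hold it in place.\<close>

lemma empty_before_one_ring:
  assumes fin: "loc_fin_rings (parcs G) R" and "0 \<le> h" and loop: "u \<noteq> w"
    and uw: "(u, w) \<in> watched_arcs G A"
    and rings: "\<forall>e\<in>watched_arcs G A. card (shift_rings r (R e) \<inter> {0<..h}) = (if e = (u, w) then 1 else 0)"
    and empty: "\<forall>y\<in>A. \<not> occupied G R (r + h) y"
  shows "\<forall>y\<in>dual_step A (u, w). \<not> occupied G R r y"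
proof (intro ballI notI)
  fix y assume y: "y \<in> dual_step A (u, w)" and occ: "occupied G R r y"
  have fin': "finite (R e \<inter> {..b})" if "e \<in> parcs G" for e b
    using fin that by (auto simp: loc_fin_rings_def)
  have quiet: "R e \<inter> {r<..r + h} = {}" if "e \<in> watched_arcs G A" "e \<noteq> (u, w)" for e
  proof -
    have "e \<in> parcs G"
      using that watched_arcs_subset[of G A] by blast
    from card_eq_0_shift_iff[OF fin'[OF this], where r = r and h = h] show ?thesis
      using rings that by simp
  qed
  show False
  proof (cases "y = u")
    case False
    then have yA: "y \<in> A"
      using y by (auto simp: dual_step_def split: if_splits)
    have "R (y, z) \<inter> {r<..r + h} = {}" if "(y, z) \<in> parcs G" for z
      using quiet[OF arc_from_watched[OF yA that]] False by simp
    then have "out_rings G R y \<inter> {r<..r + h} = {}"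
      by (fastforce simp: disjoint_iff out_rings_iff)
    then show False
      using occupied_stay[OF occ, of "r + h"] \<open>0 \<le> h\<close> empty yA by auto
  next
    case True
    then have wA: "w \<in> A"
      using y by (auto simp: dual_step_def split: if_splits)
    have arc: "(u, w) \<in> parcs G"
      using uw watched_arcs_subset by blast
    have "card (R (u, w) \<inter> {r<..r + h}) = 1"
      using rings uw by (simp add: card_shift_rings)
    then obtain a where a: "R (u, w) \<inter> {r<..r + h} = {a}"
      by (auto simp: card_1_singleton_iff)
    then have ring: "a \<in> R (u, w)" "r < a" "a \<le> r + h"
      by auto
    have "R (u, z) \<inter> {r<..<a} = {}" if "(u, z) \<in> parcs G" for z
    proof (cases "z = w")
      case True
      have "R (u, w) \<inter> {r<..<a} \<subseteq> R (u, w) \<inter> {r<..r + h} - {a}"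
        using ring by auto
      then show ?thesis
        unfolding a True by auto
    next
      case False
      have "R (u, z) \<inter> {r<..<a} \<subseteq> R (u, z) \<inter> {r<..r + h}"
        using ring by auto
      then show ?thesis
        using quiet[OF arc_to_watched[OF arc wA that]] False by auto
    qed
    then have u: "out_rings G R u \<inter> {r<..<a} = {}"
      by (fastforce simp: disjoint_iff out_rings_iff)
    have "R (w, z) \<inter> {a<..r + h} = {}" if "(w, z) \<in> parcs G" for z
    proof -
      have "R (w, z) \<inter> {a<..r + h} \<subseteq> R (w, z) \<inter> {r<..r + h}"
        using ring by auto
      then show ?thesis
        using quiet[OF arc_from_watched[OF wA that]] loop by auto
    qed
    then have w: "out_rings G R w \<inter> {a<..r + h} = {}"
      by (fastforce simp: disjoint_iff out_rings_iff)
    have "occupied G R (r + h) w"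
      using occ True by (intro occupied_move[OF _ arc ring u w]) simp
    then show False
      using empty wA by simp
  qed
qed

section \<open>Comparison of the emptiness probability with branching\<close>

context crw_clocks
begin

lemma clock_event_counts:
  assumes W: "finite W" "W \<subseteq> parcs G" and h: "0 \<le> h"
  shows "clock_event (parcs G) (\<lambda>R. \<forall>e\<in>W. card (R e \<inter> {0<..h}) = n e)"
proof (rule clock_eventI)
  let ?N = "canonical_clocks (parcs G)"
  show "{c\<in>space ?N. \<forall>e\<in>W. card (jump_points (c e) \<inter> {0<..h}) = n e} \<in> sets ?N"
  proof (intro sets.sets_Collect_finite_All W(1))
    fix e assume "e \<in> W"
    then have "(\<lambda>c. card (jump_points (c e) \<inter> {0<..h})) \<in> ?N \<rightarrow>\<^sub>M count_space UNIV"
      using clock_space_canonical[of "parcs G"] W(2) h unfolding clock_space_def by auto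
    from measurable_sets[OF this, of "{n e}"]
    show "{c\<in>space ?N. card (jump_points (c e) \<inter> {0<..h}) = n e} \<in> sets ?N"
      by (simp add: vimage_def Int_def conj_commute)
  qed
  show "\<forall>e\<in>W. card (R' e \<inter> {0<..h}) = n e"
    if "\<And>e. e \<in> parcs G \<Longrightarrow> R e = R' e" "\<forall>e\<in>W. card (R e \<inter> {0<..h}) = n e" for R R'
  proof
    fix e assume "e \<in> W"
    then have "R e = R' e"
      using that(1) W(2) by blast
    then show "card (R' e \<inter> {0<..h}) = n e"
      using that(2) \<open>e \<in> W\<close> by auto
  qed
qed

lemma prob_counts:
  assumes W: "finite W" "W \<subseteq> parcs G" and h: "0 < h"
  shows "prob {\<omega>\<in>space M. \<forall>e\<in>W. card (T e \<omega> \<inter> {0<..h}) = n e} = (\<Prod>e\<in>W. pmf (poisson_pmf h) (n e))"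
proof -
  have sets: "{c\<in>space path_space. c h = k} \<in> sets path_space" for k
  proof -
    have "(\<lambda>c. c h) \<in> path_space \<rightarrow>\<^sub>M count_space UNIV"
      using h by (intro measurable_component_singleton) simp
    from measurable_sets[OF this, of "{k}"] show ?thesis
      by (simp add: vimage_def Int_def conj_commute)
  qed
  have sp: "counting A \<in> space path_space" for A
    by (simp add: counting_def space_PiM)
  have "prob {\<omega>\<in>space M. \<forall>e\<in>W. counting (T e \<omega>) \<in> {c\<in>space path_space. c h = n e}} =
      (\<Prod>e\<in>W. prob {\<omega>\<in>space M. counting (T e \<omega>) \<in> {c\<in>space path_space. c h = n e}})"
    by (rule prob_indep_vars_all[OF indep W sets])
  also have "\<dots> = (\<Prod>e\<in>W. pmf (poisson_pmf h) (n e))"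
  proof (rule prod.cong[OF refl])
    fix e assume "e \<in> W"
    then have e: "poisson_process M 1 (T e)"
      using W poisson by blast
    have "prob {\<omega>\<in>space M. counting (T e \<omega>) \<in> {c\<in>space path_space. c h = n e}} =
        prob ((\<lambda>\<omega>. card (T e \<omega> \<inter> {0<..h})) -` {n e} \<inter> space M)"
      using h by (intro arg_cong[where f = prob]) (auto simp: sp counting_apply)
    also have "\<dots> = measure (distr M (count_space UNIV) (\<lambda>\<omega>. card (T e \<omega> \<inter> {0<..h}))) {n e}"
      by (rule measure_distr[symmetric]) (auto intro: poisson_measurable[OF e])
    also have "distr M (count_space UNIV) (\<lambda>\<omega>. card (T e \<omega> \<inter> {0<..h})) = measure_pmf (poisson_pmf h)"
      using e h unfolding poisson_process_def by auto
    finally show "prob {\<omega>\<in>space M. counting (T e \<omega>) \<in> {c\<in>space path_space. c h = n e}} = pmf (poisson_pmf h) (n e)"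
      by (simp add: pmf.rep_eq)
  qed
  finally show ?thesis
    using h by (simp add: sp counting_apply)
qed

definition p_empty :: "real \<Rightarrow> 'v set \<Rightarrow> real" where
  "p_empty r A = prob {\<omega>\<in>space M. \<forall>y\<in>A. \<not> occupied G (\<lambda>e. T e \<omega>) r y}"

lemma clock_event_empty:
  assumes "finite A" "A \<subseteq> pverts G"
  shows "clock_event (parcs G) (\<lambda>R. \<forall>y\<in>A. \<not> occupied G R r y)"
proof (rule clock_eventI)
  let ?N = "canonical_clocks (parcs G)"
  show "{c\<in>space ?N. \<forall>y\<in>A. \<not> occupied G (\<lambda>e. jump_points (c e)) r y} \<in> sets ?N"
    using assms
    by (intro sets.sets_Collect_finite_All sets.sets_Collect_neg sets_occupied[OF clock_space_canonical]) auto
  show "\<forall>y\<in>A. \<not> occupied G R' r y"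
    if "\<And>e. e \<in> parcs G \<Longrightarrow> R e = R' e" "\<forall>y\<in>A. \<not> occupied G R r y" for R R'
    using occupied_cong[of G R r R' r] that by simp
qed

lemma p_empty_bounds: "0 \<le> p_empty r A" "p_empty r A \<le> 1"
  by (simp_all add: p_empty_def)

lemma finite_out_arcs: "x \<in> pverts G \<Longrightarrow> finite (out_arcs G x)"
  using locfin by (simp add: locally_finite_graph_def)

text \<open>By symmetry the in-neighbours of \<open>A\<close> are out-neighbours, at most
  \<open>D * card A\<close> in number. Together with \<open>A\<close> these are at most
  \<open>(D + 1) * card A\<close> vertices with at most \<open>D\<close> arcs each.\<close>

lemma watched_arcs_finite:
  assumes A: "finite A" "A \<subseteq> pverts G" and D: "\<And>x. x \<in> pverts G \<Longrightarrow> out_degree G x \<le> D"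
  shows "finite (watched_arcs G A)" and "card (watched_arcs G A) \<le> D * (D + 1) * card A"
proof -
  define N where "N = {x. \<exists>w\<in>A. (x, w) \<in> parcs G}"
  have deg: "card (out_arcs G x) \<le> D" if "x \<in> pverts G" for x
    using D[OF that] by (simp add: out_degree_def)
  have N: "N \<subseteq> snd ` (\<Union>x\<in>A. out_arcs G x)"
  proof
    fix x assume "x \<in> N"
    then obtain w where w: "w \<in> A" "(x, w) \<in> parcs G"
      by (auto simp: N_def)
    then have "(w, x) \<in> parcs G"
      using arcs_symmetric by blast
    then show "x \<in> snd ` (\<Union>x\<in>A. out_arcs G x)"
      using w(1) by (intro image_eqI[of _ _ "(w, x)"]) (auto simp: out_arcs_def)
  qed
  have finA: "finite (\<Union>x\<in>A. out_arcs G x)"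
    using A finite_out_arcs by auto
  have "card N \<le> card (snd ` (\<Union>x\<in>A. out_arcs G x))"
    by (rule card_mono[OF finite_imageI[OF finA] N])
  also have "\<dots> \<le> card (\<Union>x\<in>A. out_arcs G x)"
    by (rule card_image_le[OF finA])
  also have "\<dots> \<le> (\<Sum>x\<in>A. card (out_arcs G x))"
    by (rule card_UN_le[OF A(1)])
  also have "\<dots> \<le> card A * D"
    using sum_bounded_above[of A "\<lambda>x. card (out_arcs G x)" D] deg A(2) by auto
  finally have cN: "card N \<le> card A * D" .
  have fN: "finite N"
    using finite_subset[OF N] finA by simp
  have sub: "A \<union> N \<subseteq> pverts G"
    using A(2) in_arcsD1 by (auto simp: N_def)
  have W: "watched_arcs G A = (\<Union>x\<in>A \<union> N. out_arcs G x)"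
    by (simp add: watched_arcs_def N_def)
  show "finite (watched_arcs G A)"
    unfolding W using A fN sub finite_out_arcs by auto
  have "card (watched_arcs G A) \<le> (\<Sum>x\<in>A \<union> N. card (out_arcs G x))"
    unfolding W by (rule card_UN_le) (use A fN in auto)
  also have "\<dots> \<le> card (A \<union> N) * D"
    using sum_bounded_above[of "A \<union> N" "\<lambda>x. card (out_arcs G x)" D] deg sub by auto
  also have "\<dots> \<le> (card A + card A * D) * D"
    using card_Un_le[of A N] cN by (intro mult_right_mono) auto
  finally show "card (watched_arcs G A) \<le> D * (D + 1) * card A"
    by (simp add: algebra_simps)
qed

lemma dual_step_pverts:
  assumes "finite A" "A \<subseteq> pverts G" "e \<in> parcs G"
  shows "finite (dual_step A e)" "dual_step A e \<subseteq> pverts G"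
  using assms arc_fst_in_verts[OF assms(3)] by (auto simp: dual_step_def)

text \<open>The window \<open>{r<..r + h}\<close> is split by its rings on the watched arcs: none,
  or a single ring on one arc. In each case emptiness of \<open>A\<close> is passed on to a set at
  time \<open>r\<close>, which is independent of the window; everything else is of second order in
  \<open>w * h\<close>.\<close>

lemma p_empty_step:
  assumes A: "finite A" "A \<subseteq> pverts G" and r: "0 \<le> r" and h: "0 < h"
    and W: "finite (watched_arcs G A)"
  defines "w \<equiv> real (card (watched_arcs G A))"
  shows "p_empty (r + h) A \<le>
    (1 - w * h) * p_empty r A + h * (\<Sum>e\<in>watched_arcs G A. p_empty r (dual_step A e)) + (w * h)\<^sup>2"
proof -
  let ?W = "watched_arcs G A"
  have WE: "?W \<subseteq> parcs G"
    by (rule watched_arcs_subset)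
  \<comment> \<open>\<open>None\<close> stands for no ring on the watched arcs,
    \<open>Some e\<close> for exactly one ring, on \<open>e\<close>.\<close>
  define I where "I = insert None (Some ` ?W)"
  define B where "B i = (case i of None \<Rightarrow> A | Some e \<Rightarrow> dual_step A e)" for i
  define n where "n i e = (if Some e = i then 1 else 0 :: nat)" for i and e :: "'v \<times> 'v"
  define \<pi> where "\<pi> i = (\<Prod>e\<in>?W. pmf (poisson_pmf h) (n i e))" for i
  define F where "F = {\<omega>\<in>space M. \<forall>y\<in>A. \<not> occupied G (\<lambda>e. T e \<omega>) (r + h) y}"
  define H where "H i = {\<omega>\<in>space M. \<forall>e\<in>?W. card (shift_rings r (T e \<omega>) \<inter> {0<..h}) = n i e}" for i
  have finI: "finite I"
    by (simp add: I_def W)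
  have B: "finite (B i)" "B i \<subseteq> pverts G" if "i \<in> I" for i
  proof -
    have "finite (B i) \<and> B i \<subseteq> pverts G"
    proof (cases i)
      case None
      then show ?thesis
        using A by (simp add: B_def)
    next
      case (Some e)
      then have "e \<in> parcs G"
        using that WE by (auto simp: I_def)
      then show ?thesis
        using dual_step_pverts[OF A] by (simp add: B_def Some)
    qed
    then show "finite (B i)" "B i \<subseteq> pverts G"
      by blast+
  qed
  have ce: "clock_event (parcs G) (\<lambda>R. \<forall>e\<in>?W. card (R e \<inter> {0<..h}) = n i e)" for i
    using h by (intro clock_event_counts W WE) simp
  have Hsets: "H i \<in> events" and Hprob: "prob (H i) = \<pi> i" for i
  proof -
    \<comment> \<open>The empty set makes the past event trivial, which leaves the law of the window
      alone.\<close>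
    note * = prob_past_future[OF r clock_event_empty[of "{}" r] ce[of i]]
    show "H i \<in> events"
      using *(2) by (simp add: H_def)
    show "prob (H i) = \<pi> i"
      using *(1) prob_counts[OF W WE h, of "n i"] by (simp add: H_def \<pi>_def prob_space)
  qed
  have Fsets: "F \<in> events"
    unfolding F_def by (rule clock_event_sets[OF clock_event_empty[OF A]])
  have FH: "prob (F \<inter> H i) \<le> p_empty r (B i) * \<pi> i" if i: "i \<in> I" for i
  proof -
    let ?P = "\<lambda>R. \<forall>y\<in>B i. \<not> occupied G R r y"
    have past: "?P (\<lambda>e. T e \<omega> \<inter> {..r}) \<longleftrightarrow> ?P (\<lambda>e. T e \<omega>)" for \<omega>
      using occupied_cong[of G "\<lambda>e. T e \<omega> \<inter> {..r}" r "\<lambda>e. T e \<omega>" r] by auto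
    note * = prob_past_future[OF r clock_event_empty[OF B[OF i], of r] ce[of i]]
    have "F \<inter> H i \<subseteq> {\<omega>\<in>space M. ?P (\<lambda>e. T e \<omega> \<inter> {..r}) \<and>
        (\<forall>e\<in>?W. card (shift_rings r (T e \<omega>) \<inter> {0<..h}) = n i e)}"
    proof
      fix \<omega> assume \<omega>: "\<omega> \<in> F \<inter> H i"
      then have sp: "\<omega> \<in> space M" and emp: "\<forall>y\<in>A. \<not> occupied G (\<lambda>e. T e \<omega>) (r + h) y"
        and rings: "\<forall>e\<in>?W. card (shift_rings r (T e \<omega>) \<inter> {0<..h}) = n i e"
        by (auto simp: F_def H_def)
      have "?P (\<lambda>e. T e \<omega>)"
      proof (cases i)
        case None
        then show ?thesis
          using empty_before_no_rings[OF loc_fin[OF sp] _ _ emp] rings h by (simp add: B_def n_def)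
      next
        case (Some e)
        obtain u x where e: "e = (u, x)"
          by (cases e)
        have eW: "(u, x) \<in> ?W"
          using i Some e by (auto simp: I_def)
        have loop: "u \<noteq> x"
          using pair_no_loops[of "(u, x)"] eW WE by auto
        have "\<forall>e'\<in>?W. card (shift_rings r (T e' \<omega>) \<inter> {0<..h}) = (if e' = (u, x) then 1 else 0)"
          using rings by (simp add: n_def Some e)
        from empty_before_one_ring[OF loc_fin[OF sp] _ loop eW this emp] show ?thesis
          using h by (simp add: B_def Some e)
      qed
      then show "\<omega> \<in> {\<omega>\<in>space M. ?P (\<lambda>e. T e \<omega> \<inter> {..r}) \<and>
        (\<forall>e\<in>?W. card (shift_rings r (T e \<omega>) \<inter> {0<..h}) = n i e)}"
        using sp rings past by simp
    qed
    then have "prob (F \<inter> H i) \<le> prob {\<omega>\<in>space M. ?P (\<lambda>e. T e \<omega> \<inter> {..r}) \<and>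
        (\<forall>e\<in>?W. card (shift_rings r (T e \<omega>) \<inter> {0<..h}) = n i e)}"
      by (rule finite_measure_mono) (rule *(2))
    also have "\<dots> = p_empty r (B i) * \<pi> i"
      using *(1) unfolding past p_empty_def \<pi>_def prob_counts[OF W WE h] .
    finally show ?thesis .
  qed
  have disj: "disjoint_family_on H I"
    unfolding disjoint_family_on_def
  proof (intro ballI impI)
    have neq: "H (Some e) \<inter> H j = {}" if "e \<in> ?W" "j \<noteq> Some e" for e j
    proof (rule equals0I)
      fix \<omega> assume "\<omega> \<in> H (Some e) \<inter> H j"
      then have "card (shift_rings r (T e \<omega>) \<inter> {0<..h}) = n (Some e) e"
          "card (shift_rings r (T e \<omega>) \<inter> {0<..h}) = n j e"
        using that(1) unfolding H_def by blast+
      then have "n (Some e) e = n j e"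
        by simp
      then show False
        using that(2) by (auto simp: n_def)
    qed
    fix i j assume ij: "i \<in> I" "j \<in> I" "i \<noteq> j"
    show "H i \<inter> H j = {}"
    proof (cases i)
      case None
      then obtain e where "j = Some e" "e \<in> ?W"
        using ij by (auto simp: I_def)
      then show ?thesis
        using neq[of e i] ij by (simp add: Int_commute)
    next
      case (Some e)
      then show ?thesis
        using neq[of e j] ij by (auto simp: I_def)
    qed
  qed
  have UH: "prob (\<Union>i\<in>I. H i) = (\<Sum>i\<in>I. \<pi> i)"
    unfolding Hprob[symmetric] by (rule finite_measure_finite_Union[OF finI _ disj]) (use Hsets in auto)
  have UHs: "(\<Union>i\<in>I. H i) \<in> events" and FHs: "(\<Union>i\<in>I. F \<inter> H i) \<in> events"
    by (intro sets.finite_UN finI sets.Int Fsets Hsets)+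
  \<comment> \<open>The complement collects the outcomes with at least two watched rings; on it
    emptiness is simply bounded by 1.\<close>
  have "F \<subseteq> (\<Union>i\<in>I. F \<inter> H i) \<union> (space M - (\<Union>i\<in>I. H i))"
    using sets.sets_into_space[OF Fsets] by blast
  then have "prob F \<le> prob ((\<Union>i\<in>I. F \<inter> H i) \<union> (space M - (\<Union>i\<in>I. H i)))"
    by (rule finite_measure_mono) (intro sets.Un sets.Diff sets.top UHs FHs)
  also have "\<dots> \<le> prob (\<Union>i\<in>I. F \<inter> H i) + prob (space M - (\<Union>i\<in>I. H i))"
    by (intro measure_Un_le sets.Diff sets.top UHs FHs)
  also have "prob (\<Union>i\<in>I. F \<inter> H i) \<le> (\<Sum>i\<in>I. prob (F \<inter> H i))"
    by (rule measure_UNION_le[OF finI]) (use Fsets Hsets in blast)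
  also have "(\<Sum>i\<in>I. prob (F \<inter> H i)) \<le> (\<Sum>i\<in>I. p_empty r (B i) * \<pi> i)"
    by (rule sum_mono) (rule FH)
  also have "prob (space M - (\<Union>i\<in>I. H i)) = 1 - (\<Sum>i\<in>I. \<pi> i)"
    unfolding UH[symmetric] by (rule prob_compl[OF UHs])
  finally have main: "p_empty (r + h) A \<le> (\<Sum>i\<in>I. p_empty r (B i) * \<pi> i) + (1 - (\<Sum>i\<in>I. \<pi> i))"
    by (simp add: p_empty_def F_def)
  have sumI: "(\<Sum>i\<in>I. f i) = f None + (\<Sum>e\<in>?W. f (Some e))" for f :: "('v \<times> 'v) option \<Rightarrow> real"
    unfolding I_def using W by (subst sum.insert) (auto simp: sum.reindex)
  define c where "c = exp (- h) ^ card ?W"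
  have \<pi>0: "\<pi> None = c"
    using h by (simp add: \<pi>_def n_def c_def)
  have \<pi>1: "\<pi> (Some e) = h * c" if "e \<in> ?W" for e
  proof -
    have "pmf (poisson_pmf h) (n (Some e) e') = (if e' = e then h else 1) * exp (- h)" for e'
      using h by (simp add: n_def)
    then have "\<pi> (Some e) = (\<Prod>e'\<in>?W. (if e' = e then h else 1)) * c"
      by (simp add: \<pi>_def prod.distrib c_def)
    then show ?thesis
      using W that by simp
  qed
  define S where "S = (\<Sum>e\<in>?W. p_empty r (dual_step A e))"
  define x where "x = p_empty r A + h * S"
  have "(\<Sum>i\<in>I. p_empty r (B i) * \<pi> i) = c * x"
    by (simp add: sumI \<pi>0 \<pi>1 B_def x_def S_def sum_distrib_left algebra_simps)
  moreover have "(\<Sum>i\<in>I. \<pi> i) = c * (1 + w * h)"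
    by (simp add: sumI \<pi>0 \<pi>1 w_def algebra_simps)
  ultimately have main': "p_empty (r + h) A \<le> 1 - c * (1 + w * h - x)"
    using main by (simp add: algebra_simps)
  have "S \<le> w"
    unfolding S_def w_def using sum_bounded_above[of ?W "\<lambda>e. p_empty r (dual_step A e)" 1] p_empty_bounds by simp
  then have "x \<le> 1 + w * h"
    unfolding x_def using p_empty_bounds(2)[of r A] h by (simp add: add_mono mult.commute)
  \<comment> \<open>The bound \<open>1 - c * (1 + w * h - x)\<close> decreases in \<open>c\<close>
    because \<open>x \<le> 1 + w * h\<close>. Hence \<open>c = exp (- (w * h))\<close> may be
    replaced by its linear lower bound, even a negative one.\<close>
  moreover have "1 - w * h \<le> c"
  proof -
    have "c = exp (- (w * h))"
      by (simp add: c_def w_def exp_of_nat_mult[symmetric])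
    then show ?thesis
      using exp_ge_add_one_self[of "- (w * h)"] by simp
  qed
  ultimately have "(1 - w * h) * (1 + w * h - x) \<le> c * (1 + w * h - x)"
    by (intro mult_right_mono) auto
  then have "p_empty (r + h) A \<le> 1 - (1 - w * h) * (1 + w * h - x)"
    using main' by linarith
  also have "\<dots> = (1 - w * h) * p_empty r A + h * S + (w * h)\<^sup>2 - w * h * (h * S)"
    by (simp add: x_def algebra_simps power2_eq_square)
  also have "\<dots> \<le> (1 - w * h) * p_empty r A + h * S + (w * h)\<^sup>2"
  proof -
    have "0 \<le> S"
      unfolding S_def by (intro sum_nonneg p_empty_bounds)
    then show ?thesis
      using h by (simp add: w_def)
  qed
  finally show ?thesis
    by (simp add: S_def)
qed

text \<open>An arc into \<open>A\<close> from outside adds a vertex, an arc out of \<open>A\<close>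
  removes one, and all others leave \<open>A\<close> unchanged. Reversal pairs the first two kinds,
  so growth and loss occur at the same rate \<open>b\<close>, the number of boundary edges, and only
  the second difference of \<open>f\<close> remains.\<close>

lemma sum_dual_step:
  assumes A: "finite A" "A \<subseteq> pverts G" and D: "\<And>x. x \<in> pverts G \<Longrightarrow> out_degree G x \<le> D"
    and W: "finite (watched_arcs G A)"
  obtains b where "b \<le> D * card A"
    "\<And>f :: nat \<Rightarrow> real. (\<Sum>e\<in>watched_arcs G A. f (card (dual_step A e)) - f (card A)) =
      real b * (f (card A + 1) + f (card A - 1) - 2 * f (card A))"
proof -
  let ?W = "watched_arcs G A"
  let ?In = "{e\<in>?W. snd e \<in> A \<and> fst e \<notin> A}" and ?Out = "{e\<in>?W. fst e \<in> A \<and> snd e \<notin> A}"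
  have sym: "(y, x) \<in> parcs G" if "(x, y) \<in> parcs G" for x y
    using arcs_symmetric that by blast
  have "bij_betw prod.swap ?In ?Out"
  proof (rule bij_betwI[where g = prod.swap])
    show "prod.swap \<in> ?In \<rightarrow> ?Out"
      using arc_from_watched sym watched_arcs_subset[of G A] by fastforce
    show "prod.swap \<in> ?Out \<rightarrow> ?In"
      using arc_to_watched sym watched_arcs_subset[of G A] by fastforce
  qed auto
  then have eq: "card ?In = card ?Out"
    by (rule bij_betw_same_card)
  have "?Out \<subseteq> (\<Union>x\<in>A. out_arcs G x)"
    using watched_arcs_subset[of G A] by (auto simp: out_arcs_def)
  then have "card ?Out \<le> card (\<Union>x\<in>A. out_arcs G x)"
    using A finite_out_arcs by (intro card_mono) auto
  also have "\<dots> \<le> (\<Sum>x\<in>A. card (out_arcs G x))"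
    by (rule card_UN_le[OF A(1)])
  also have "\<dots> \<le> D * card A"
    using sum_bounded_above[of A "\<lambda>x. card (out_arcs G x)" D] D A(2)
    by (auto simp: out_degree_def subset_iff mult.commute)
  finally have le: "card ?Out \<le> D * card A" .
  have "(\<Sum>e\<in>?W. f (card (dual_step A e)) - f (card A)) =
      real (card ?Out) * (f (card A + 1) + f (card A - 1) - 2 * f (card A))" for f :: "nat \<Rightarrow> real"
  proof -
    let ?a = "f (card A + 1) - f (card A)" and ?d = "f (card A - 1) - f (card A)"
    have "(\<Sum>e\<in>?W. f (card (dual_step A e)) - f (card A)) =
        (\<Sum>e\<in>?W. (if snd e \<in> A \<and> fst e \<notin> A then ?a else 0) + (if fst e \<in> A \<and> snd e \<notin> A then ?d else 0))"
      using A(1) by (intro sum.cong) (auto simp: dual_step_def insert_absorb)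
    also have "\<dots> = (\<Sum>e\<in>?In. ?a) + (\<Sum>e\<in>?Out. ?d)"
      unfolding sum.distrib using W by (simp only: sum.inter_filter)
    also have "\<dots> = real (card ?Out) * (?a + ?d)"
      using eq by (simp add: algebra_simps)
    finally show ?thesis
      by (simp add: algebra_simps)
  qed
  with le show ?thesis
    by (rule that)
qed

text \<open>The term \<open>step_err D h k * (real (card A))\<^sup>2\<close> is chosen so that the
  claim reproduces itself: its second difference is constant, and the error of one step is quadratic
  in the cardinality as well.\<close>

lemma p_empty_le:
  assumes D: "\<And>x. x \<in> pverts G \<Longrightarrow> out_degree G x \<le> D" and h: "0 < h" "real D * h < 1"
  shows "finite A \<Longrightarrow> A \<subseteq> pverts G \<Longrightarrow>
    p_empty (real k * h) A \<le> ext_prob D h k ^ card A + step_err D h k * (real (card A))\<^sup>2"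
proof (induction k arbitrary: A)
  case 0
  show ?case
  proof (cases "A = {}")
    case False
    then obtain y where "y \<in> A" "y \<in> pverts G"
      using 0 by auto
    then have "{\<omega>\<in>space M. \<forall>y\<in>A. \<not> occupied G (\<lambda>e. T e \<omega>) 0 y} = {}"
      using occupied_0[of y G] by blast
    then have "p_empty 0 A = 0"
      unfolding p_empty_def by (simp only: measure_empty)
    then show ?thesis
      by simp
  qed (simp add: p_empty_def prob_space)
next
  case (Suc k)
  note A = Suc.prems
  let ?W = "watched_arcs G A" and ?q = "ext_prob D h k" and ?a = "step_err D h k" and ?n = "card A"
  let ?q' = "ext_prob D h (Suc k)" and ?a' = "step_err D h (Suc k)"
  note W = watched_arcs_finite[OF A D]
  define f where "f m = ?q ^ m + ?a * (real m)\<^sup>2" for m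
  define w where "w = real (card ?W)"
  have q: "0 \<le> ?q" "0 \<le> ?q'" and a: "0 \<le> ?a" "0 \<le> ?a'"
    using ext_prob_bounds[of D h k] ext_prob_bounds[of D h "Suc k"] h step_err_nonneg[of D h] by auto
  have w: "0 \<le> w * h" "w * h \<le> real D * (real D + 1) * h * real ?n"
  proof -
    show "0 \<le> w * h"
      using h by (simp add: w_def)
    have "w \<le> real (D * (D + 1) * ?n)"
      unfolding w_def using W(2) of_nat_le_iff by blast
    then have "w * h \<le> real (D * (D + 1) * ?n) * h"
      using h by (intro mult_right_mono) auto
    then show "w * h \<le> real D * (real D + 1) * h * real ?n"
      by (simp add: algebra_simps)
  qed
  have w2: "(w * h)\<^sup>2 \<le> (real D * (real D + 1) * h)\<^sup>2 * (real ?n)\<^sup>2"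
    using power_mono[OF w(2) w(1), of 2] by (simp add: power_mult_distrib)
  show ?case
  \<comment> \<open>The recursion needs a nonnegative weight \<open>1 - w * h\<close>. Where this
    fails, the term newly added to \<open>step_err\<close> alone makes the right-hand side at least
    1; for empty \<open>A\<close> the power with exponent 0 is 1.\<close>
  proof (cases "A = {} \<or> 1 < w * h")
    case True
    then show ?thesis
    proof
      assume "1 < w * h"
      then have "1 \<le> (w * h)\<^sup>2"
        by (simp add: one_le_power)
      also note w2
      also have "(real D * (real D + 1) * h)\<^sup>2 * (real ?n)\<^sup>2 \<le> ?a' * (real ?n)\<^sup>2"
        using a(1) h by (intro mult_right_mono) simp_all
      also have "\<dots> \<le> ?q' ^ ?n + ?a' * (real ?n)\<^sup>2"
        using q(2) by (simp del: ext_prob.simps)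
      finally show ?thesis
        using p_empty_bounds(2) order_trans by blast
    qed (simp add: p_empty_bounds)
  next
    case False
    then have wh: "w * h \<le> 1" and n: "1 \<le> ?n"
      using A(1) by (auto simp: Suc_le_eq card_gt_0_iff)
    obtain b where b: "b \<le> D * ?n"
      and sum: "\<And>f :: nat \<Rightarrow> real. (\<Sum>e\<in>?W. f (card (dual_step A e)) - f ?n) = real b * (f (?n + 1) + f (?n - 1) - 2 * f ?n)"
      using sum_dual_step[OF A D W(1)] by metis
    have IH: "p_empty (real k * h) (dual_step A e) \<le> f (card (dual_step A e))" if "e \<in> ?W" for e
      unfolding f_def using that watched_arcs_subset[of G A] by (intro Suc.IH dual_step_pverts[OF A]) auto
    have "real (Suc k) * h = real k * h + h"
      by (simp add: algebra_simps)
    then have "p_empty (real (Suc k) * h) A \<le> (1 - w * h) * p_empty (real k * h) A +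
        h * (\<Sum>e\<in>?W. p_empty (real k * h) (dual_step A e)) + (w * h)\<^sup>2"
      using p_empty_step[OF A _ h(1) W(1), of "real k * h"] h by (simp add: w_def)
    also have "\<dots> \<le> (1 - w * h) * f ?n + h * (\<Sum>e\<in>?W. f (card (dual_step A e))) + (w * h)\<^sup>2"
      using wh h Suc.IH[OF A] IH by (intro add_mono mult_left_mono sum_mono order_refl) (auto simp: f_def)
    also have "\<dots> = f ?n + h * (\<Sum>e\<in>?W. f (card (dual_step A e)) - f ?n) + (w * h)\<^sup>2"
      by (simp add: sum_subtractf w_def algebra_simps)
    also have "\<dots> = f ?n + real b * h * (f (?n + 1) + f (?n - 1) - 2 * f ?n) + (w * h)\<^sup>2"
      unfolding sum by (simp add: algebra_simps)
    also have "f (?n + 1) + f (?n - 1) - 2 * f ?n = ?q ^ (?n - 1) * (1 - ?q)\<^sup>2 + 2 * ?a"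
    proof -
      obtain m where m: "?n = Suc m"
        using n by (cases ?n) auto
      show ?thesis
        unfolding m f_def by (simp add: power2_eq_square algebra_simps)
    qed
    \<comment> \<open>The second difference is nonnegative, so the number of boundary edges may be
      replaced by its maximum. The factor \<open>card A\<close> left with the error term is then
      bounded by its square.\<close>
    also have "real b * h * (?q ^ (?n - 1) * (1 - ?q)\<^sup>2 + 2 * ?a) \<le>
        real (D * ?n) * h * (?q ^ (?n - 1) * (1 - ?q)\<^sup>2 + 2 * ?a)"
      using b h q a by (intro mult_right_mono) (simp_all del: of_nat_mult)
    also have "\<dots> = real ?n * ?q ^ (?n - 1) * (D * h * (1 - ?q)\<^sup>2) + ?a * (2 * D * h) * real ?n"
      by (simp add: algebra_simps)
    also have "?a * (2 * D * h) * real ?n \<le> ?a * (2 * D * h) * (real ?n)\<^sup>2"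
      using a h n by (intro mult_left_mono) (auto simp: power2_eq_square)
    finally have "p_empty (real (Suc k) * h) A \<le> (?q ^ ?n + real ?n * ?q ^ (?n - 1) * (D * h * (1 - ?q)\<^sup>2)) +
        (?a * (1 + 2 * D * h) * (real ?n)\<^sup>2 + (w * h)\<^sup>2)"
      by (simp add: f_def algebra_simps)
    also have "\<dots> \<le> ?q' ^ ?n + ?a' * (real ?n)\<^sup>2"
    proof (rule add_mono)
      obtain m where m: "?n = Suc m"
        using n by (cases ?n) auto
      show "?q ^ ?n + real ?n * ?q ^ (?n - 1) * (D * h * (1 - ?q)\<^sup>2) \<le> ?q' ^ ?n"
        using power_add_ge_linear[of ?q "D * h * (1 - ?q)\<^sup>2" m] q(1) h unfolding m by simp
      show "?a * (1 + 2 * D * h) * (real ?n)\<^sup>2 + (w * h)\<^sup>2 \<le> ?a' * (real ?n)\<^sup>2"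
        using w2 by (simp add: algebra_simps)
    qed
    finally show ?thesis .
  qed
qed

text \<open>The comparison for the singleton \<open>{v}\<close> with \<open>k\<close> steps of size
  \<open>s / k\<close>. The discrete solution tends to \<open>1 / (1 + D * s)\<close> and the error
  vanishes as \<open>k\<close> grows.\<close>

theorem p_occ_ge:
  assumes D: "\<And>x. x \<in> pverts G \<Longrightarrow> out_degree G x \<le> D" and v: "v \<in> pverts G" and s: "0 \<le> s"
  shows "1 / (1 + real D * s) \<le> p_occ v s"
proof (cases "s = 0")
  case True
  then show ?thesis
    using occupied_0[OF v] by (simp add: p_occ_def[OF v] prob_space)
next
  case False
  then have s: "0 < s"
    using s by simp
  have compl: "p_empty s {v} = 1 - p_occ v s"
  proof -
    have "{\<omega>\<in>space M. \<forall>y\<in>{v}. \<not> occupied G (\<lambda>e. T e \<omega>) s y} = space M - {\<omega>\<in>space M. occupied G (\<lambda>e. T e \<omega>) s v}"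
      by auto
    then show ?thesis
      using prob_compl[OF sets_occ[OF v, of s]] by (simp add: p_empty_def p_occ_def[OF v])
  qed
  \<comment> \<open>The bound of \<open>step_err_le\<close> at \<open>h = s / k\<close>, where
    \<open>h\<^sup>2 * k\<close> is \<open>s\<^sup>2 / k\<close> and
    \<open>(1 + 2 * D * h) ^ k\<close> is at most \<open>exp (2 * D * s)\<close>.\<close>
  let ?err = "\<lambda>k :: nat. (real D * (real D + 1))\<^sup>2 * s\<^sup>2 * (exp (2 * D * s) / real k)"
  have bound: "1 / (1 + D * s / (1 - D * s / real k)) - ?err k \<le> p_occ v s" if k: "real D * s < real k" for k
  proof -
    have kpos: "0 < real k"
      using k s by (meson le_less_trans mult_nonneg_nonneg of_nat_0_le_iff less_imp_le)
    define h where "h = s / real k"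
    have h: "0 < h" "real D * h < 1" "real k * h = s"
      using s k kpos by (auto simp: h_def)
    have "p_empty (real k * h) {v} \<le> ext_prob D h k ^ card {v} + step_err D h k * (real (card {v}))\<^sup>2"
      by (rule p_empty_le[OF D h(1,2)]) (use v in auto)
    then have "1 - ext_prob D h k - step_err D h k \<le> p_occ v s"
      using compl h(3) by simp
    moreover have "1 / (1 + D * s / (1 - D * s / real k)) \<le> 1 - ext_prob D h k"
    proof -
      have eq: "1 + real k * (D * h / (1 - D * h)) = 1 + D * s / (1 - D * s / real k)"
        using kpos by (simp add: h_def)
      have "1 / (1 + real k * (D * h / (1 - D * h))) \<le> 1 - ext_prob D h k"
        using ext_prob_bounds[of D h k] h by simp
      then show ?thesis
        unfolding eq .
    qed
    moreover have "step_err D h k \<le> ?err k"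
    proof -
      have "(1 + 2 * D * h) ^ k \<le> exp (2 * D * h) ^ k"
        using h(1) exp_ge_add_one_self[of "2 * D * h"] by (intro power_mono) auto
      also have "\<dots> = exp (2 * D * s)"
        using h(3) by (simp add: exp_of_nat_mult[symmetric] algebra_simps)
      finally have "(real D * (real D + 1))\<^sup>2 * h\<^sup>2 * real k * (1 + 2 * D * h) ^ k \<le>
          (real D * (real D + 1))\<^sup>2 * h\<^sup>2 * real k * exp (2 * D * s)"
        by (intro mult_left_mono) auto
      also have "\<dots> = ?err k"
        using kpos by (simp add: h_def power2_eq_square)
      finally show ?thesis
        using step_err_le[of D h k] h by simp
    qed
    ultimately show ?thesis
      by linarith
  qed
  have "(\<lambda>k :: nat. 1 / (1 + D * s / (1 - D * s / real k)) - ?err k) \<longlonglongrightarrow>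
      1 / (1 + D * s / (1 - 0)) - (real D * (real D + 1))\<^sup>2 * s\<^sup>2 * 0"
    using s by (intro tendsto_intros lim_const_over_n) (auto simp: add_nonneg_eq_0_iff)
  then have lim: "(\<lambda>k :: nat. 1 / (1 + D * s / (1 - D * s / real k)) - ?err k) \<longlonglongrightarrow> 1 / (1 + D * s)"
    by simp
  have "eventually (\<lambda>k. real D * s < real k) sequentially"
    using filterlim_real_sequentially by (simp add: filterlim_at_top_dense)
  then have "eventually (\<lambda>k. 1 / (1 + D * s / (1 - D * s / real k)) - ?err k \<le> p_occ v s) sequentially"
    by eventually_elim (rule bound)
  then show ?thesis
    by (rule tendsto_upperbound[OF lim]) simp
qed

end

section \<open>Countability of the graph, the explicit integral and the conclusion\<close>

text \<open>\<open>connected\<close> speaks of reachability in the symmetric closure, whose arcs are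
  already arcs of \<open>G\<close>. The set reachable from one vertex is countable because local
  finiteness keeps images of countable sets countable.\<close>

lemma countable_pverts:
  assumes graph: "pair_bidirected_digraph G"
    and conn: "Digraph_Component.connected (with_proj G)"
    and locfin: "locally_finite_graph G"
  shows "countable (pverts G)"
proof -
  interpret pair_bidirected_digraph G by fact
  have ne: "pverts G \<noteq> {}" and reach: "\<And>x y. x \<in> pverts G \<Longrightarrow> y \<in> pverts G \<Longrightarrow> x \<rightarrow>\<^sup>*\<^bsub>with_proj (mk_symmetric (with_proj G))\<^esub> y"
    using conn unfolding connected_def strongly_connected_def by (auto simp: mk_symmetric_def)
  obtain v where v: "v \<in> pverts G"
    using ne by auto
  have arcs: "parcs (mk_symmetric (with_proj G)) \<subseteq> parcs G"
    using arcs_symmetric by (auto simp: mk_symmetric_def)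
  have "(v, x) \<in> (parcs G)\<^sup>*" if "x \<in> pverts G" for x
  proof -
    have "(v, x) \<in> (parcs (mk_symmetric (with_proj G)))\<^sup>*"
      using reach[OF v that] rtrancl_on_rtranclI unfolding reachable_def by auto
    then show ?thesis
      using rtrancl_mono[OF arcs] by blast
  qed
  then have "pverts G \<subseteq> (parcs G)\<^sup>* `` {v}"
    by auto
  moreover have "countable ((parcs G)\<^sup>* `` {v})"
  proof (rule countable_rtrancl)
    fix Y :: "'a set" assume "countable Y"
    have "parcs G `` Y \<subseteq> (\<Union>y\<in>Y \<inter> pverts G. snd ` out_arcs G y)"
      using in_arcsD1 by (force simp: out_arcs_def)
    moreover have "countable (\<Union>y\<in>Y \<inter> pverts G. snd ` out_arcs G y)"
      using \<open>countable Y\<close> locfin unfolding locally_finite_graph_def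
      by (intro countable_UN countable_Int1 countable_image) (auto intro: countable_finite)
    ultimately show "countable (parcs G `` Y)"
      by (rule countable_subset)
  qed simp
  ultimately show ?thesis
    by (rule countable_subset)
qed

lemma inverse_linear_integral:
  fixes d t u :: real
  assumes "0 < d" "0 \<le> t" "t \<le> u"
  shows "set_integrable lborel {t..u} (\<lambda>s. 1 / (1 + d * s))"
    and "(LBINT s:{t..u}. 1 / (1 + d * s)) = 1 / d * (ln (1 + d * u) - ln (1 + d * t))"
proof -
  have pos: "0 < 1 + d * s" if "t \<le> s" for s
    using that assms by (intro add_pos_nonneg mult_nonneg_nonneg) auto
  have cont: "continuous_on {t..u} (\<lambda>s. 1 / (1 + d * s))"
    by (intro continuous_intros) (use pos in force)
  show "set_integrable lborel {t..u} (\<lambda>s. 1 / (1 + d * s))"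
    by (rule borel_integrable_atLeastAtMost'[OF cont])
  have "(LBINT s:{t..u}. 1 / (1 + d * s)) = 1 / d * ln (1 + d * u) - 1 / d * ln (1 + d * t)"
    unfolding set_lebesgue_integral_def
  proof (rule integral_FTC_Icc[OF assms(3) _ cont])
    fix s assume s: "t \<le> s" "s \<le> u"
    show "((\<lambda>s. 1 / d * ln (1 + d * s)) has_vector_derivative 1 / (1 + d * s)) (at s within {t..u})"
      unfolding has_real_derivative_iff_has_vector_derivative[symmetric]
      by (rule derivative_eq_intros refl | use pos[OF s(1)] assms in simp)+
  qed
  then show "(LBINT s:{t..u}. 1 / (1 + d * s)) = 1 / d * (ln (1 + d * u) - ln (1 + d * t))"
    by (simp add: algebra_simps)
qed

lemma log_bound_bigo:
  fixes t d c :: real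
  assumes "0 \<le> t" "0 < d"
  shows "(\<lambda>u. t / (t + 1 / d * (ln (1 + d * u) - c))) \<in> O[at_top](\<lambda>u. 1 / ln u)"
proof (cases "t = 0")
  case False
  then have "0 < t"
    using assms by simp
  then show ?thesis
    using assms by real_asymp
qed simp

text \<open>The measurability and integrability clauses ensure that the probabilities and integrals
  are genuine, and not the default value 0 of a nonmeasurable set or a nonintegrable
  function.\<close>

theorem corollary3:
  fixes G :: "'v pair_pre_digraph" and M :: "'w measure"
    and T :: "'v \<times> 'v \<Rightarrow> 'w \<Rightarrow> real set" and v :: 'v
  assumes graph: "pair_bidirected_digraph G"
    and conn: "Digraph_Component.connected (with_proj G)"
    and locfin: "locally_finite_graph G"
    and prob: "prob_space M"
    and clocks: "indep_unit_clocks M G T"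
    and v: "v \<in> pverts G"
  shows
    "(\<forall>s\<ge>0. {\<omega> \<in> space M. crw G T s \<omega> v = 1} \<in> sets M) \<and>
     (\<forall>t\<ge>0. next_occ G T v t \<in> borel_measurable M) \<and>
     (\<forall>t u. 0 \<le> t \<and> t < u \<longrightarrow>
        set_integrable lborel {t..u} (occ_prob M G T v) \<and>
        \<P>(\<omega> in M. next_occ G T v t \<omega> > ereal u)
          \<le> t / (t + (LBINT s:{t..u}. occ_prob M G T v s))) \<and>
     (\<forall>D::nat. has_max_degree G D \<and> 1 \<le> D \<longrightarrow>
        (\<forall>t u. 0 \<le> t \<and> t < u \<longrightarrow>
           \<P>(\<omega> in M. next_occ G T v t \<omega> > ereal u)
             \<le> t / (t + 1 / real D * (ln (1 + real D * u) - ln (1 + real D * t)))) \<and>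
        (\<forall>t\<ge>0. (\<lambda>u. t / (t + 1 / real D * (ln (1 + real D * u) - ln (1 + real D * t))))
                  \<in> O[at_top](\<lambda>u. 1 / ln u)))"
proof -
  interpret pair_bidirected_digraph G by fact
  interpret prob_space M by fact
  interpret crw_clocks G M T
  proof unfold_locales
    show "locally_finite_graph G" "countable (pverts G)"
      using countable_pverts[OF graph conn locfin] locfin by auto
    show "poisson_process M 1 (T e)" if "e \<in> parcs G" for e
      using clocks that unfolding indep_unit_clocks_def by blast
    show "indep_vars (\<lambda>_. path_space) (\<lambda>e \<omega>. counting (T e \<omega>)) (parcs G)"
      using clocks unfolding indep_unit_clocks_def counting_def by blast
  qed
  have occ_prob: "occ_prob M G T v = p_occ v"
    by (rule ext) (simp only: occ_prob_def crw_eq_1_iff p_occ_def[OF v])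
  have gap: "\<P>(\<omega> in M. next_occ G T v t \<omega> > ereal u) = p_gap v t u" for t u
    by (simp only: next_occ_eq p_gap_def[OF v])
  have occ_meas: "{\<omega> \<in> space M. crw G T s \<omega> v = 1} \<in> sets M" for s
    unfolding crw_eq_1_iff by (rule sets_occ[OF v])
  have next_meas: "next_occ G T v t \<in> borel_measurable M" for t
    unfolding next_occ_eq[abs_def] by (rule measurable_next_occupied[OF clock_space v])
  have degree: "p_gap v t u \<le> t / (t + 1 / real D * (ln (1 + real D * u) - ln (1 + real D * t)))"
    if D: "has_max_degree G D" "1 \<le> D" and t: "0 \<le> t" "t < u" for D t u
  proof -
    let ?J = "1 / real D * (ln (1 + real D * u) - ln (1 + real D * t))"
    have deg: "out_degree G x \<le> D" if "x \<in> pverts G" for x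
      using D(1) that unfolding has_max_degree_def by blast
    have d: "0 < real D"
      using D(2) by simp
    have "?J = (LBINT s:{t..u}. 1 / (1 + real D * s))"
      using inverse_linear_integral(2)[OF d t(1)] t(2) by simp
    also have "\<dots> \<le> (LBINT s:{t..u}. p_occ v s)"
      using t p_occ_ge[OF deg v]
      by (intro set_integral_mono inverse_linear_integral(1)[OF d] set_integrable_p_occ[OF v]) auto
    finally have le: "?J \<le> (LBINT s:{t..u}. p_occ v s)" .
    have "0 < 1 + real D * t" "1 + real D * t < 1 + real D * u"
      using d t by (auto intro: add_pos_nonneg)
    then have "ln (1 + real D * t) < ln (1 + real D * u)"
      by (subst ln_less_cancel_iff) linarith+
    \<comment> \<open>Strict positivity keeps the denominator positive even for
      \<open>t = 0\<close>, as the comparison of the two fractions requires.\<close>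
    then have J: "0 < ?J"
      using d by simp
    have "p_gap v t u \<le> t / (t + (LBINT s:{t..u}. p_occ v s))"
      by (rule p_gap_bound[OF v t])
    also have "\<dots> \<le> t / (t + ?J)"
      using le J t by (intro divide_left_mono mult_pos_pos) auto
    finally show ?thesis .
  qed
  have bigo: "(\<lambda>u. t / (t + 1 / real D * (ln (1 + real D * u) - ln (1 + real D * t)))) \<in> O[at_top](\<lambda>u. 1 / ln u)"
    if "1 \<le> D" "0 \<le> t" for D :: nat and t
    by (rule log_bound_bigo) (use that in simp_all)
  show ?thesis
    unfolding occ_prob gap
    using occ_meas next_meas set_integrable_p_occ[OF v] p_gap_bound[OF v] degree bigo by blast
qed

end
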